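(* Let $(\mathbb{X},\mathcal{B},\mu)$ be a standard probability space without atoms, and let $\mathrm{MPT}$ be the space of $\mu$-preserving essential bijections on $\mathbb{X}$, endowed with the weak topology. Then: (a) There is a dense set of transformations $T\in\mathrm{MPT}$ such that, for each such $T$, the collection of asymptotically linearly predictive observables $f$ is prevalent and generic in $L^2_\mu$. (b) For a generic set of transformations $T\in\mathrm{MPT}$, the collection of asymptotically linearly predictive observables $f$ is generic in $L^2_\mu$. (c) There is a dense set of transformations $T\in \mathrm{MPT}$ such that, for each such $T$, every observable $f\in L^2_\mu$ is weakly linearly asymptotically predictive. Specifically, this conclusion (every $f\in L^2_\mu$ is weakly linearly asymptotically predictive) holds for all $T\in\mathrm{MPT}$ with discrete spectrum.
   Context: A standard probability space without atoms is a probability space isomorphic modulo null sets to $[0,1]$ with Lebesgue measure. $\mathrm{MPT}$ is the set of maps $T:\mathbb{X}\to\mathbb{X}$ that are, after removing null sets, invertible with $T,T^{-1}$ measurable and $\mu$-preserving; maps agreeing up to a null set are identified. The weak topology on $\mathrm{MPT}$ has as subbasis the sets $\{S\in\mathrm{MPT} : \mu(TE\,\triangle\,SE)<\varepsilon\}$ with $T\in\mathrm{MPT}$, $E$ measurable, $\varepsilon>0$. $L^2_\mu=L^2_\mu(\mathbb{X})$ is the space of complex-valued square-integrable functions with its norm topology. The Koopman operator of $T$ is $\mathcal{U}_T:L^2_\mu\to L^2_\mu$, $\mathcal{U}_Tf=f\circ T$ (a unitary operator for $T\in\mathrm{MPT}$). For a unitary operator $\mathcal{V}$ on $L^2_\mu$,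 a vector $f$ is cyclic for $\mathcal{V}$ if $\overline{\mathrm{span}\{f,\mathcal{V}f,\mathcal{V}^2f,\ldots\}}=L^2_\mu$ (only nonnegative powers). For given $T$, an observable $f\in L^2_\mu$ is asymptotically linearly predictive if $f$ is a cyclic vector of $\mathcal{U}_T^{-1}=\mathcal{U}_{T^{-1}}$. Put $\mathcal{K}_d=\mathrm{span}\{f,f\circ T^{-1},\ldots,f\circ T^{-d+1}\}$. The observable $f$ is weakly linearly asymptotically predictive if $f\circ T\in\overline{\bigcup_{d\in\mathbb{N}}\mathcal{K}_d}$ (closure in $L^2_\mu$). A subset of a topological space is a $G_\delta$ set if it is a countable intersection of open sets; a set is generic if it contains a dense $G_\delta$ set. A subset $\mathbb{S}$ of a complex vector space $\mathbb{V}$ is prevalent if there is a finite-dimensional subspace $\mathbb{E}\subset\mathbb{V}$ such that for every $v\in\mathbb{V}$, Lebesgue-almost every point of $v+\mathbb{E}$ belongs to $\mathbb{S}$. $T$ has discrete spectrum if $\mathcal{U}_T$ has a countable set of eigenvalues with associated eigenfunctions yielding an orthonormal basis of $L^2_\mu$. *)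

theory Defs
  imports "HOL-Probability.Probability"
begin

section \<open>Isomorphisms modulo null sets\<close>

definition iso_mod_null ::
  "'a measure \<Rightarrow> 'b measure \<Rightarrow> 'a set \<Rightarrow> 'b set \<Rightarrow> ('a \<Rightarrow> 'b) \<Rightarrow> bool"
where
  "iso_mod_null M N A B f \<longleftrightarrow>
     A \<in> null_sets M \<and> B \<in> null_sets N \<and>
     bij_betw f (space M - A) (space N - B) \<and>
     f \<in> restrict_space M (space M - A) \<rightarrow>\<^sub>M restrict_space N (space N - B) \<and>
     inv_into (space M - A) f \<in> restrict_space N (space N - B) \<rightarrow>\<^sub>M restrict_space M (space M - A) \<and>
     distr (restrict_space M (space M - A)) (restrict_space N (space N - B)) f
       = restrict_space N (space N - B)"

text \<open>
  Both usual conventions for the \<open>\<sigma>\<close>-algebra of the model space \<open>[0,1]\<close> are admitted: the Borel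
  sets and the Lebesgue (completed) sets.
\<close>

definition standard_nonatomic_prob_space :: "'a measure \<Rightarrow> bool" where
  "standard_nonatomic_prob_space M \<longleftrightarrow>
     prob_space M \<and>
     ((\<exists>A B f. iso_mod_null M (restrict_space lborel {0..1::real}) A B f) \<or>
      (\<exists>A B f. iso_mod_null M (lebesgue_on {0..1::real}) A B f))"


section \<open>Classes of functions modulo almost everywhere equality\<close>

definition ae_rel :: "'a measure \<Rightarrow> ('a \<Rightarrow> 'b) set \<Rightarrow> (('a \<Rightarrow> 'b) \<times> ('a \<Rightarrow> 'b)) set" where
  "ae_rel M X = {(f, g). f \<in> X \<and> g \<in> X \<and> (AE x in M. f x = g x)}"

definition rep :: "('a \<Rightarrow> 'b) set \<Rightarrow> 'a \<Rightarrow> 'b" where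
  "rep C = (SOME f. f \<in> C)"


section \<open>The space of measure-preserving essential bijections\<close>

text \<open>
  Representatives are taken to be measurable on all of the space. This costs no generality: a map
  that is only measurable off a null set can be redefined to be constant on that set, without
  changing its class.
\<close>

definition mpt_maps :: "'a measure \<Rightarrow> ('a \<Rightarrow> 'a) set" where
  "mpt_maps M = {T. T \<in> M \<rightarrow>\<^sub>M M \<and> (\<exists>A B. iso_mod_null M M A B T)}"

definition MPT :: "'a measure \<Rightarrow> ('a \<Rightarrow> 'a) set set" where
  "MPT M = mpt_maps M // ae_rel M (mpt_maps M)"

definition mpt_inv :: "'a measure \<Rightarrow> ('a \<Rightarrow> 'a) set \<Rightarrow> ('a \<Rightarrow> 'a) set" where
  "mpt_inv M T = {S \<in> mpt_maps M. AE x in M. S (rep T x) = x \<and> rep T (S x) = x}"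

text \<open>
  The image \<open>T E\<close> is formed after removing from \<open>E\<close> a null set off which the representative \<open>t\<close> is
  bijective and bimeasurable: the plain image of \<open>E\<close> under \<open>t\<close> need not be measurable, and could be
  large even for a null set \<open>E\<close>. Up to null sets the result does not depend on the choice of the
  representatives or of the removed sets.
\<close>

definition weak_nbhd ::
  "'a measure \<Rightarrow> ('a \<Rightarrow> 'a) set \<Rightarrow> 'a set \<Rightarrow> real \<Rightarrow> ('a \<Rightarrow> 'a) set set"
where
  "weak_nbhd M T E \<epsilon> =
     {S \<in> MPT M. \<exists>t\<in>T. \<exists>s\<in>S. \<exists>A B C D.
        iso_mod_null M M A B t \<and> iso_mod_null M M C D s \<and>
        measure M (sym_diff (t ` (E - A)) (s ` (E - C))) < \<epsilon>}"

definition weak_topology :: "'a measure \<Rightarrow> ('a \<Rightarrow> 'a) set topology" where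
  "weak_topology M =
     topology_generated_by {weak_nbhd M T E \<epsilon> | T E \<epsilon>. T \<in> MPT M \<and> E \<in> sets M \<and> \<epsilon> > 0}"


section \<open>The complex Hilbert space of square-integrable functions\<close>

definition l2_fun :: "'a measure \<Rightarrow> ('a \<Rightarrow> complex) set" where
  "l2_fun M = {f \<in> borel_measurable M. integrable M (\<lambda>x. (cmod (f x))\<^sup>2)}"

definition L2 :: "'a measure \<Rightarrow> ('a \<Rightarrow> complex) set set" where
  "L2 M = l2_fun M // ae_rel M (l2_fun M)"

definition l2_class :: "'a measure \<Rightarrow> ('a \<Rightarrow> complex) \<Rightarrow> ('a \<Rightarrow> complex) set" where
  "l2_class M f = ae_rel M (l2_fun M) `` {f}"

definition l2_zero :: "'a measure \<Rightarrow> ('a \<Rightarrow> complex) set" where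
  "l2_zero M = l2_class M (\<lambda>x. 0)"

definition l2_add ::
  "'a measure \<Rightarrow> ('a \<Rightarrow> complex) set \<Rightarrow> ('a \<Rightarrow> complex) set \<Rightarrow> ('a \<Rightarrow> complex) set"
where
  "l2_add M F G = l2_class M (\<lambda>x. rep F x + rep G x)"

definition l2_scale ::
  "'a measure \<Rightarrow> complex \<Rightarrow> ('a \<Rightarrow> complex) set \<Rightarrow> ('a \<Rightarrow> complex) set"
where
  "l2_scale M c F = l2_class M (\<lambda>x. c * rep F x)"

definition l2_inner :: "'a measure \<Rightarrow> ('a \<Rightarrow> complex) set \<Rightarrow> ('a \<Rightarrow> complex) set \<Rightarrow> complex" where
  "l2_inner M F G = (\<integral>x. rep F x * cnj (rep G x) \<partial>M)"

definition l2_dist :: "'a measure \<Rightarrow> ('a \<Rightarrow> complex) set \<Rightarrow> ('a \<Rightarrow> complex) set \<Rightarrow> real" where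
  "l2_dist M F G = sqrt (\<integral>x. (cmod (rep F x - rep G x))\<^sup>2 \<partial>M)"

definition L2_topology :: "'a measure \<Rightarrow> ('a \<Rightarrow> complex) set topology" where
  "L2_topology M = Metric_space.mtopology (L2 M) (l2_dist M)"

definition l2_lincomb ::
  "'a measure \<Rightarrow> nat \<Rightarrow> (nat \<Rightarrow> complex) \<Rightarrow> (nat \<Rightarrow> ('a \<Rightarrow> complex) set) \<Rightarrow> ('a \<Rightarrow> complex) set"
where
  "l2_lincomb M n c e = l2_class M (\<lambda>x. \<Sum>i<n. c i * rep (e i) x)"

definition l2_span :: "'a measure \<Rightarrow> ('a \<Rightarrow> complex) set set \<Rightarrow> ('a \<Rightarrow> complex) set set" where
  "l2_span M S = {l2_lincomb M n c e | n c e. \<forall>i<n. e i \<in> S}"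


section \<open>Generic and prevalent sets\<close>

definition dense_in :: "'b topology \<Rightarrow> 'b set \<Rightarrow> bool" where
  "dense_in X D \<longleftrightarrow> D \<subseteq> topspace X \<and> X closure_of D = topspace X"

definition generic_in :: "'b topology \<Rightarrow> 'b set \<Rightarrow> bool" where
  "generic_in X S \<longleftrightarrow> S \<subseteq> topspace X \<and> (\<exists>G. gdelta_in X G \<and> dense_in X G \<and> G \<subseteq> S)"

text \<open>
  The finite-dimensional subspace is given by a basis \<open>e 0, \<dots>, e (n - 1)\<close>, whose coordinates identify
  it with \<open>\<complex>\<^sup>n\<close>; the resulting notion of a Lebesgue-null set does not depend on the basis.
\<close>

definition prevalent_in_L2 :: "'a measure \<Rightarrow> ('a \<Rightarrow> complex) set set \<Rightarrow> bool" where
  "prevalent_in_L2 M S \<longleftrightarrow> S \<subseteq> L2 M \<and>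
     (\<exists>n e. (\<forall>i<n. e i \<in> L2 M) \<and>
        (\<forall>c. l2_lincomb M n c e = l2_zero M \<longrightarrow> (\<forall>i<n. c i = 0)) \<and>
        (\<forall>v\<in>L2 M. AE c in (\<Pi>\<^sub>M i\<in>{..<n}. (lborel :: complex measure)).
            l2_add M v (l2_lincomb M n c e) \<in> S))"


section \<open>Koopman operators and linear predictivity\<close>

definition koopman ::
  "'a measure \<Rightarrow> ('a \<Rightarrow> 'a) set \<Rightarrow> ('a \<Rightarrow> complex) set \<Rightarrow> ('a \<Rightarrow> complex) set"
where
  "koopman M T F = l2_class M (rep F \<circ> rep T)"

definition cyclic_vector ::
  "'a measure \<Rightarrow> (('a \<Rightarrow> complex) set \<Rightarrow> ('a \<Rightarrow> complex) set) \<Rightarrow> ('a \<Rightarrow> complex) set \<Rightarrow> bool"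
where
  "cyclic_vector M V f \<longleftrightarrow>
     f \<in> L2 M \<and> L2_topology M closure_of (l2_span M {(V ^^ k) f | k. True}) = L2 M"

definition asymp_lin_predictive ::
  "'a measure \<Rightarrow> ('a \<Rightarrow> 'a) set \<Rightarrow> ('a \<Rightarrow> complex) set \<Rightarrow> bool"
where
  "asymp_lin_predictive M T f \<longleftrightarrow> cyclic_vector M (koopman M (mpt_inv M T)) f"

definition delay_space ::
  "'a measure \<Rightarrow> ('a \<Rightarrow> 'a) set \<Rightarrow> ('a \<Rightarrow> complex) set \<Rightarrow> nat \<Rightarrow> ('a \<Rightarrow> complex) set set"
where
  "delay_space M T f d = l2_span M {(koopman M (mpt_inv M T) ^^ k) f | k. k < d}"

definition weakly_lin_asymp_predictive ::
  "'a measure \<Rightarrow> ('a \<Rightarrow> 'a) set \<Rightarrow> ('a \<Rightarrow> complex) set \<Rightarrow> bool"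
where
  "weakly_lin_asymp_predictive M T f \<longleftrightarrow>
     f \<in> L2 M \<and> koopman M T f \<in> L2_topology M closure_of (\<Union>d. delay_space M T f d)"

definition eigenfunction ::
  "'a measure \<Rightarrow> ('a \<Rightarrow> 'a) set \<Rightarrow> complex \<Rightarrow> ('a \<Rightarrow> complex) set \<Rightarrow> bool"
where
  "eigenfunction M T \<alpha> f \<longleftrightarrow> f \<in> L2 M \<and> f \<noteq> l2_zero M \<and> koopman M T f = l2_scale M \<alpha> f"

definition orthonormal_basis_L2 :: "'a measure \<Rightarrow> ('a \<Rightarrow> complex) set set \<Rightarrow> bool" where
  "orthonormal_basis_L2 M B \<longleftrightarrow>
     B \<subseteq> L2 M \<and>
     (\<forall>f\<in>B. \<forall>g\<in>B. l2_inner M f g = (if f = g then 1 else 0)) \<and>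
     L2_topology M closure_of (l2_span M B) = L2 M"

definition discrete_spectrum :: "'a measure \<Rightarrow> ('a \<Rightarrow> 'a) set \<Rightarrow> bool" where
  "discrete_spectrum M T \<longleftrightarrow>
     (\<exists>\<Lambda> B. countable \<Lambda> \<and> (\<forall>\<alpha>\<in>\<Lambda>. \<exists>f. eigenfunction M T \<alpha> f) \<and>
        (\<forall>f\<in>B. \<exists>\<alpha>\<in>\<Lambda>. eigenfunction M T \<alpha> f) \<and> orthonormal_basis_L2 M B)"

end

theory Submission
  imports Defs
begin

text \<open>
  Write \<open>V\<close> for the Koopman operator of the inverse of \<open>T\<close>, so that \<open>f\<close> is asymptotically linearly
  predictive if the vectors \<open>V\<^sup>n f\<close> with \<open>n \<ge> 0\<close> span a dense subspace.

  Everything rests on a dense supply of transformations whose operator \<open>V\<close> has an orthonormal basis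
  of eigenvectors \<open>e k\<close> with distinct eigenvalues. For such a \<open>T\<close> the averages
  \<open>1/N \<Sum>\<^sub>j \<mu>\<^sup>j V\<^sup>j f\<close> over \<open>j < N\<close>, where \<open>\<mu>\<close> is the conjugate of the eigenvalue of \<open>e k\<close>, converge to the
  component of \<open>f\<close> along \<open>e k\<close> (\<open>mean_ergodic\<close>). They involve nonnegative powers only, so \<open>f\<close> is cyclic as
  soon as none of its coefficients vanishes (\<open>cyclicI\<close>). This is a countable conjunction of open dense
  conditions, which gives genericity; and along a complex line \<open>f + c g\<close>, where all coefficients of \<open>g\<close> are
  nonzero, it excludes countably many \<open>c\<close> only, which gives prevalence (\<open>prevalent_predictive\<close>).

  The supply consists of the irrational rotations \<open>u \<mapsto> u + a\<close> in a coordinate \<open>u\<close> that identifies the space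
  with the unit interval; the basis is \<open>exp (2 \<pi> i k u)\<close> (\<open>fourier_total\<close>, \<open>rotation_diagonal\<close>). The coordinate
  is arbitrary, and this is why these rotations are dense (\<open>irrational_rotations_dense\<close>): cut the interval into
  \<open>q\<close> equal cells, arrange the cells in a suitable cyclic order, and rotate by slightly more
  than \<open>1/q\<close>; this moves nearly every point to the next cell. To imitate a given \<open>T\<close> on finitely many
  sets the order has to send cells inside a set to cells inside its image. Reading cells as edges of a directed
  multigraph whose vertices are the possible patterns of membership, one looks for a nearly
  Eulerian circuit. The graph is nearly balanced because \<open>T\<close> preserves measure, and the number of its vertices does
  not grow with \<open>q\<close>, so the edges fall into few trails compared with \<open>q\<close> (\<open>exists_cyclic_ordering\<close>).

  For the second claim, the transformations for which every member of a countable base of balls contains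
  a vector that some polynomial in \<open>V\<close> brings close to a given \<open>e k\<close> form an intersection of countably many open
  sets, because \<open>V\<close> depends continuously on \<open>T\<close> (\<open>weakly_continuous_koopman\<close>). The intersection is dense since it
  contains the rotations, and for its members Baire's theorem in \<open>L\<^sup>2\<close> produces the cyclic
  vectors (\<open>generic_transformations\<close>).

  For discrete spectrum, Dirichlet's theorem makes \<open>V\<^sup>n f\<close> return close to \<open>f\<close> for some \<open>n \<ge> 1\<close>; then
  \<open>V\<^sup>n\<^sup>-\<^sup>1 f\<close> is close to the value \<open>f \<circ> T\<close> to be predicted (\<open>discrete_spectrum_weakly_predictive\<close>). The rotations
  have discrete spectrum, and this yields the remaining density claim.
\<close>

section \<open>Isomorphisms modulo null sets as pairs of total maps\<close>

text \<open>
  The pair of maps replaces the removed null sets and the partial inverse of an isomorphism modulo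
  null sets: both maps are total and measurable, and they are inverse to each other almost everywhere.
  Such pairs can be composed without keeping track of exceptional sets.
\<close>

definition ess_iso :: "'a measure \<Rightarrow> 'b measure \<Rightarrow> ('a \<Rightarrow> 'b) \<Rightarrow> ('b \<Rightarrow> 'a) \<Rightarrow> bool" where
  "ess_iso M N f g \<longleftrightarrow> f \<in> M \<rightarrow>\<^sub>M N \<and> g \<in> N \<rightarrow>\<^sub>M M \<and> distr M N f = N \<and>
     (AE x in M. g (f x) = x) \<and> (AE y in N. f (g y) = y)"

lemma ess_isoD:
  assumes "ess_iso M N f g"
  shows "f \<in> M \<rightarrow>\<^sub>M N" "g \<in> N \<rightarrow>\<^sub>M M" "distr M N f = N"
    "AE x in M. g (f x) = x" "AE y in N. f (g y) = y"
  using assms by (auto simp: ess_iso_def)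

text \<open>
  \<open>P\<close> need not be measurable: its exceptional set lies in a null set, and the preimage of that
  set is null.
\<close>

lemma AE_distr_pullback:
  assumes "f \<in> M \<rightarrow>\<^sub>M N" "distr M N f = N" "AE y in N. P y"
  shows "AE x in M. P (f x)"
  using AE_distrD[OF assms(1)] assms(2,3) by metis

lemma ess_iso_sym:
  assumes "ess_iso M N f g" shows "ess_iso N M g f"
proof -
  note f = ess_isoD[OF assms]
  have "distr N M g = distr (distr M N f) M g" by (simp only: f(3))
  also have "\<dots> = distr M M (g \<circ> f)" by (rule distr_distr[OF f(2,1)])
  also have "\<dots> = distr M M (\<lambda>x. x)" using f by (intro distr_cong_AE) auto
  also have "\<dots> = M" by (rule distr_id)
  finally show ?thesis using f unfolding ess_iso_def by auto
qed

lemma ess_iso_trans: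
  assumes "ess_iso M N f g" "ess_iso N P h k"
  shows "ess_iso M P (h \<circ> f) (g \<circ> k)"
proof -
  note f = ess_isoD[OF assms(1)] and h = ess_isoD[OF assms(2)]
  have "distr M P (h \<circ> f) = P" using f h distr_distr[of h N P f M] by simp
  moreover have "AE x in M. (g \<circ> k) ((h \<circ> f) x) = x"
    using AE_distr_pullback[OF f(1,3) h(4)] f(4) by eventually_elim auto
  moreover have "AE x in P. (h \<circ> f) ((g \<circ> k) x) = x"
    using AE_distr_pullback[OF h(2) ess_isoD(3)[OF ess_iso_sym[OF assms(2)]] f(5)] h(5)
    by eventually_elim auto
  ultimately show ?thesis using f h unfolding ess_iso_def by (auto intro: measurable_comp)
qed

lemma distr_eq_preimage_null:
  assumes "f \<in> M \<rightarrow>\<^sub>M N" "distr M N f = N" "Z \<in> null_sets N"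
  shows "f -` Z \<inter> space M \<in> null_sets M"
  using assms by (metis emeasure_distr measurable_sets null_setsD1 null_setsD2 null_setsI)

text \<open>
  The points where \<open>f\<close> and \<open>g\<close> fail to be inverse lie in null sets \<open>Z\<close> and \<open>Y\<close>. Removing these is
  not enough for a bijection; removing also \<open>f\<close>-preimages of \<open>Y\<close> and \<open>g\<close>-preimages of \<open>Z\<close> is.
\<close>

lemma ess_iso_imp_iso_mod_null:
  assumes "ess_iso M N f g"
  shows "\<exists>A B. iso_mod_null M N A B f"
proof -
  note f = ess_isoD[OF assms] and g = ess_isoD[OF ess_iso_sym[OF assms]]
  obtain Z where Z: "{x \<in> space M. g (f x) \<noteq> x} \<subseteq> Z" "Z \<in> null_sets M"
    using f(4) unfolding eventually_ae_filter by blast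
  obtain Y where Y: "{y \<in> space N. f (g y) \<noteq> y} \<subseteq> Y" "Y \<in> null_sets N"
    using f(5) unfolding eventually_ae_filter by blast
  define A where "A = Z \<union> (f -` Y \<inter> space M)"
  define B where "B = Y \<union> (g -` Z \<inter> space N)"
  have A: "A \<in> null_sets M" unfolding A_def
    by (intro null_sets.Un Z distr_eq_preimage_null[OF f(1,3)] Y)
  have B: "B \<in> null_sets N" unfolding B_def
    by (intro null_sets.Un Y distr_eq_preimage_null[OF g(1,3)] Z)
  have fs: "f x \<in> space N" if "x \<in> space M" for x using measurable_space[OF f(1) that] .
  have gs: "g x \<in> space M" if "x \<in> space N" for x using measurable_space[OF f(2) that] .
  have fg: "f x \<in> space N - B" "g (f x) = x" if "x \<in> space M - A" for x
    using that Z(1) Y(1) fs unfolding A_def B_def by auto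
  have gf: "g y \<in> space M - A" "f (g y) = y" if "y \<in> space N - B" for y
    using that Z(1) Y(1) gs unfolding A_def B_def by auto
  have bij: "bij_betw f (space M - A) (space N - B)"
    by (rule bij_betw_byWitness[where f' = g]) (use fg gf in auto)
  have inv: "inv_into (space M - A) f y = g y" if "y \<in> space N - B" for y
    using that gf by (metis bij bij_betw_inv_into_left)
  have mA: "space M - A \<in> sets M" and mB: "space N - B \<in> sets N" using A B by auto
  have mf: "f \<in> restrict_space M (space M - A) \<rightarrow>\<^sub>M restrict_space N (space N - B)"
    using fg by (auto intro!: measurable_restrict_space3 f)
  have "g \<in> restrict_space N (space N - B) \<rightarrow>\<^sub>M restrict_space M (space M - A)"
    using gf by (auto intro!: measurable_restrict_space3 f)
  then have mg: "inv_into (space M - A) f \<in> restrict_space N (space N - B) \<rightarrow>\<^sub>M restrict_space M (space M - A)"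
    by (subst measurable_cong[where g = g]) (auto simp: space_restrict_space inv)
  have d: "distr (restrict_space M (space M - A)) (restrict_space N (space N - B)) f
       = restrict_space N (space N - B)"
  proof (rule measure_eqI)
    fix X assume "X \<in> sets (distr (restrict_space M (space M - A)) (restrict_space N (space N - B)) f)"
    then have X: "X \<in> sets (restrict_space N (space N - B))" by simp
    then have X': "X \<in> sets N" "X \<subseteq> space N - B"
      using mB by (auto simp: sets_restrict_space_iff)
    have "emeasure (distr (restrict_space M (space M - A)) (restrict_space N (space N - B)) f) X
       = emeasure (restrict_space M (space M - A)) (f -` X \<inter> space (restrict_space M (space M - A)))"
      by (rule emeasure_distr[OF mf X])
    also have "\<dots> = emeasure M (f -` X \<inter> space (restrict_space M (space M - A)))"
      using mA by (intro emeasure_restrict_space) (auto simp: space_restrict_space)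
    also have "\<dots> = emeasure M ((f -` X \<inter> space M) - A)"
      by (rule arg_cong[where f = "emeasure M"]) (auto simp: space_restrict_space)
    also have "\<dots> = emeasure M (f -` X \<inter> space M)"
      using A X' f by (intro emeasure_Diff_null_set) auto
    also have "\<dots> = emeasure (distr M N f) X"
      by (rule emeasure_distr[OF f(1) X'(1), symmetric])
    also have "\<dots> = emeasure N X" by (simp only: f(3))
    also have "\<dots> = emeasure (restrict_space N (space N - B)) X"
      using mB X' by (intro emeasure_restrict_space[symmetric]) auto
    finally show "emeasure (distr (restrict_space M (space M - A)) (restrict_space N (space N - B)) f) X
      = emeasure (restrict_space N (space N - B)) X" .
  qed simp
  show ?thesis unfolding iso_mod_null_def using A B bij mf mg d by blast
qed

text \<open>
  The second conclusion turns images into preimages: the image of \<open>E - A\<close>, by which the weak topology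
  is defined, is up to the null set \<open>B\<close> the preimage of \<open>E\<close> under the inverse map.
\<close>

lemma iso_mod_null_imp_ess_iso:
  assumes i: "iso_mod_null M N A B f" and f: "f \<in> M \<rightarrow>\<^sub>M N" and a: "a \<in> space M"
  defines "g \<equiv> \<lambda>y. if y \<in> space N - B then inv_into (space M - A) f y else a"
  shows "ess_iso M N f g"
    and "E \<in> sets M \<Longrightarrow> f ` (E - A) = g -` E \<inter> (space N - B)"
proof -
  have A: "A \<in> null_sets M" and B: "B \<in> null_sets N" and bij: "bij_betw f (space M - A) (space N - B)"
    and mf: "f \<in> restrict_space M (space M - A) \<rightarrow>\<^sub>M restrict_space N (space N - B)"
    and mg: "inv_into (space M - A) f \<in> restrict_space N (space N - B) \<rightarrow>\<^sub>M restrict_space M (space M - A)"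
    and d: "distr (restrict_space M (space M - A)) (restrict_space N (space N - B)) f
       = restrict_space N (space N - B)"
    using i unfolding iso_mod_null_def by auto
  have mA: "space M - A \<in> sets M" and mB: "space N - B \<in> sets N" using A B by auto
  have fB: "f x \<in> space N - B" if "x \<in> space M - A" for x
    by (rule bij_betw_apply[OF bij that])
  have gf: "g (f x) = x" if "x \<in> space M - A" for x
    unfolding g_def using fB[OF that] bij_betw_inv_into_left[OF bij that] by simp
  have fg: "f (g y) = y" if "y \<in> space N - B" for y
    unfolding g_def using that bij_betw_inv_into_right[OF bij that] by simp
  have gA: "g y \<in> space M - A" if "y \<in> space N - B" for y
    unfolding g_def using that bij_betw_apply[OF bij_betw_inv_into[OF bij] that] by simp
  have AE1: "AE x in M. g (f x) = x"
    using AE_not_in[OF A] by (rule AE_mp) (auto intro!: AE_I2 gf)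
  have AE2: "AE x in N. f (g x) = x"
    using AE_not_in[OF B] by (rule AE_mp) (auto intro!: AE_I2 fg)
  have "inv_into (space M - A) f \<in> restrict_space N (space N - B) \<rightarrow>\<^sub>M M"
    using mg by (simp add: measurable_restrict_space2_iff)
  then have mg': "g \<in> N \<rightarrow>\<^sub>M M" unfolding g_def
    using measurable_restrict_space_iff[of "space N - B" N a M] a mB by (simp add: Int_absorb2)
  have "distr M N f = N"
  proof (rule measure_eqI)
    fix X assume "X \<in> sets (distr M N f)"
    then have X: "X \<in> sets N" by simp
    have XB: "X - B \<in> sets (restrict_space N (space N - B))"
      using mB X B sets.sets_into_space[OF X] by (auto simp: sets_restrict_space_iff)
    have eq: "(f -` (X - B) \<inter> (space M - A)) - A = (f -` X \<inter> space M) - A"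
      using fB by auto
    have m1: "f -` (X - B) \<inter> (space M - A) \<in> sets M"
      using measurable_sets[OF f, of "X - B"] X B mA by (metis Int_Diff null_setsD2 sets.Diff A)
    have "emeasure N X = emeasure N (X - B)" using B X by (simp add: emeasure_Diff_null_set)
    also have "\<dots> = emeasure (restrict_space N (space N - B)) (X - B)"
      using mB sets.sets_into_space[OF X] by (intro emeasure_restrict_space[symmetric]) auto
    also have "\<dots> = emeasure (restrict_space M (space M - A)) (f -` (X - B) \<inter> space (restrict_space M (space M - A)))"
      using emeasure_distr[OF mf XB] d by simp
    also have "\<dots> = emeasure M (f -` (X - B) \<inter> space (restrict_space M (space M - A)))"
      using mA by (intro emeasure_restrict_space) (auto simp: space_restrict_space)
    also have "\<dots> = emeasure M (f -` (X - B) \<inter> (space M - A))"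
      by (rule arg_cong[where f = "emeasure M"]) (auto simp: space_restrict_space)
    also have "\<dots> = emeasure M ((f -` (X - B) \<inter> (space M - A)) - A)"
      using emeasure_Diff_null_set[OF A m1] by simp
    also have "\<dots> = emeasure M (f -` X \<inter> space M)"
      unfolding eq using A X f by (intro emeasure_Diff_null_set) auto
    also have "\<dots> = emeasure (distr M N f) X" using f X by (simp add: emeasure_distr)
    finally show "emeasure (distr M N f) X = emeasure N X" by simp
  qed simp
  then show "ess_iso M N f g" using f mg' AE1 AE2 unfolding ess_iso_def by auto
  show "f ` (E - A) = g -` E \<inter> (space N - B)" if E: "E \<in> sets M"
  proof -
    have sub: "E \<subseteq> space M" using sets.sets_into_space[OF E] .
    show ?thesis
    proof (intro equalityI subsetI)
      fix y assume "y \<in> f ` (E - A)"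
      then obtain x where "x \<in> E" "x \<in> space M - A" "y = f x" using sub by auto
      then show "y \<in> g -` E \<inter> (space N - B)" using gf[of x] fB[of x] by simp
    next
      fix y assume y: "y \<in> g -` E \<inter> (space N - B)"
      then have "y = f (g y)" "g y \<in> E - A" using fg[of y] gA[of y] by auto
      then show "y \<in> f ` (E - A)" by (rule image_eqI)
    qed
  qed
qed

lemma iso_mod_null_extend:
  assumes i: "iso_mod_null M N A B f" and b: "b \<in> space N"
  defines "f' \<equiv> \<lambda>x. if x \<in> space M - A then f x else b"
  shows "iso_mod_null M N A B f'" "f' \<in> M \<rightarrow>\<^sub>M N"
proof -
  have A: "A \<in> null_sets M" and B: "B \<in> null_sets N" and bij: "bij_betw f (space M - A) (space N - B)"
    and mf: "f \<in> restrict_space M (space M - A) \<rightarrow>\<^sub>M restrict_space N (space N - B)"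
    and mg: "inv_into (space M - A) f \<in> restrict_space N (space N - B) \<rightarrow>\<^sub>M restrict_space M (space M - A)"
    and d: "distr (restrict_space M (space M - A)) (restrict_space N (space N - B)) f
       = restrict_space N (space N - B)"
    using i unfolding iso_mod_null_def by auto
  have ff: "f' x = f x" if "x \<in> space M - A" for x using that by (simp add: f'_def)
  have "inv_into (space M - A) f' y = inv_into (space M - A) f y" for y
    unfolding inv_into_def by (rule arg_cong[where f = Eps]) (auto simp: ff)
  then have inv: "inv_into (space M - A) f' = inv_into (space M - A) f" by auto
  have "bij_betw f' (space M - A) (space N - B)" using bij using bij_betw_cong[of "space M - A" f' f "space N - B"] ff by blast
  moreover have "f' \<in> restrict_space M (space M - A) \<rightarrow>\<^sub>M restrict_space N (space N - B)"
    using mf by (subst measurable_cong[where g = f]) (auto simp: ff space_restrict_space)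
  moreover have "distr (restrict_space M (space M - A)) (restrict_space N (space N - B)) f'
       = distr (restrict_space M (space M - A)) (restrict_space N (space N - B)) f"
    by (rule distr_cong) (auto simp: ff space_restrict_space)
  ultimately show "iso_mod_null M N A B f'"
    using A B mg d unfolding iso_mod_null_def inv by simp
  have "f \<in> restrict_space M (space M - A) \<rightarrow>\<^sub>M N"
    using mf by (simp add: measurable_restrict_space2_iff)
  then show "f' \<in> M \<rightarrow>\<^sub>M N" unfolding f'_def
    using measurable_restrict_space_iff[of "space M - A" M b N f] b A by (auto simp: Int_absorb2)
qed

lemma mpt_maps_iff:
  assumes "prob_space M"
  shows "t \<in> mpt_maps M \<longleftrightarrow> (\<exists>s. ess_iso M M t s)"
proof -
  obtain a where "a \<in> space M" using prob_space.not_empty[OF assms] by auto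
  then show ?thesis unfolding mpt_maps_def mem_Collect_eq
    using iso_mod_null_imp_ess_iso(1)[of M M _ _ t a] ess_iso_imp_iso_mod_null[of M M t] ess_isoD(1)[of M M t]
    by metis
qed

section \<open>Square-integrable functions\<close>

text \<open>
  The norm and the inner product are studied on square-integrable functions, where sums and
  compositions are pointwise; \<open>nrm\<close> is therefore only a seminorm, and classes enter later.
\<close>

definition nrm :: "'a measure \<Rightarrow> ('a \<Rightarrow> complex) \<Rightarrow> real" where
  "nrm M f = sqrt (\<integral>x. (cmod (f x))\<^sup>2 \<partial>M)"

definition ip :: "'a measure \<Rightarrow> ('a \<Rightarrow> complex) \<Rightarrow> ('a \<Rightarrow> complex) \<Rightarrow> complex" where
  "ip M f g = (\<integral>x. f x * cnj (g x) \<partial>M)"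

lemma l2_funD:
  assumes "f \<in> l2_fun M"
  shows "f \<in> borel_measurable M" "integrable M (\<lambda>x. (cmod (f x))\<^sup>2)"
  using assms by (auto simp: l2_fun_def)

lemma nrm_nonneg [simp]: "0 \<le> nrm M f" by (simp add: nrm_def)

lemma nrm_power2: "(nrm M f)\<^sup>2 = (\<integral>x. (cmod (f x))\<^sup>2 \<partial>M)"
  by (simp add: nrm_def)

lemma borel_measurable_cnj [measurable]:
  assumes "f \<in> borel_measurable M" shows "(\<lambda>x. cnj (f x)) \<in> borel_measurable M"
  using measurable_compose[OF assms borel_measurable_continuous_onI[OF continuous_on_cnj[OF continuous_on_id]]] .

lemma integrable_l2_prod_norm:
  assumes "f \<in> l2_fun M" "g \<in> l2_fun M"
  shows "integrable M (\<lambda>x. cmod (f x) * cmod (g x))"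
proof (rule Bochner_Integration.integrable_bound)
  show "integrable M (\<lambda>x. (cmod (f x))\<^sup>2 + (cmod (g x))\<^sup>2)"
    using assms[THEN l2_funD(2)] by simp
  show "(\<lambda>x. cmod (f x) * cmod (g x)) \<in> borel_measurable M"
    using assms[THEN l2_funD(1)] by measurable
  have "a * b \<le> a\<^sup>2 + b\<^sup>2" for a b :: real
    using sum_squares_bound[of a b] zero_le_power2[of a] zero_le_power2[of b] zero_le_power2[of "a + b"]
    by (simp add: power2_sum)
  then show "AE x in M. norm (cmod (f x) * cmod (g x)) \<le> norm ((cmod (f x))\<^sup>2 + (cmod (g x))\<^sup>2)"
    by simp
qed

lemma integrable_l2_prod:
  assumes "f \<in> l2_fun M" "g \<in> l2_fun M"
  shows "integrable M (\<lambda>x. f x * cnj (g x))"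
  by (rule Bochner_Integration.integrable_bound[OF integrable_l2_prod_norm[OF assms]])
     (use assms[THEN l2_funD(1)] in \<open>auto simp: norm_mult\<close>)

lemma l2_fun_add:
  assumes "f \<in> l2_fun M" "g \<in> l2_fun M"
  shows "(\<lambda>x. f x + g x) \<in> l2_fun M"
proof -
  have "integrable M (\<lambda>x. (cmod (f x + g x))\<^sup>2)"
  proof (rule Bochner_Integration.integrable_bound)
    show "integrable M (\<lambda>x. 2 * (cmod (f x))\<^sup>2 + 2 * (cmod (g x))\<^sup>2)"
      using assms[THEN l2_funD(2)] by simp
    show "(\<lambda>x. (cmod (f x + g x))\<^sup>2) \<in> borel_measurable M"
      using assms[THEN l2_funD(1)] by measurable
    have "(cmod (a + b))\<^sup>2 \<le> 2 * (cmod a)\<^sup>2 + 2 * (cmod b)\<^sup>2" for a b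
    proof -
      have "(cmod (a + b))\<^sup>2 \<le> (cmod a + cmod b)\<^sup>2" by (intro power_mono norm_triangle_ineq) auto
      also have "\<dots> \<le> 2 * (cmod a)\<^sup>2 + 2 * (cmod b)\<^sup>2"
        using sum_squares_bound[of "cmod a" "cmod b"] by (simp add: power2_sum)
      finally show ?thesis .
    qed
    then show "AE x in M. norm ((cmod (f x + g x))\<^sup>2) \<le> norm (2 * (cmod (f x))\<^sup>2 + 2 * (cmod (g x))\<^sup>2)"
      by simp
  qed
  then show ?thesis using assms by (auto simp: l2_fun_def)
qed

lemma l2_fun_scale:
  assumes "f \<in> l2_fun M" shows "(\<lambda>x. c * f x) \<in> l2_fun M"
  using assms by (auto simp: l2_fun_def norm_mult power_mult_distrib)

lemma l2_fun_zero [simp]: "(\<lambda>x. 0) \<in> l2_fun M" by (simp add: l2_fun_def)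

lemma l2_fun_diff:
  assumes "f \<in> l2_fun M" "g \<in> l2_fun M"
  shows "(\<lambda>x. f x - g x) \<in> l2_fun M"
  using l2_fun_add[OF assms(1) l2_fun_scale[OF assms(2), of "-1"]] by simp

lemma l2_fun_sum:
  assumes "\<And>i. i \<in> I \<Longrightarrow> f i \<in> l2_fun M"
  shows "(\<lambda>x. \<Sum>i\<in>I. f i x) \<in> l2_fun M"
  using assms by (induction I rule: infinite_finite_induct) (auto intro: l2_fun_add)

lemma l2_fun_lincomb:
  assumes "\<And>i. i < (n::nat) \<Longrightarrow> e i \<in> l2_fun M"
  shows "(\<lambda>x. \<Sum>i<n. c i * e i x) \<in> l2_fun M"
  using assms by (intro l2_fun_sum l2_fun_scale) auto

lemma l2_fun_bounded:
  assumes "prob_space M" "f \<in> borel_measurable M" "\<And>x. x \<in> space M \<Longrightarrow> cmod (f x) \<le> B"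
  shows "f \<in> l2_fun M" and "0 \<le> B \<Longrightarrow> nrm M f \<le> B"
proof -
  interpret prob_space M by fact
  have le: "(cmod (f x))\<^sup>2 \<le> B\<^sup>2" if "x \<in> space M" for x
    using assms(3)[OF that] by (intro power_mono) auto
  have i: "integrable M (\<lambda>x. (cmod (f x))\<^sup>2)"
    by (rule integrable_const_bound[where B="B\<^sup>2"]) (use le assms(2) in auto)
  then show "f \<in> l2_fun M" using assms by (simp add: l2_fun_def)
  have "(\<integral>x. (cmod (f x))\<^sup>2 \<partial>M) \<le> (\<integral>x. B\<^sup>2 \<partial>M)"
    using i le by (intro integral_mono) auto
  then show "nrm M f \<le> B" if "0 \<le> B"
    unfolding nrm_def using that prob_space by (intro real_le_lsqrt) auto
qed

lemma nrm_cong_AE: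
  assumes "AE x in M. f x = g x" "f \<in> borel_measurable M" "g \<in> borel_measurable M"
  shows "nrm M f = nrm M g"
  unfolding nrm_def using assms by (intro arg_cong[where f=sqrt] integral_cong_AE) auto

lemma nrm_eq_0_iff:
  assumes "f \<in> l2_fun M" shows "nrm M f = 0 \<longleftrightarrow> (AE x in M. f x = 0)"
  unfolding nrm_def using integral_nonneg_eq_0_iff_AE[OF l2_funD(2)[OF assms]] by simp

lemma nrm_scale: "nrm M (\<lambda>x. c * f x) = cmod c * nrm M f"
  by (simp add: nrm_def norm_mult power_mult_distrib real_sqrt_mult)

lemma nrm_minus_commute: "nrm M (\<lambda>x. f x - g x) = nrm M (\<lambda>x. g x - f x)"
  by (simp add: nrm_def norm_minus_commute)

lemma nrm_zero [simp]: "nrm M (\<lambda>x. 0) = 0" by (simp add: nrm_def)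

text \<open>
  Integrating \<open>2 a b \<le> t a\<^sup>2 + b\<^sup>2 / t\<close> bounds the left-hand side for every \<open>t > 0\<close>; the best choice is
  \<open>t = nrm M g / nrm M f\<close>. If one of the norms vanishes there is no best choice, and an extreme \<open>t\<close>
  gives a contradiction.
\<close>

lemma Cauchy_Schwarz_integral:
  assumes f: "f \<in> l2_fun M" and g: "g \<in> l2_fun M"
  shows "(\<integral>x. cmod (f x) * cmod (g x) \<partial>M) \<le> nrm M f * nrm M g"
proof -
  define X where "X = (\<integral>x. cmod (f x) * cmod (g x) \<partial>M)"
  have bd: "2 * X \<le> t * (nrm M f)\<^sup>2 + (nrm M g)\<^sup>2 / t" if t: "t > 0" for t
  proof -
    have "2 * (a * b) \<le> t * a\<^sup>2 + b\<^sup>2 / t" for a b :: real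
    proof -
      have "0 \<le> (t * a - b)\<^sup>2 / t" using t by simp
      also have "\<dots> = t * a\<^sup>2 + b\<^sup>2 / t - 2 * (a * b)"
        using t by (simp add: field_simps power2_eq_square)
      finally show ?thesis by simp
    qed
    then have "(\<integral>x. 2 * (cmod (f x) * cmod (g x)) \<partial>M) \<le> (\<integral>x. t * (cmod (f x))\<^sup>2 + (cmod (g x))\<^sup>2 / t \<partial>M)"
      using l2_funD(2)[OF f] l2_funD(2)[OF g] integrable_l2_prod_norm[OF f g]
      by (intro integral_mono) auto
    then show ?thesis using l2_funD(2)[OF f] l2_funD(2)[OF g] by (simp add: X_def nrm_power2)
  qed
  have "X \<le> nrm M f * nrm M g"
  proof (cases "nrm M f = 0 \<or> nrm M g = 0")
    case True
    have "X \<le> 0"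
    proof (rule ccontr)
      assume "\<not> X \<le> 0" then have X: "X > 0" by simp
      consider "nrm M f = 0" | "nrm M g = 0" using True by auto
      then show False
      proof cases
        case 1
        define t where "t = ((nrm M g)\<^sup>2 + 1) / X"
        have t: "t > 0" using X unfolding t_def
          by (intro divide_pos_pos) (auto intro: add_nonneg_pos)
        have "2 * X \<le> (nrm M g)\<^sup>2 / t" using bd[OF t] 1 by simp
        also have "\<dots> = X * ((nrm M g)\<^sup>2 / ((nrm M g)\<^sup>2 + 1))" by (simp add: t_def)
        also have "\<dots> \<le> X * 1" using X by (intro mult_left_mono) (auto simp: divide_simps add_nonneg_pos)
        finally show False using X by simp
      next
        case 2
        define t where "t = X / ((nrm M f)\<^sup>2 + 1)"
        have t: "t > 0" using X unfolding t_def
          by (intro divide_pos_pos) (auto intro: add_nonneg_pos)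
        have "2 * X \<le> t * (nrm M f)\<^sup>2" using bd[OF t] 2 by simp
        also have "\<dots> = X * ((nrm M f)\<^sup>2 / ((nrm M f)\<^sup>2 + 1))" by (simp add: t_def)
        also have "\<dots> \<le> X * 1" using X by (intro mult_left_mono) (auto simp: divide_simps add_nonneg_pos)
        finally show False using X by simp
      qed
    qed
    then show ?thesis using True by auto
  next
    case False
    then have p: "nrm M f > 0" "nrm M g > 0" using nrm_nonneg[of M f] nrm_nonneg[of M g] by linarith+
    then have "nrm M g / nrm M f > 0" by simp
    from bd[OF this] p show ?thesis by (simp add: power2_eq_square)
  qed
  then show ?thesis by (simp add: X_def)
qed

lemma ip_bound:
  assumes "f \<in> l2_fun M" "g \<in> l2_fun M"
  shows "cmod (ip M f g) \<le> nrm M f * nrm M g"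
proof -
  have "cmod (ip M f g) \<le> (\<integral>x. cmod (f x * cnj (g x)) \<partial>M)" unfolding ip_def
    by (rule integral_norm_bound)
  also have "\<dots> \<le> nrm M f * nrm M g" using Cauchy_Schwarz_integral[OF assms] by (simp add: norm_mult)
  finally show ?thesis .
qed

lemma nrm_triangle:
  assumes f: "f \<in> l2_fun M" and g: "g \<in> l2_fun M"
  shows "nrm M (\<lambda>x. f x + g x) \<le> nrm M f + nrm M g"
proof -
  have "(cmod (a + b))\<^sup>2 \<le> (cmod a)\<^sup>2 + (cmod b)\<^sup>2 + 2 * (cmod a * cmod b)" for a b
  proof -
    have "(cmod (a + b))\<^sup>2 \<le> (cmod a + cmod b)\<^sup>2" by (intro power_mono norm_triangle_ineq) auto
    then show ?thesis by (simp add: power2_sum)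
  qed
  then have "(\<integral>x. (cmod (f x + g x))\<^sup>2 \<partial>M) \<le>
      (\<integral>x. (cmod (f x))\<^sup>2 + (cmod (g x))\<^sup>2 + 2 * (cmod (f x) * cmod (g x)) \<partial>M)"
    using l2_funD(2)[OF f] l2_funD(2)[OF g] integrable_l2_prod_norm[OF f g] l2_funD(2)[OF l2_fun_add[OF f g]]
    by (intro integral_mono) auto
  also have "\<dots> = (nrm M f)\<^sup>2 + (nrm M g)\<^sup>2 + 2 * (\<integral>x. cmod (f x) * cmod (g x) \<partial>M)"
    using l2_funD(2)[OF f] l2_funD(2)[OF g] integrable_l2_prod_norm[OF f g]
    by (simp add: nrm_power2)
  also have "\<dots> \<le> (nrm M f + nrm M g)\<^sup>2"
    using Cauchy_Schwarz_integral[OF f g] by (simp add: power2_sum)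
  finally show ?thesis unfolding nrm_def[of M "\<lambda>x. f x + g x"]
    by (intro real_le_lsqrt) auto
qed

lemma nrm_triangle_diff:
  assumes "f \<in> l2_fun M" "g \<in> l2_fun M" "h \<in> l2_fun M"
  shows "nrm M (\<lambda>x. f x - h x) \<le> nrm M (\<lambda>x. f x - g x) + nrm M (\<lambda>x. g x - h x)"
  using nrm_triangle[OF l2_fun_diff[OF assms(1,2)] l2_fun_diff[OF assms(2,3)]] by simp

lemma nrm_sum:
  assumes "\<And>i. i \<in> I \<Longrightarrow> f i \<in> l2_fun M"
  shows "nrm M (\<lambda>x. \<Sum>i\<in>I. f i x) \<le> (\<Sum>i\<in>I. nrm M (f i))"
  using assms
proof (induction I rule: infinite_finite_induct)
  case (insert i I)
  then show ?case using nrm_triangle[of "f i" M "\<lambda>x. \<Sum>i\<in>I. f i x"] l2_fun_sum[of I f M] by force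
qed auto

lemma ip_add_left:
  assumes "f \<in> l2_fun M" "g \<in> l2_fun M" "h \<in> l2_fun M"
  shows "ip M (\<lambda>x. f x + g x) h = ip M f h + ip M g h"
  unfolding ip_def using integrable_l2_prod[OF assms(1,3)] integrable_l2_prod[OF assms(2,3)]
  by (simp add: distrib_right)

lemma ip_scale_left: "ip M (\<lambda>x. c * f x) h = c * ip M f h"
  unfolding ip_def by (simp add: mult.assoc)

lemma ip_scale_right: "ip M f (\<lambda>x. c * h x) = cnj c * ip M f h"
  unfolding ip_def by (simp add: mult.left_commute)

lemma ip_diff_left:
  assumes "f \<in> l2_fun M" "g \<in> l2_fun M" "h \<in> l2_fun M"
  shows "ip M (\<lambda>x. f x - g x) h = ip M f h - ip M g h"
  unfolding ip_def using integrable_l2_prod[OF assms(1,3)] integrable_l2_prod[OF assms(2,3)]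
  by (simp add: left_diff_distrib)

lemma ip_cong_AE:
  assumes "AE x in M. f x = f' x" "AE x in M. g x = g' x"
    "f \<in> l2_fun M" "f' \<in> l2_fun M" "g \<in> l2_fun M" "g' \<in> l2_fun M"
  shows "ip M f g = ip M f' g'"
  unfolding ip_def
  by (rule integral_cong_AE) (use assms in \<open>auto dest!: l2_funD(1)\<close>)

lemma measure_preserving_l2:
  assumes s: "s \<in> M \<rightarrow>\<^sub>M M" "distr M M s = M" and f: "f \<in> l2_fun M"
  shows "(\<lambda>x. f (s x)) \<in> l2_fun M" "nrm M (\<lambda>x. f (s x)) = nrm M f"
proof -
  note [measurable] = s(1) l2_funD(1)[OF f]
  have m: "(\<lambda>x. (cmod (f x))\<^sup>2) \<in> borel_measurable M" by measurable
  have "integrable (distr M M s) (\<lambda>x. (cmod (f x))\<^sup>2)" using l2_funD(2)[OF f] s by simp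
  then have "integrable M (\<lambda>x. (cmod (f (s x)))\<^sup>2)"
    by (subst (asm) integrable_distr_eq) (use m s in auto)
  then show "(\<lambda>x. f (s x)) \<in> l2_fun M" by (simp add: l2_fun_def)
  have "(\<integral>x. (cmod (f x))\<^sup>2 \<partial>M) = (\<integral>x. (cmod (f x))\<^sup>2 \<partial>distr M M s)" using s by simp
  also have "\<dots> = (\<integral>x. (cmod (f (s x)))\<^sup>2 \<partial>M)" by (subst integral_distr) (use m s in auto)
  finally show "nrm M (\<lambda>x. f (s x)) = nrm M f" by (simp add: nrm_def)
qed

lemma measure_preserving_ip:
  assumes s: "s \<in> M \<rightarrow>\<^sub>M M" "distr M M s = M" and f: "f \<in> l2_fun M" "g \<in> l2_fun M"
  shows "ip M (\<lambda>x. f (s x)) (\<lambda>x. g (s x)) = ip M f g"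
proof -
  note [measurable] = s(1) l2_funD(1)[OF f(1)] l2_funD(1)[OF f(2)]
  have "ip M f g = (\<integral>x. f x * cnj (g x) \<partial>distr M M s)" using s by (simp add: ip_def)
  also have "\<dots> = ip M (\<lambda>x. f (s x)) (\<lambda>x. g (s x))" unfolding ip_def by (subst integral_distr) measurable
  finally show ?thesis by simp
qed

section \<open>Completeness\<close>

lemma nn_integral_l2:
  assumes "f \<in> l2_fun M"
  shows "(\<integral>\<^sup>+x. ennreal ((cmod (f x))\<^sup>2) \<partial>M) = ennreal ((nrm M f)\<^sup>2)"
  unfolding nrm_power2 using l2_funD(2)[OF assms] by (intro nn_integral_eq_integral) auto

text \<open>
  Riesz and Fischer: along a subsequence with summable increments the functions converge almost
  everywhere, because the increments are also summable in the \<open>L\<^sup>1\<close> norm of a probability space.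
  Fatou's lemma turns the Cauchy condition into convergence to the pointwise limit.
\<close>

theorem l2_complete:
  fixes F :: "nat \<Rightarrow> 'a \<Rightarrow> complex"
  assumes M: "prob_space M" and F: "\<And>n. F n \<in> l2_fun M"
    and C: "\<And>\<epsilon>. \<epsilon> > 0 \<Longrightarrow> \<exists>N. \<forall>m\<ge>N. \<forall>n\<ge>N. nrm M (\<lambda>x. F m x - F n x) < \<epsilon>"
  shows "\<exists>g\<in>l2_fun M. \<forall>\<epsilon>>0. \<exists>N. \<forall>n\<ge>N. nrm M (\<lambda>x. F n x - g x) < \<epsilon>"
proof -
  interpret prob_space M by fact
  note [measurable] = l2_funD(1)[OF F]
  have one: "(\<lambda>x. 1) \<in> l2_fun M" "nrm M (\<lambda>x. 1) \<le> 1"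
    using l2_fun_bounded[OF M, of "\<lambda>x. 1" 1] by auto
  have "\<exists>N. \<forall>k. \<forall>m\<ge>N k. \<forall>n\<ge>N k. nrm M (\<lambda>x. F m x - F n x) < (1/2)^k"
    by (intro choice allI C) simp
  then obtain N where N: "\<And>k m n. m \<ge> N k \<Longrightarrow> n \<ge> N k \<Longrightarrow> nrm M (\<lambda>x. F m x - F n x) < (1/2)^k"
    by blast
  \<comment> \<open>A nondecreasing choice with \<open>r k \<ge> N k\<close> that tends to infinity.\<close>
  define r where "r k = (\<Sum>j\<le>k. N j) + k" for k
  have rN: "r k \<ge> N k" for k
    unfolding r_def by (rule trans_le_add1) (rule member_le_sum, auto)
  have rS: "r (Suc k) \<ge> r k" for k by (simp add: r_def)
  have rk: "r k \<ge> k" for k by (simp add: r_def)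
  define h where "h k x = cmod (F (r (Suc k)) x - F (r k) x)" for k x
  have [measurable]: "h k \<in> borel_measurable M" for k unfolding h_def by measurable
  have dl2: "(\<lambda>x. F m x - F n x) \<in> l2_fun M" for m n by (intro l2_fun_diff F)
  have hint: "(\<integral>\<^sup>+x. ennreal (h k x) \<partial>M) \<le> ennreal ((1/2)^k)" for k
  proof -
    have "integrable M (\<lambda>x. h k x)"
      using integrable_l2_prod_norm[OF dl2 one(1)] by (simp add: h_def)
    then have "(\<integral>\<^sup>+x. ennreal (h k x) \<partial>M) = ennreal (\<integral>x. h k x \<partial>M)"
      by (intro nn_integral_eq_integral) (auto simp: h_def)
    moreover have "(\<integral>x. h k x \<partial>M) \<le> nrm M (\<lambda>x. F (r (Suc k)) x - F (r k) x) * nrm M (\<lambda>x. 1)"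
      using Cauchy_Schwarz_integral[OF dl2 one(1)] by (simp add: h_def)
    moreover have "\<dots> \<le> (1/2)^k * 1"
      using N[of k "r (Suc k)" "r k"] rN[of k] rS[of k] one by (intro mult_mono) auto
    ultimately show ?thesis by (simp add: ennreal_leI)
  qed
  have "(\<integral>\<^sup>+x. (\<Sum>k. ennreal (h k x)) \<partial>M) = (\<Sum>k. \<integral>\<^sup>+x. ennreal (h k x) \<partial>M)"
    by (rule nn_integral_suminf) measurable
  also have "\<dots> \<le> (\<Sum>k. ennreal ((1/2)^k))" by (intro suminf_le hint summableI)
  also have "\<dots> = ennreal (\<Sum>k. (1/2)^k)" by (intro suminf_ennreal2) (auto intro: summable_geometric)
  also have "\<dots> < \<infinity>" by simp
  finally have "(\<integral>\<^sup>+x. (\<Sum>k. ennreal (h k x)) \<partial>M) \<noteq> \<infinity>" by simp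
  then have "AE x in M. (\<Sum>k. ennreal (h k x)) \<noteq> \<infinity>" by (intro nn_integral_PInf_AE) measurable
  then have conv: "AE x in M. convergent (\<lambda>k. F (r k) x)"
  proof eventually_elim
    case (elim x)
    then have "summable (\<lambda>k. h k x)" by (intro summable_suminf_not_top) (auto simp: h_def)
    then have "summable (\<lambda>k. F (r (Suc k)) x - F (r k) x)"
      unfolding h_def by (rule summable_norm_cancel)
    then have "convergent (\<lambda>n. \<Sum>k<n. F (r (Suc k)) x - F (r k) x)"
      using summable_iff_convergent by blast
    then have "convergent (\<lambda>n. F (r n) x - F (r 0) x)" unfolding sum_lessThan_telescope[of "\<lambda>k. F (r k) x"] .
    from convergent_add[OF this convergent_const[of "F (r 0) x"]] show ?case by simp
  qed
  define g where "g x = lim (\<lambda>k. F (r k) x)" for x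
  have gm [measurable]: "g \<in> borel_measurable M" unfolding g_def by (rule borel_measurable_lim_metric) measurable
  have Fg: "(\<integral>\<^sup>+x. ennreal ((cmod (F m x - g x))\<^sup>2) \<partial>M) \<le> ennreal (\<epsilon>\<^sup>2)"
    if \<epsilon>: "\<epsilon> > 0" and L: "\<And>m n. m \<ge> L \<Longrightarrow> n \<ge> L \<Longrightarrow> nrm M (\<lambda>x. F m x - F n x) < \<epsilon>" and m: "m \<ge> L" for m \<epsilon> L
  proof -
    have "(\<integral>\<^sup>+x. ennreal ((cmod (F m x - g x))\<^sup>2) \<partial>M) =
      (\<integral>\<^sup>+x. liminf (\<lambda>k. ennreal ((cmod (F m x - F (r k) x))\<^sup>2)) \<partial>M)"
    proof (rule nn_integral_cong_AE)
      show "AE x in M. ennreal ((cmod (F m x - g x))\<^sup>2) = liminf (\<lambda>k. ennreal ((cmod (F m x - F (r k) x))\<^sup>2))"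
        using conv
      proof eventually_elim
        case (elim x)
        then have "(\<lambda>k. F (r k) x) \<longlonglongrightarrow> g x" unfolding g_def by (simp add: convergent_LIMSEQ_iff)
        then have "(\<lambda>k. ennreal ((cmod (F m x - F (r k) x))\<^sup>2)) \<longlonglongrightarrow> ennreal ((cmod (F m x - g x))\<^sup>2)"
          by (intro tendsto_ennrealI tendsto_intros)
        from lim_imp_Liminf[OF sequentially_bot this] show ?case by simp
      qed
    qed
    also have "\<dots> \<le> liminf (\<lambda>k. \<integral>\<^sup>+x. ennreal ((cmod (F m x - F (r k) x))\<^sup>2) \<partial>M)"
      by (rule nn_integral_liminf) measurable
    also have "\<dots> \<le> liminf (\<lambda>k::nat. ennreal (\<epsilon>\<^sup>2))"
    proof (rule Liminf_mono, rule eventually_sequentiallyI)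
      fix k assume k: "k \<ge> L"
      have "(nrm M (\<lambda>x. F m x - F (r k) x))\<^sup>2 \<le> \<epsilon>\<^sup>2"
        using L[OF m, of "r k"] rk[of k] k by (intro power_mono) auto
      then show "(\<integral>\<^sup>+x. ennreal ((cmod (F m x - F (r k) x))\<^sup>2) \<partial>M) \<le> ennreal (\<epsilon>\<^sup>2)"
        by (simp add: nn_integral_l2[OF dl2] ennreal_leI)
    qed
    also have "\<dots> = ennreal (\<epsilon>\<^sup>2)" by (simp add: Liminf_const)
    finally show ?thesis .
  qed
  have Fgl2: "(\<lambda>x. F m x - g x) \<in> l2_fun M \<and> nrm M (\<lambda>x. F m x - g x) \<le> \<epsilon>"
    if "\<epsilon> > 0" and "\<And>m n. m \<ge> L \<Longrightarrow> n \<ge> L \<Longrightarrow> nrm M (\<lambda>x. F m x - F n x) < \<epsilon>" and "m \<ge> L" for m \<epsilon> L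
  proof -
    have le: "(\<integral>\<^sup>+x. ennreal ((cmod (F m x - g x))\<^sup>2) \<partial>M) \<le> ennreal (\<epsilon>\<^sup>2)" by (rule Fg[OF that]) auto
    have "integrable M (\<lambda>x. (cmod (F m x - g x))\<^sup>2)"
      by (rule integrableI_nonneg) (use le in \<open>auto simp: order.strict_trans1\<close>)
    then have l: "(\<lambda>x. F m x - g x) \<in> l2_fun M" by (simp add: l2_fun_def)
    have "(nrm M (\<lambda>x. F m x - g x))\<^sup>2 \<le> \<epsilon>\<^sup>2"
      using le unfolding nn_integral_l2[OF l] by simp
    then show ?thesis using l that(1) by (simp add: power2_le_iff_abs_le)
  qed
  obtain L0 where L0: "\<And>m n. m \<ge> L0 \<Longrightarrow> n \<ge> L0 \<Longrightarrow> nrm M (\<lambda>x. F m x - F n x) < 1"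
    using C[of 1] by auto
  have gl2: "g \<in> l2_fun M"
  proof -
    have "(\<lambda>x. F L0 x - g x) \<in> l2_fun M" using Fgl2[of 1 L0 L0] L0 by simp
    from l2_fun_diff[OF F[of L0] this] show ?thesis by simp
  qed
  moreover have "\<exists>N. \<forall>n\<ge>N. nrm M (\<lambda>x. F n x - g x) < \<epsilon>" if \<epsilon>: "\<epsilon> > 0" for \<epsilon>
  proof -
    obtain L where "\<And>m n. m \<ge> L \<Longrightarrow> n \<ge> L \<Longrightarrow> nrm M (\<lambda>x. F m x - F n x) < \<epsilon>/2"
      using C[of "\<epsilon>/2"] \<epsilon> by auto
    then have "nrm M (\<lambda>x. F n x - g x) \<le> \<epsilon>/2" if "n \<ge> L" for n
      using Fgl2[of "\<epsilon>/2" L n] \<epsilon> that by auto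
    then show ?thesis using \<epsilon> by (intro exI[of _ L]) force
  qed
  ultimately show ?thesis by blast
qed

section \<open>Closed subspaces\<close>

text \<open>
  Closedness is stated by approximation, so that such a subspace automatically contains with a
  function every square-integrable function that is equal to it almost everywhere.
\<close>

definition l2_closed_subspace :: "'a measure \<Rightarrow> ('a \<Rightarrow> complex) set \<Rightarrow> bool" where
  "l2_closed_subspace M W \<longleftrightarrow> W \<subseteq> l2_fun M \<and> (\<lambda>x. 0) \<in> W \<and>
     (\<forall>f\<in>W. \<forall>g\<in>W. (\<lambda>x. f x + g x) \<in> W) \<and> (\<forall>c. \<forall>f\<in>W. (\<lambda>x. c * f x) \<in> W) \<and>
     (\<forall>f\<in>l2_fun M. (\<forall>\<epsilon>>0. \<exists>g\<in>W. nrm M (\<lambda>x. f x - g x) < \<epsilon>) \<longrightarrow> f \<in> W)"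

text \<open>
  The closed linear span, on the level of functions.
\<close>

definition cspan :: "'a measure \<Rightarrow> ('a \<Rightarrow> complex) set \<Rightarrow> ('a \<Rightarrow> complex) set" where
  "cspan M S = {f \<in> l2_fun M. \<forall>\<epsilon>>0. \<exists>n c e. (\<forall>i<n. e i \<in> S) \<and>
      nrm M (\<lambda>x. f x - (\<Sum>i<(n::nat). c i * e i x)) < \<epsilon>}"

lemma closed_subspaceD:
  assumes "l2_closed_subspace M W"
  shows "W \<subseteq> l2_fun M" "(\<lambda>x. 0) \<in> W"
    "f \<in> W \<Longrightarrow> g \<in> W \<Longrightarrow> (\<lambda>x. f x + g x) \<in> W" "f \<in> W \<Longrightarrow> (\<lambda>x. c * f x) \<in> W"
    "f \<in> l2_fun M \<Longrightarrow> (\<And>\<epsilon>. \<epsilon> > 0 \<Longrightarrow> \<exists>g\<in>W. nrm M (\<lambda>x. f x - g x) < \<epsilon>) \<Longrightarrow> f \<in> W"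
  using assms unfolding l2_closed_subspace_def by blast+

lemma closed_subspace_sum:
  assumes "l2_closed_subspace M W" "\<And>i. i \<in> I \<Longrightarrow> f i \<in> W"
  shows "(\<lambda>x. \<Sum>i\<in>I. f i x) \<in> W"
  using assms(2)
  by (induction I rule: infinite_finite_induct) (auto intro: closed_subspaceD[OF assms(1)])

lemma closed_subspace_AE:
  assumes "l2_closed_subspace M W" "f \<in> l2_fun M" "g \<in> W" "AE x in M. f x = g x"
  shows "f \<in> W"
proof (rule closed_subspaceD(5)[OF assms(1,2)])
  fix \<epsilon> :: real assume "\<epsilon> > 0"
  have "g \<in> l2_fun M" using closed_subspaceD(1)[OF assms(1)] assms(3) by auto
  then have "nrm M (\<lambda>x. f x - g x) = 0"
    using assms(2,4) by (subst nrm_eq_0_iff) (auto intro: l2_fun_diff)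
  then show "\<exists>g\<in>W. nrm M (\<lambda>x. f x - g x) < \<epsilon>"
    using \<open>\<epsilon> > 0\<close> by (intro bexI[OF _ assms(3)]) simp
qed

lemma cspan_subset:
  assumes "l2_closed_subspace M W" "S \<subseteq> W"
  shows "cspan M S \<subseteq> W"
proof
  fix f assume f: "f \<in> cspan M S"
  show "f \<in> W"
  proof (rule closed_subspaceD(5)[OF assms(1)])
    show "f \<in> l2_fun M" using f by (simp add: cspan_def)
    fix \<epsilon> :: real assume "\<epsilon> > 0"
    then obtain n :: nat and c e where e: "\<forall>i<n. e i \<in> S" "nrm M (\<lambda>x. f x - (\<Sum>i<n. c i * e i x)) < \<epsilon>"
      using f unfolding cspan_def by blast
    have "(\<lambda>x. \<Sum>i<n. c i * e i x) \<in> W"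
      using e assms(2) by (intro closed_subspace_sum[OF assms(1)] closed_subspaceD(4)[OF assms(1)]) auto
    then show "\<exists>g\<in>W. nrm M (\<lambda>x. f x - g x) < \<epsilon>" by (rule bexI[rotated]) (rule e(2))
  qed
qed

lemma lincomb_append:
  fixes e d :: "nat \<Rightarrow> 'a \<Rightarrow> complex"
  shows "(\<Sum>i<n. a i * e i x) + (\<Sum>i<m. b i * d i x) =
    (\<Sum>i<n+m. (if i < n then a i else b (i - n)) * (if i < n then e i else d (i - n)) x)"
  by (induction m) (auto simp: add.assoc[symmetric] intro: sum.cong)

lemma cspan_closed:
  assumes S: "S \<subseteq> l2_fun M"
  shows "l2_closed_subspace M (cspan M S)"
  unfolding l2_closed_subspace_def
proof (intro conjI ballI allI impI)
  show "cspan M S \<subseteq> l2_fun M" by (auto simp: cspan_def)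
  show "(\<lambda>x. 0) \<in> cspan M S" unfolding cspan_def
    by (auto intro!: exI[of _ "0::nat"])
next
  fix f g assume f: "f \<in> cspan M S" and g: "g \<in> cspan M S"
  show "(\<lambda>x. f x + g x) \<in> cspan M S"
    unfolding cspan_def
  proof (intro CollectI conjI allI impI)
    show "(\<lambda>x. f x + g x) \<in> l2_fun M" using f g by (auto simp: cspan_def intro: l2_fun_add)
    fix \<epsilon> :: real assume "\<epsilon> > 0"
    then have h: "\<epsilon>/2 > 0" by simp
    obtain n :: nat and a e where e: "\<forall>i<n. e i \<in> S" "nrm M (\<lambda>x. f x - (\<Sum>i<n. a i * e i x)) < \<epsilon>/2"
      using f h unfolding cspan_def by blast
    obtain m :: nat and b d where d: "\<forall>i<m. d i \<in> S" "nrm M (\<lambda>x. g x - (\<Sum>i<m. b i * d i x)) < \<epsilon>/2"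
      using g h unfolding cspan_def by blast
    have l: "(\<lambda>x. f x - (\<Sum>i<n. a i * e i x)) \<in> l2_fun M" "(\<lambda>x. g x - (\<Sum>i<m. b i * d i x)) \<in> l2_fun M"
      using f g S e(1) d(1) by (auto simp: cspan_def intro!: l2_fun_diff l2_fun_lincomb)
    have "nrm M (\<lambda>x. (f x + g x) - ((\<Sum>i<n. a i * e i x) + (\<Sum>i<m. b i * d i x))) < \<epsilon>"
      using nrm_triangle[OF l] e(2) d(2) by (simp add: algebra_simps)
    then have "nrm M (\<lambda>x. (f x + g x) - (\<Sum>i<n+m. (if i < n then a i else b (i - n)) * (if i < n then e i else d (i - n)) x)) < \<epsilon>"
      by (simp only: lincomb_append)
    moreover have "\<forall>i<n+m. (if i < n then e i else d (i - n)) \<in> S" using e(1) d(1) by auto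
    ultimately show "\<exists>n c e. (\<forall>i<n. e i \<in> S) \<and> nrm M (\<lambda>x. (f x + g x) - (\<Sum>i<(n::nat). c i * e i x)) < \<epsilon>"
      by (intro exI[of _ "n+m"] exI[of _ "\<lambda>i. if i < n then a i else b (i - n)"]
          exI[of _ "\<lambda>i. if i < n then e i else d (i - n)"] conjI)
  qed
next
  fix k f assume f: "f \<in> cspan M S"
  show "(\<lambda>x. k * f x) \<in> cspan M S"
    unfolding cspan_def
  proof (intro CollectI conjI allI impI)
    show "(\<lambda>x. k * f x) \<in> l2_fun M" using f by (auto simp: cspan_def intro: l2_fun_scale)
    fix \<epsilon> :: real assume "\<epsilon> > 0"
    then have h: "\<epsilon>/(cmod k + 1) > 0" by (simp add: add_nonneg_pos)
    obtain n :: nat and a e where e: "\<forall>i<n. e i \<in> S" "nrm M (\<lambda>x. f x - (\<Sum>i<n. a i * e i x)) < \<epsilon>/(cmod k + 1)"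
      using f h unfolding cspan_def by blast
    have "nrm M (\<lambda>x. k * f x - (\<Sum>i<n. (k * a i) * e i x)) = cmod k * nrm M (\<lambda>x. f x - (\<Sum>i<n. a i * e i x))"
      by (simp add: nrm_scale[symmetric] right_diff_distrib sum_distrib_left mult.assoc)
    also have "\<dots> \<le> (cmod k + 1) * nrm M (\<lambda>x. f x - (\<Sum>i<n. a i * e i x))"
      by (intro mult_right_mono) auto
    also have "\<dots> < \<epsilon>" using e(2) by (simp add: pos_less_divide_eq add_nonneg_pos mult.commute)
    finally show "\<exists>n c e. (\<forall>i<n. e i \<in> S) \<and> nrm M (\<lambda>x. k * f x - (\<Sum>i<(n::nat). c i * e i x)) < \<epsilon>"
      using e(1) by (intro exI[of _ n] exI[of _ "\<lambda>i. k * a i"] exI[of _ e] conjI)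
  qed
next
  fix f assume f: "f \<in> l2_fun M" and app: "\<forall>\<epsilon>>0. \<exists>g\<in>cspan M S. nrm M (\<lambda>x. f x - g x) < \<epsilon>"
  show "f \<in> cspan M S" unfolding cspan_def
  proof (intro CollectI conjI allI impI)
    show "f \<in> l2_fun M" by fact
    fix \<epsilon> :: real assume "\<epsilon> > 0"
    then have h: "\<epsilon>/2 > 0" by simp
    obtain g where g: "g \<in> cspan M S" "nrm M (\<lambda>x. f x - g x) < \<epsilon>/2" using app h by blast
    obtain m :: nat and b d where d: "\<forall>i<m. d i \<in> S" "nrm M (\<lambda>x. g x - (\<Sum>i<m. b i * d i x)) < \<epsilon>/2"
      using g(1) h unfolding cspan_def by blast
    have "g \<in> l2_fun M" "(\<lambda>x. \<Sum>i<m. b i * d i x) \<in> l2_fun M"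
      using g(1) d(1) S by (auto simp: cspan_def intro!: l2_fun_lincomb)
    from nrm_triangle_diff[OF f this] have "nrm M (\<lambda>x. f x - (\<Sum>i<m. b i * d i x)) < \<epsilon>"
      using g(2) d(2) by simp
    then show "\<exists>n c e. (\<forall>i<n. e i \<in> S) \<and> nrm M (\<lambda>x. f x - (\<Sum>i<(n::nat). c i * e i x)) < \<epsilon>"
      using d(1) by (intro exI[of _ m] exI[of _ b] exI[of _ d] conjI)
  qed
qed

lemma cspan_superset:
  assumes "S \<subseteq> l2_fun M" shows "S \<subseteq> cspan M S"
proof
  fix f assume "f \<in> S"
  then show "f \<in> cspan M S" using assms unfolding cspan_def
    by (auto intro!: exI[of _ "1::nat"] exI[of _ "\<lambda>i. 1"] exI[of _ "\<lambda>i. f"])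
qed

text \<open>
  Simple functions are linear combinations of indicators, and every \<open>f\<close> is the limit of simple
  functions that are dominated by \<open>2 |f|\<close>. This reduces later totality and continuity statements to
  indicators of measurable sets.
\<close>

lemma closed_subspace_eq_l2_fun:
  assumes M: "prob_space M" and W: "l2_closed_subspace M W"
    and ind: "\<And>E. E \<in> sets M \<Longrightarrow> (\<lambda>x. of_real (indicator E x)) \<in> W"
  shows "W = l2_fun M"
proof (intro equalityI subsetI)
  fix f assume f: "f \<in> l2_fun M"
  interpret prob_space M by fact
  obtain F where F: "\<And>i. simple_function M (F i)" "\<And>x. x \<in> space M \<Longrightarrow> (\<lambda>i. F i x) \<longlonglongrightarrow> f x"
    "\<And>i x. x \<in> space M \<Longrightarrow> dist (F i x) 0 \<le> 2 * dist (f x) 0"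
    using borel_measurable_implies_sequence_metric[OF l2_funD(1)[OF f], of 0] by metis
  have FW: "F i \<in> W" for i
  proof -
    have s: "F i x = (\<Sum>y\<in>F i ` space M. y * of_real (indicator (F i -` {y} \<inter> space M) x))" if "x \<in> space M" for x
    proof -
      have "(\<Sum>y\<in>F i ` space M. y * of_real (indicator (F i -` {y} \<inter> space M) x))
        = (\<Sum>y\<in>F i ` space M. if y = F i x then y else 0)"
        using that by (intro sum.cong) (auto simp: indicator_def)
      also have "\<dots> = F i x" using that F(1)[of i] by (simp add: simple_function_def)
      finally show ?thesis by simp
    qed
    have sW: "(\<lambda>x. \<Sum>y\<in>F i ` space M. y * of_real (indicator (F i -` {y} \<inter> space M) x)) \<in> W"
      using F(1)[of i] by (intro closed_subspace_sum[OF W] closed_subspaceD(4)[OF W] ind) (auto simp: simple_function_def)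
    have fl: "F i \<in> l2_fun M"
    proof -
      have "F i \<in> borel_measurable M" using F(1) by (rule borel_measurable_simple_function)
      moreover have "cmod (F i x) \<le> (\<Sum>y\<in>F i ` space M. cmod y)" if "x \<in> space M" for x
        using that F(1)[of i] by (intro member_le_sum) (auto simp: simple_function_def)
      ultimately show ?thesis using l2_fun_bounded(1)[OF M] by blast
    qed
    show "F i \<in> W" by (rule closed_subspace_AE[OF W fl sW AE_I2[OF s]])
  qed
  show "f \<in> W"
  proof (rule closed_subspaceD(5)[OF W f])
    fix \<epsilon> :: real assume \<epsilon>: "\<epsilon> > 0"
    have Fm: "F i \<in> borel_measurable M" for i using F(1) by (rule borel_measurable_simple_function)
    note [measurable] = Fm l2_funD(1)[OF f]
    have "(\<lambda>i. \<integral>x. (cmod (f x - F i x))\<^sup>2 \<partial>M) \<longlonglongrightarrow> (\<integral>x. 0 \<partial>M)"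
    proof (rule integral_dominated_convergence)
      show "integrable M (\<lambda>x. 9 * (cmod (f x))\<^sup>2)" using l2_funD(2)[OF f] by auto
      show "AE x in M. (\<lambda>i. (cmod (f x - F i x))\<^sup>2) \<longlonglongrightarrow> 0"
      proof (rule AE_I2)
        fix x assume "x \<in> space M"
        from tendsto_power[OF tendsto_norm[OF tendsto_diff[OF tendsto_const[of "f x"] F(2)[OF this]]], of 2]
        show "(\<lambda>i. (cmod (f x - F i x))\<^sup>2) \<longlonglongrightarrow> 0" by simp
      qed
      show "AE x in M. norm ((cmod (f x - F i x))\<^sup>2) \<le> 9 * (cmod (f x))\<^sup>2" for i
      proof (rule AE_I2)
        fix x assume x: "x \<in> space M"
        have "cmod (f x - F i x) \<le> 3 * cmod (f x)"
          using F(3)[OF x, of i] norm_triangle_ineq4[of "f x" "F i x"] by (simp add: dist_norm)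
        then have "(cmod (f x - F i x))\<^sup>2 \<le> (3 * cmod (f x))\<^sup>2" by (intro power_mono) auto
        then show "norm ((cmod (f x - F i x))\<^sup>2) \<le> 9 * (cmod (f x))\<^sup>2" by (simp add: power_mult_distrib)
      qed
    qed measurable
    then have "(\<lambda>i. nrm M (\<lambda>x. f x - F i x)) \<longlonglongrightarrow> sqrt 0"
      unfolding nrm_def by (intro tendsto_real_sqrt) simp
    then have "eventually (\<lambda>i. nrm M (\<lambda>x. f x - F i x) < \<epsilon>) sequentially"
      using order_tendstoD(2)[of _ "sqrt 0"] \<epsilon> by simp
    then obtain i where "nrm M (\<lambda>x. f x - F i x) < \<epsilon>" by (auto simp: eventually_sequentially)
    then show "\<exists>g\<in>W. nrm M (\<lambda>x. f x - g x) < \<epsilon>" by (rule bexI[OF _ FW])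
  qed
qed (use closed_subspaceD(1)[OF W] in auto)

section \<open>Classes of square-integrable functions\<close>

lemma equiv_ae_rel: "equiv X (ae_rel M X)"
proof (rule equivI)
  show "refl_on X (ae_rel M X)" by (auto simp: ae_rel_def refl_on_def)
  show "sym (ae_rel M X)" by (auto simp: ae_rel_def sym_def)
  show "trans (ae_rel M X)"
  proof (rule transI)
    fix f g h assume "(f, g) \<in> ae_rel M X" "(g, h) \<in> ae_rel M X"
    then have X: "f \<in> X" "h \<in> X" and "AE x in M. f x = g x" "AE x in M. g x = h x"
      by (auto simp: ae_rel_def)
    from this(3,4) have "AE x in M. f x = h x" by eventually_elim simp
    with X show "(f, h) \<in> ae_rel M X" by (auto simp: ae_rel_def)
  qed
qed (auto simp: ae_rel_def)

text \<open>
  With \<open>rep_l2_class\<close> below this makes the choice of representatives harmless: whatever is computed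
  with \<open>rep\<close> agrees almost everywhere with the same computation for any other representative.
\<close>

lemma rep_in:
  assumes "C \<in> X // ae_rel M X"
  shows "rep C \<in> C" "rep C \<in> X" "ae_rel M X `` {rep C} = C"
proof -
  have "C \<noteq> {}" using in_quotient_imp_non_empty[OF equiv_ae_rel assms] .
  then show r: "rep C \<in> C" unfolding rep_def by (rule some_in_eq[THEN iffD2])
  then show X: "rep C \<in> X" using in_quotient_imp_subset[OF equiv_ae_rel assms] by auto
  obtain f where f: "f \<in> X" "C = ae_rel M X `` {f}" using assms by (auto elim: quotientE)
  then have "(f, rep C) \<in> ae_rel M X" using r by auto
  then show "ae_rel M X `` {rep C} = C" using f(2) equiv_class_eq[OF equiv_ae_rel] by metis
qed

lemma l2_class_in_L2: "f \<in> l2_fun M \<Longrightarrow> l2_class M f \<in> L2 M"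
  by (auto simp: L2_def l2_class_def intro: quotientI)

lemma rep_L2:
  assumes "F \<in> L2 M"
  shows "rep F \<in> l2_fun M" "l2_class M (rep F) = F"
  using rep_in[of F "l2_fun M" M] assms by (auto simp: L2_def l2_class_def)

lemma l2_class_eq_iff:
  assumes "f \<in> l2_fun M" "g \<in> l2_fun M"
  shows "l2_class M f = l2_class M g \<longleftrightarrow> (AE x in M. f x = g x)"
proof -
  have "l2_class M f = l2_class M g \<longleftrightarrow> (f, g) \<in> ae_rel M (l2_fun M)"
    unfolding l2_class_def using eq_equiv_class_iff[OF equiv_ae_rel assms] .
  then show ?thesis using assms by (auto simp: ae_rel_def)
qed

lemma rep_l2_class:
  assumes "f \<in> l2_fun M"
  shows "AE x in M. rep (l2_class M f) x = f x"
  using rep_L2[OF l2_class_in_L2[OF assms]] assms by (subst l2_class_eq_iff[symmetric]) auto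

lemma L2_cases:
  assumes "F \<in> L2 M" obtains f where "f \<in> l2_fun M" "F = l2_class M f"
  using rep_L2[OF assms] by metis

lemma l2_dist_nrm: "l2_dist M F G = nrm M (\<lambda>x. rep F x - rep G x)"
  by (simp add: l2_dist_def nrm_def)

lemma l2_dist_class:
  assumes "f \<in> l2_fun M" "g \<in> l2_fun M"
  shows "l2_dist M (l2_class M f) (l2_class M g) = nrm M (\<lambda>x. f x - g x)"
  unfolding l2_dist_nrm
proof (rule nrm_cong_AE)
  show "AE x in M. rep (l2_class M f) x - rep (l2_class M g) x = f x - g x"
    using rep_l2_class[OF assms(1)] rep_l2_class[OF assms(2)] by eventually_elim simp
  show "(\<lambda>x. rep (l2_class M f) x - rep (l2_class M g) x) \<in> borel_measurable M"
    using l2_funD(1)[OF l2_fun_diff[OF rep_L2(1)[OF l2_class_in_L2[OF assms(1)]] rep_L2(1)[OF l2_class_in_L2[OF assms(2)]]]] .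
  show "(\<lambda>x. f x - g x) \<in> borel_measurable M" using l2_funD(1)[OF l2_fun_diff[OF assms]] .
qed

lemma Metric_space_L2: "Metric_space (L2 M) (l2_dist M)"
proof
  show "0 \<le> l2_dist M F G" for F G by (simp add: l2_dist_nrm)
  show "l2_dist M F G = l2_dist M G F" for F G unfolding l2_dist_nrm by (rule nrm_minus_commute)
  show "l2_dist M F G = 0 \<longleftrightarrow> F = G" if "F \<in> L2 M" "G \<in> L2 M" for F G
  proof -
    have "l2_dist M F G = 0 \<longleftrightarrow> (AE x in M. rep F x - rep G x = 0)"
      unfolding l2_dist_nrm by (rule nrm_eq_0_iff[OF l2_fun_diff[OF rep_L2(1)[OF that(1)] rep_L2(1)[OF that(2)]]])
    also have "\<dots> \<longleftrightarrow> l2_class M (rep F) = l2_class M (rep G)"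
      by (subst l2_class_eq_iff) (use that rep_L2 in auto)
    finally show ?thesis using that rep_L2 by metis
  qed
  show "l2_dist M F H \<le> l2_dist M F G + l2_dist M G H" if "F \<in> L2 M" "G \<in> L2 M" "H \<in> L2 M" for F G H
    unfolding l2_dist_nrm using that by (intro nrm_triangle_diff rep_L2(1))
qed

lemma topspace_L2 [simp]: "topspace (L2_topology M) = L2 M"
  unfolding L2_topology_def by (rule Metric_space.topspace_mtopology[OF Metric_space_L2])

lemma l2_class_in_closure_iff:
  assumes "f \<in> l2_fun M" "S \<subseteq> l2_fun M"
  shows "l2_class M f \<in> L2_topology M closure_of (l2_class M ` S) \<longleftrightarrow>
    (\<forall>\<epsilon>>0. \<exists>g\<in>S. nrm M (\<lambda>x. f x - g x) < \<epsilon>)"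
proof -
  have "l2_class M g \<in> L2 M \<and> l2_dist M (l2_class M f) (l2_class M g) = nrm M (\<lambda>x. f x - g x)"
    if "g \<in> S" for g
    using assms that by (auto simp: subset_eq l2_class_in_L2 l2_dist_class)
  then show ?thesis unfolding L2_topology_def Metric_space.metric_closure_of[OF Metric_space_L2]
    using assms by (auto simp: Metric_space.in_mball[OF Metric_space_L2] l2_class_in_L2)
qed

lemma l2_lincomb_class:
  assumes "\<And>i. i < n \<Longrightarrow> e i \<in> l2_fun M"
  shows "l2_lincomb M n c (\<lambda>i. l2_class M (e i)) = l2_class M (\<lambda>x. \<Sum>i<n. c i * e i x)"
  unfolding l2_lincomb_def
proof (subst l2_class_eq_iff)
  show "(\<lambda>x. \<Sum>i<n. c i * rep (l2_class M (e i)) x) \<in> l2_fun M"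
    by (intro l2_fun_lincomb rep_L2(1) l2_class_in_L2 assms)
  show "(\<lambda>x. \<Sum>i<n. c i * e i x) \<in> l2_fun M" by (intro l2_fun_lincomb assms)
  have "AE x in M. \<forall>i\<in>{..<n}. rep (l2_class M (e i)) x = e i x"
    by (intro AE_finite_allI rep_l2_class) (auto intro: assms)
  then show "AE x in M. (\<Sum>i<n. c i * rep (l2_class M (e i)) x) = (\<Sum>i<n. c i * e i x)"
    by eventually_elim (auto intro: sum.cong)
qed

definition lincombs :: "('a \<Rightarrow> complex) set \<Rightarrow> ('a \<Rightarrow> complex) set" where
  "lincombs S = {g. \<exists>n c e. (\<forall>i<(n::nat). e i \<in> S) \<and> g = (\<lambda>x. \<Sum>i<n. c i * e i x)}"

lemma cspan_iff_lincombs: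
  assumes "f \<in> l2_fun M"
  shows "f \<in> cspan M S \<longleftrightarrow> (\<forall>\<epsilon>>0. \<exists>g\<in>lincombs S. nrm M (\<lambda>x. f x - g x) < \<epsilon>)"
proof -
  have "(\<exists>g\<in>lincombs S. nrm M (\<lambda>x. f x - g x) < \<epsilon>) \<longleftrightarrow>
    (\<exists>n c e. (\<forall>i<(n::nat). e i \<in> S) \<and> nrm M (\<lambda>x. f x - (\<Sum>i<n. c i * e i x)) < \<epsilon>)" for \<epsilon>
    unfolding lincombs_def Bex_def mem_Collect_eq
    by (rule iffI; elim exE conjE; hypsubst?; intro exI conjI; (assumption | rule refl))
  then show ?thesis using assms by (simp add: cspan_def)
qed

lemma l2_span_class:
  assumes "S \<subseteq> l2_fun M"
  shows "l2_span M (l2_class M ` S) =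
    l2_class M ` lincombs S"
proof (intro equalityI subsetI)
  fix F assume "F \<in> l2_span M (l2_class M ` S)"
  then obtain n c E where E: "\<forall>i<n. E i \<in> l2_class M ` S" "F = l2_lincomb M n c E"
    by (auto simp: l2_span_def)
  then have "\<forall>i. \<exists>g. i < n \<longrightarrow> g \<in> S \<and> E i = l2_class M g" by blast
  then obtain e where e: "\<forall>i<n. e i \<in> S \<and> E i = l2_class M (e i)" unfolding choice_iff by blast
  have "F = l2_lincomb M n c (\<lambda>i. l2_class M (e i))"
    unfolding E(2) l2_lincomb_def using e by (intro arg_cong[where f="l2_class M"] ext sum.cong) auto
  also have "\<dots> = l2_class M (\<lambda>x. \<Sum>i<n. c i * e i x)" using e assms by (intro l2_lincomb_class) auto
  finally have F: "F = l2_class M (\<lambda>x. \<Sum>i<n. c i * e i x)" .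
  have "(\<lambda>x. \<Sum>i<n. c i * e i x) \<in> lincombs S" unfolding lincombs_def
    using e by (intro CollectI exI[of _ n] exI[of _ c] exI[of _ e] conjI) auto
  then show "F \<in> l2_class M ` lincombs S" unfolding F by (rule imageI)
next
  fix F assume "F \<in> l2_class M ` lincombs S"
  then obtain n :: nat and c e where e: "\<forall>i<n. e i \<in> S" "F = l2_class M (\<lambda>x. \<Sum>i<n. c i * e i x)"
    by (auto simp: lincombs_def)
  then have "F = l2_lincomb M n c (\<lambda>i. l2_class M (e i))"
    using assms by (subst l2_lincomb_class) auto
  then show "F \<in> l2_span M (l2_class M ` S)" using e(1) unfolding l2_span_def
    by (intro CollectI exI[of _ n] exI[of _ c] exI[of _ "\<lambda>i. l2_class M (e i)"]) auto
qed

lemma closure_l2_span_eq_L2: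
  assumes S: "S \<subseteq> l2_fun M" and c: "cspan M S = l2_fun M"
  shows "L2_topology M closure_of (l2_span M (l2_class M ` S)) = L2 M"
proof (intro equalityI subsetI)
  fix F assume "F \<in> L2 M"
  then obtain f where f: "f \<in> l2_fun M" "F = l2_class M f" by (rule L2_cases)
  have sub: "lincombs S \<subseteq> l2_fun M"
    using S by (auto simp: lincombs_def intro!: l2_fun_lincomb)
  have "f \<in> cspan M S" using f c by simp
  then show "F \<in> L2_topology M closure_of (l2_span M (l2_class M ` S))"
    unfolding f(2) l2_span_class[OF S] l2_class_in_closure_iff[OF f(1) sub] cspan_iff_lincombs[OF f(1)] .
qed (use closure_of_subset_topspace[of "L2_topology M"] in auto)

lemma cspan_eq_l2_fun_if_closure:
  assumes S: "S \<subseteq> l2_fun M" and c: "L2_topology M closure_of (l2_span M (l2_class M ` S)) = L2 M"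
  shows "cspan M S = l2_fun M"
proof -
  have sub: "lincombs S \<subseteq> l2_fun M"
    using S by (auto simp: lincombs_def intro!: l2_fun_lincomb)
  have "f \<in> cspan M S" if f: "f \<in> l2_fun M" for f
  proof -
    have "l2_class M f \<in> L2_topology M closure_of (l2_span M (l2_class M ` S))"
      using c l2_class_in_L2[OF f] by simp
    then show ?thesis
      unfolding l2_span_class[OF S] l2_class_in_closure_iff[OF f sub] cspan_iff_lincombs[OF f] .
  qed
  then show ?thesis by (auto simp: cspan_def)
qed

section \<open>Baire category in the space of classes\<close>

lemma L2_mcomplete:
  assumes "prob_space M" shows "Metric_space.mcomplete (L2 M) (l2_dist M)"
  unfolding Metric_space.mcomplete_def[OF Metric_space_L2]
proof (intro allI impI)
  fix \<sigma> assume "Metric_space.MCauchy (L2 M) (l2_dist M) \<sigma>"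
  then have L: "\<And>n. \<sigma> n \<in> L2 M" and
    C: "\<And>\<epsilon>. \<epsilon> > 0 \<Longrightarrow> \<exists>N. \<forall>n n'. N \<le> n \<longrightarrow> N \<le> n' \<longrightarrow> l2_dist M (\<sigma> n) (\<sigma> n') < \<epsilon>"
    unfolding Metric_space.MCauchy_def[OF Metric_space_L2] by auto
  obtain g where g: "g \<in> l2_fun M" "\<And>\<epsilon>. \<epsilon> > 0 \<Longrightarrow> \<exists>N. \<forall>n\<ge>N. nrm M (\<lambda>x. rep (\<sigma> n) x - g x) < \<epsilon>"
    using l2_complete[OF assms, of "\<lambda>n. rep (\<sigma> n)"] L C
    unfolding l2_dist_nrm by (metis rep_L2(1))
  have "l2_dist M (\<sigma> n) (l2_class M g) = nrm M (\<lambda>x. rep (\<sigma> n) x - g x)" for n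
    using l2_dist_class[OF rep_L2(1)[OF L] g(1)] rep_L2(2)[OF L] by simp
  then show "\<exists>x. limitin (Metric_space.mtopology (L2 M) (l2_dist M)) \<sigma> x sequentially"
    using g L by (intro exI[of _ "l2_class M g"])
      (simp add: Metric_space.limit_metric_sequentially[OF Metric_space_L2] l2_class_in_L2)
qed

text \<open>
  Baire's theorem in the complete metric space of classes, phrased for countably many open and dense
  conditions on functions. Openness of a condition already makes it independent of the representative,
  since equivalent functions have distance zero. The second conclusion is used to find one vector that
  satisfies all conditions.
\<close>

lemma generic_L2I:
  assumes M: "prob_space M" and I: "countable I"
    and op: "\<And>i f. i \<in> I \<Longrightarrow> f \<in> l2_fun M \<Longrightarrow> P i f \<Longrightarrow>
      \<exists>\<delta>>0. \<forall>g\<in>l2_fun M. nrm M (\<lambda>x. f x - g x) < \<delta> \<longrightarrow> P i g"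
    and de: "\<And>i f \<epsilon>. i \<in> I \<Longrightarrow> f \<in> l2_fun M \<Longrightarrow> \<epsilon> > 0 \<Longrightarrow>
      \<exists>g\<in>l2_fun M. P i g \<and> nrm M (\<lambda>x. f x - g x) < \<epsilon>"
  shows "S \<subseteq> L2 M \<Longrightarrow> (\<And>f. f \<in> l2_fun M \<Longrightarrow> (\<And>i. i \<in> I \<Longrightarrow> P i f) \<Longrightarrow> l2_class M f \<in> S) \<Longrightarrow>
      generic_in (L2_topology M) S"
    and "\<exists>g\<in>l2_fun M. \<forall>i\<in>I. P i g"
proof -
  define A where "A i = l2_class M ` {f \<in> l2_fun M. P i f}" for i
  have A_iff: "l2_class M f \<in> A i \<longleftrightarrow> P i f" if i: "i \<in> I" and f: "f \<in> l2_fun M" for i f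
  proof
    assume "l2_class M f \<in> A i"
    then obtain g where g: "g \<in> l2_fun M" "P i g" "l2_class M f = l2_class M g" unfolding A_def by auto
    then have "AE x in M. g x - f x = 0" using l2_class_eq_iff[OF f g(1)] by auto
    then have "nrm M (\<lambda>x. g x - f x) = 0" using nrm_eq_0_iff[OF l2_fun_diff[OF g(1) f]] by simp
    then show "P i f" using op[OF i g(1,2)] f by auto
  qed (use f in \<open>auto simp: A_def\<close>)
  have opA: "openin (L2_topology M) (A i)" if i: "i \<in> I" for i
    unfolding L2_topology_def Metric_space.openin_mtopology[OF Metric_space_L2]
  proof (intro conjI allI impI)
    show "A i \<subseteq> L2 M" by (auto simp: A_def l2_class_in_L2)
    fix F assume "F \<in> A i"
    then obtain f where f: "f \<in> l2_fun M" "P i f" "F = l2_class M f" unfolding A_def by auto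
    obtain \<delta> where \<delta>: "\<delta> > 0" "\<forall>g\<in>l2_fun M. nrm M (\<lambda>x. f x - g x) < \<delta> \<longrightarrow> P i g"
      using op[OF i f(1,2)] by auto
    have "Metric_space.mball (L2 M) (l2_dist M) F \<delta> \<subseteq> A i"
    proof
      fix G assume "G \<in> Metric_space.mball (L2 M) (l2_dist M) F \<delta>"
      then have G: "G \<in> L2 M" "l2_dist M F G < \<delta>"
        by (auto simp: Metric_space.in_mball[OF Metric_space_L2])
      then obtain g where g: "g \<in> l2_fun M" "G = l2_class M g" by (auto elim: L2_cases)
      then show "G \<in> A i" using G(2) \<delta>(2) i f A_iff by (auto simp: l2_dist_class)
    qed
    then show "\<exists>r>0. Metric_space.mball (L2 M) (l2_dist M) F r \<subseteq> A i" using \<delta>(1) by blast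
  qed
  have deA: "L2_topology M closure_of (A i) = L2 M" if i: "i \<in> I" for i
  proof (intro equalityI subsetI)
    fix F assume "F \<in> L2 M"
    then obtain f where f: "f \<in> l2_fun M" "F = l2_class M f" by (rule L2_cases)
    show "F \<in> L2_topology M closure_of (A i)" unfolding A_def f(2)
      by (subst l2_class_in_closure_iff) (use f de[OF i f(1)] in auto)
  qed (use closure_of_subset_topspace[of "L2_topology M"] in auto)
  define \<G> where "\<G> = insert (L2 M) (A ` I)"
  have "openin (L2_topology M) (L2 M)" using openin_topspace[of "L2_topology M"] by simp
  moreover have "L2_topology M closure_of (L2 M) = L2 M" using closure_of_topspace[of "L2_topology M"] by simp
  ultimately have op\<G>: "openin (L2_topology M) T" and de\<G>: "L2_topology M closure_of T = L2 M" if "T \<in> \<G>" for T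
    using that opA deA unfolding \<G>_def by blast+
  have c: "countable \<G>" using I by (simp add: \<G>_def)
  have dense: "L2_topology M closure_of (\<Inter>\<G>) = L2 M"
    using Metric_space.metric_Baire_category[OF Metric_space_L2 L2_mcomplete[OF M] c] op\<G> de\<G>
    unfolding L2_topology_def by blast
  have gd: "gdelta_in (L2_topology M) (\<Inter>\<G>)"
    using c op\<G> by (intro gdelta_in_Inter open_imp_gdelta_in) (auto simp: \<G>_def)
  have sub: "\<Inter>\<G> \<subseteq> L2 M" by (auto simp: \<G>_def)
  have Int_P: "\<exists>f\<in>l2_fun M. F = l2_class M f \<and> (\<forall>i\<in>I. P i f)" if "F \<in> \<Inter>\<G>" for F
  proof -
    have "F \<in> L2 M" using that sub by auto
    then obtain f where f: "f \<in> l2_fun M" "F = l2_class M f" by (rule L2_cases)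
    moreover have "P i f" if "i \<in> I" for i using A_iff[OF that f(1)] \<open>F \<in> \<Inter>\<G>\<close> f(2) that by (auto simp: \<G>_def)
    ultimately show ?thesis by blast
  qed
  show "generic_in (L2_topology M) S" if "S \<subseteq> L2 M" "\<And>f. f \<in> l2_fun M \<Longrightarrow> (\<And>i. i \<in> I \<Longrightarrow> P i f) \<Longrightarrow> l2_class M f \<in> S"
  proof -
    have "\<Inter>\<G> \<subseteq> S" using Int_P that(2) by (metis subsetI)
    then show ?thesis unfolding generic_in_def dense_in_def using gd dense sub that(1) by auto
  qed
  have "L2 M \<noteq> {}" using l2_class_in_L2[OF l2_fun_zero] by auto
  then have "\<Inter>\<G> \<noteq> {}" using dense by (metis closure_of_empty)
  then show "\<exists>g\<in>l2_fun M. \<forall>i\<in>I. P i g" using Int_P by blast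
qed

section \<open>Representatives of transformations and Koopman operators\<close>

text \<open>
  The cyclic vectors in question belong to the Koopman operator of the inverse, so composition
  with \<open>tinv M T\<close> is the operator that matters; it also describes images, since \<open>T E\<close> is up to a null
  set the preimage of \<open>E\<close> under \<open>tinv M T\<close>.
\<close>

definition tinv :: "'a measure \<Rightarrow> ('a \<Rightarrow> 'a) set \<Rightarrow> 'a \<Rightarrow> 'a" where
  "tinv M T = rep (mpt_inv M T)"

lemma ess_iso_rep_tinv:
  assumes M: "prob_space M" and T: "T \<in> MPT M"
  shows "ess_iso M M (rep T) (tinv M T)"
proof -
  have "rep T \<in> mpt_maps M" using rep_in(2)[of T "mpt_maps M" M] T by (simp add: MPT_def)
  then obtain s where s: "ess_iso M M (rep T) s" using mpt_maps_iff[OF M] by blast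
  note sD = ess_isoD[OF s]
  have "s \<in> mpt_inv M T" unfolding mpt_inv_def
    using mpt_maps_iff[OF M] ess_iso_sym[OF s] sD(4,5) by auto
  then have "tinv M T \<in> mpt_inv M T" unfolding tinv_def rep_def by (rule someI[of "\<lambda>f. f \<in> mpt_inv M T"])
  then have t: "tinv M T \<in> mpt_maps M" "AE x in M. tinv M T (rep T x) = x \<and> rep T (tinv M T x) = x"
    by (auto simp: mpt_inv_def)
  then have "tinv M T \<in> M \<rightarrow>\<^sub>M M" by (simp add: mpt_maps_def)
  then show ?thesis using sD(1,3) t(2) unfolding ess_iso_def by auto
qed

lemma ess_iso_AE_unique:
  assumes "ess_iso M N f g" "ess_iso M N f' g'" "AE x in M. f x = f' x"
  shows "AE y in N. g y = g' y"
proof -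
  note f = ess_isoD[OF assms(1)] and f' = ess_isoD[OF assms(2)]
    and g' = ess_isoD[OF ess_iso_sym[OF assms(2)]]
  have "AE y in N. f (g' y) = f' (g' y)" using AE_distr_pullback[OF g'(1,3) assms(3)] .
  moreover have "AE y in N. g (f (g' y)) = g' y" using AE_distr_pullback[OF g'(1,3) f(4)] .
  ultimately show ?thesis using f'(5) by eventually_elim auto
qed

definition mpt_class :: "'a measure \<Rightarrow> ('a \<Rightarrow> 'a) \<Rightarrow> ('a \<Rightarrow> 'a) set" where
  "mpt_class M t = ae_rel M (mpt_maps M) `` {t}"

lemma mpt_class:
  assumes M: "prob_space M" and t: "ess_iso M M t s"
  shows "mpt_class M t \<in> MPT M" "AE x in M. rep (mpt_class M t) x = t x"
    "AE x in M. tinv M (mpt_class M t) x = s x"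
proof -
  have t': "t \<in> mpt_maps M" using mpt_maps_iff[OF M] t by blast
  show T: "mpt_class M t \<in> MPT M" unfolding mpt_class_def MPT_def by (rule quotientI[OF t'])
  then have "rep (mpt_class M t) \<in> mpt_class M t" using rep_in(1)[of "mpt_class M t" "mpt_maps M" M] by (simp add: MPT_def)
  then show r: "AE x in M. rep (mpt_class M t) x = t x"
    unfolding mpt_class_def ae_rel_def by (auto elim: AE_mp)
  show "AE x in M. tinv M (mpt_class M t) x = s x"
    by (rule ess_iso_AE_unique[OF ess_iso_rep_tinv[OF M T] t r])
qed

lemma MPT_mem_iff:
  assumes T: "T \<in> MPT M"
  shows "t \<in> T \<longleftrightarrow> t \<in> mpt_maps M \<and> (AE x in M. rep T x = t x)"
proof -
  note r = rep_in[of T "mpt_maps M" M] 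
  have "T = ae_rel M (mpt_maps M) `` {rep T}" using T r(3) by (simp add: MPT_def)
  then have "t \<in> T \<longleftrightarrow> (rep T, t) \<in> ae_rel M (mpt_maps M)" by blast
  then show ?thesis using T r(2) by (auto simp: ae_rel_def MPT_def)
qed

lemma koopman_class:
  assumes t: "rep T \<in> M \<rightarrow>\<^sub>M M" "distr M M (rep T) = M" and f: "f \<in> l2_fun M"
  shows "koopman M T (l2_class M f) = l2_class M (\<lambda>x. f (rep T x))"
proof -
  have "AE x in M. rep (l2_class M f) (rep T x) = f (rep T x)"
    by (rule AE_distr_pullback[OF t rep_l2_class[OF f]])
  moreover have "(\<lambda>x. rep (l2_class M f) (rep T x)) \<in> l2_fun M" "(\<lambda>x. f (rep T x)) \<in> l2_fun M"
    using t f by (auto intro!: measure_preserving_l2 rep_L2 l2_class_in_L2)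
  ultimately show ?thesis unfolding koopman_def comp_def by (simp add: l2_class_eq_iff)
qed

lemma funpow_measure_preserving:
  assumes "s \<in> M \<rightarrow>\<^sub>M M" "distr M M s = M"
  shows "s ^^ k \<in> M \<rightarrow>\<^sub>M M" "distr M M (s ^^ k) = M"
proof -
  have "s ^^ k \<in> M \<rightarrow>\<^sub>M M \<and> distr M M (s ^^ k) = M"
  proof (induction k)
    case (Suc k)
    have "s ^^ Suc k = (s ^^ k) \<circ> s" by (simp add: funpow_swap1 fun_eq_iff)
    moreover have "distr M M ((s ^^ k) \<circ> s) = distr (distr M M s) M (s ^^ k)"
      using Suc assms by (intro distr_distr[symmetric]) auto
    moreover have "(s ^^ k) \<circ> s \<in> M \<rightarrow>\<^sub>M M" by (rule measurable_comp[OF assms(1)]) (use Suc in simp)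
    ultimately show ?case using Suc assms by metis
  qed (simp add: id_def distr_id)
  then show "s ^^ k \<in> M \<rightarrow>\<^sub>M M" "distr M M (s ^^ k) = M" by auto
qed

lemma koopman_funpow_class:
  assumes t: "rep T \<in> M \<rightarrow>\<^sub>M M" "distr M M (rep T) = M" and f: "f \<in> l2_fun M"
  shows "(koopman M T ^^ k) (l2_class M f) = l2_class M (\<lambda>x. f ((rep T ^^ k) x))"
proof (induction k)
  case (Suc k)
  then show ?case
    using koopman_class[OF t measure_preserving_l2(1)[OF funpow_measure_preserving[OF t] f]]
    by (simp add: funpow_swap1)
qed simp

definition orbit_fun :: "('a \<Rightarrow> 'a) \<Rightarrow> ('a \<Rightarrow> complex) \<Rightarrow> nat \<Rightarrow> 'a \<Rightarrow> complex" where
  "orbit_fun s f k = (\<lambda>x. f ((s ^^ k) x))"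

lemma orbit_fun_l2:
  assumes "s \<in> M \<rightarrow>\<^sub>M M" "distr M M s = M" "f \<in> l2_fun M"
  shows "orbit_fun s f k \<in> l2_fun M" "nrm M (orbit_fun s f k) = nrm M f"
  unfolding orbit_fun_def using measure_preserving_l2[OF funpow_measure_preserving[OF assms(1,2)] assms(3)] by auto

lemma asymp_lin_predictive_iff:
  assumes M: "prob_space M" and T: "T \<in> MPT M" and f: "f \<in> l2_fun M"
  shows "asymp_lin_predictive M T (l2_class M f) \<longleftrightarrow> cspan M (range (orbit_fun (tinv M T) f)) = l2_fun M"
proof -
  note s = ess_isoD[OF ess_iso_sym[OF ess_iso_rep_tinv[OF M T]]]
  note s' = s(1,3)[unfolded tinv_def]
  have eq: "{(koopman M (mpt_inv M T) ^^ k) (l2_class M f) |k. True} = l2_class M ` range (orbit_fun (tinv M T) f)"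
    using koopman_funpow_class[OF s' f] by (auto simp: orbit_fun_def tinv_def)
  have sub: "range (orbit_fun (tinv M T) f) \<subseteq> l2_fun M" using orbit_fun_l2[OF s(1,3) f] by auto
  show ?thesis unfolding asymp_lin_predictive_def cyclic_vector_def eq
    using closure_l2_span_eq_L2[OF sub] cspan_eq_l2_fun_if_closure[OF sub] l2_class_in_L2[OF f] by blast
qed

lemma weakly_lin_asymp_predictiveI:
  assumes M: "prob_space M" and T: "T \<in> MPT M" and f: "f \<in> l2_fun M"
    and app: "\<And>\<epsilon>. \<epsilon> > 0 \<Longrightarrow> \<exists>k. nrm M (\<lambda>x. f (rep T x) - orbit_fun (tinv M T) f k x) < \<epsilon>"
  shows "weakly_lin_asymp_predictive M T (l2_class M f)"
proof -
  note t = ess_isoD[OF ess_iso_rep_tinv[OF M T]]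
  note s = ess_isoD[OF ess_iso_sym[OF ess_iso_rep_tinv[OF M T]]]
  note s' = s(1,3)[unfolded tinv_def]
  let ?O = "range (orbit_fun (tinv M T) f)"
  have sub: "?O \<subseteq> l2_fun M" using orbit_fun_l2[OF s(1,3) f] by auto
  have ft: "(\<lambda>x. f (rep T x)) \<in> l2_fun M" by (rule measure_preserving_l2(1)[OF t(1,3) f])
  have "l2_class M ` ?O \<subseteq> (\<Union>d. delay_space M T (l2_class M f) d)"
  proof
    fix F assume "F \<in> l2_class M ` ?O"
    then obtain k where k: "F = l2_class M (orbit_fun (tinv M T) f k)" by auto
    have eq: "(koopman M (mpt_inv M T) ^^ k) (l2_class M f) = F"
      using koopman_funpow_class[OF s' f, of k] by (simp add: k orbit_fun_def tinv_def)
    have "F \<in> L2 M" using sub unfolding k by (auto intro: l2_class_in_L2)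
    then have "F = l2_lincomb M 1 (\<lambda>i. 1) (\<lambda>i. F)" by (simp add: l2_lincomb_def rep_L2)
    moreover have "F \<in> {(koopman M (mpt_inv M T) ^^ j) (l2_class M f) |j. j < Suc k}" using eq by blast
    ultimately have "F \<in> delay_space M T (l2_class M f) (Suc k)"
      unfolding delay_space_def l2_span_def by blast
    then show "F \<in> (\<Union>d. delay_space M T (l2_class M f) d)" by blast
  qed
  moreover have "l2_class M (\<lambda>x. f (rep T x)) \<in> L2_topology M closure_of (l2_class M ` ?O)"
    using app by (subst l2_class_in_closure_iff[OF ft sub]) auto
  ultimately have "l2_class M (\<lambda>x. f (rep T x)) \<in> L2_topology M closure_of (\<Union>d. delay_space M T (l2_class M f) d)"
    using closure_of_mono by blast
  then show ?thesis unfolding weakly_lin_asymp_predictive_def koopman_class[OF t(1,3) f]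
    using l2_class_in_L2[OF f] by simp
qed

section \<open>Piecewise translations\<close>

text \<open>
  An exact bijection of \<open>[0,1)\<close> with countably many displacements. Both maps send all reals into
  \<open>[0,1)\<close>, so that they also act on the models, which contain the point \<open>1\<close>.
\<close>

definition piecewise_translation :: "(real \<Rightarrow> real) \<Rightarrow> (real \<Rightarrow> real) \<Rightarrow> bool" where
  "piecewise_translation h k \<longleftrightarrow> h \<in> borel_measurable borel \<and> k \<in> borel_measurable borel \<and>
     range h \<subseteq> {0..<1} \<and> range k \<subseteq> {0..<1} \<and>
     (\<forall>x\<in>{0..<1}. k (h x) = x \<and> h (k x) = x) \<and> countable ((\<lambda>x. h x - x) ` {0..<1})"

text \<open>
  Both sides are cut into countably many pieces according to the displacement \<open>c\<close>. The piece \<open>Q c\<close> of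
  the target is the translate by \<open>c\<close> of the piece \<open>P c\<close> of the source.
\<close>

lemma piecewise_translation_emeasure:
  assumes "piecewise_translation h k" and A[measurable]: "A \<in> sets borel"
  shows "emeasure lborel {x \<in> {0..<1}. h x \<in> A} = emeasure lborel (A \<inter> {0..<1})"
proof -
  have [measurable]: "h \<in> borel_measurable borel" "k \<in> borel_measurable borel"
    and r: "\<And>x. h x \<in> {0..<1}" "\<And>x. k x \<in> {0..<1}"
    and kh: "\<And>x. x \<in> {0..<1} \<Longrightarrow> k (h x) = x" and hk: "\<And>x. x \<in> {0..<1} \<Longrightarrow> h (k x) = x"
    and C: "countable ((\<lambda>x. h x - x) ` {0..<1})"
    using assms(1) unfolding piecewise_translation_def by blast+
  define C where "C = (\<lambda>x. h x - x) ` {0..<1}"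
  define P where "P c = {x. x \<in> {0..<1} \<and> h x - x = c \<and> h x \<in> A}" for c
  define Q where "Q c = {y. y \<in> {0..<1} \<and> y \<in> A \<and> y - k y = c}" for c
  have [measurable]: "P c \<in> sets borel" "Q c \<in> sets borel" for c
  proof -
    have hA: "h -` A \<in> sets borel" using measurable_sets[of h borel borel A] by simp
    have hc: "(\<lambda>x. h x - x) -` {c} \<in> sets borel" "(\<lambda>x. x - k x) -` {c} \<in> sets borel"
      using measurable_sets[of "\<lambda>x. h x - x" borel borel "{c}"] measurable_sets[of "\<lambda>x. x - k x" borel borel "{c}"]
      by auto
    have "P c = {0..<1} \<inter> (\<lambda>x. h x - x) -` {c} \<inter> h -` A" by (auto simp: P_def)
    moreover have "Q c = {0..<1} \<inter> A \<inter> (\<lambda>x. x - k x) -` {c}" by (auto simp: Q_def)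
    ultimately show "P c \<in> sets borel" "Q c \<in> sets borel" using hA hc A by auto
  qed
  have PQ: "P c = (\<lambda>x. c + x) -` Q c" for c
  proof (intro equalityI subsetI)
    fix x assume x: "x \<in> P c"
    then have e: "c + x = h x" by (auto simp: P_def)
    show "x \<in> (\<lambda>x. c + x) -` Q c" using x r(1)[of x] kh[of x] unfolding vimage_eq e by (auto simp: P_def Q_def)
  next
    fix x assume "x \<in> (\<lambda>x. c + x) -` Q c"
    then have *: "c + x \<in> {0..<1}" "c + x \<in> A" "k (c + x) = x" by (auto simp: Q_def)
    then show "x \<in> P c" using hk[OF *(1)] r(2)[of "c + x"] by (auto simp: P_def)
  qed
  have e: "emeasure lborel (P c) = emeasure lborel (Q c)" for c
  proof -
    have "emeasure lborel (Q c) = emeasure (distr lborel borel (\<lambda>x. c + x)) (Q c)"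
      by (simp add: lborel_distr_plus)
    also have "\<dots> = emeasure lborel ((\<lambda>x. c + x) -` Q c)" by (subst emeasure_distr) auto
    finally show ?thesis by (simp add: PQ)
  qed
  have "emeasure lborel {x \<in> {0..<1}. h x \<in> A} = emeasure lborel (\<Union>(P ` C))"
    by (rule arg_cong[where f="emeasure lborel"]) (auto simp: P_def C_def)
  also have "\<dots> = (\<integral>\<^sup>+c. emeasure lborel (P c) \<partial>count_space C)"
    using C by (intro emeasure_UN_countable) (auto simp: C_def[symmetric] disjoint_family_on_def P_def)
  also have "\<dots> = (\<integral>\<^sup>+c. emeasure lborel (Q c) \<partial>count_space C)" by (simp add: e)
  also have "\<dots> = emeasure lborel (\<Union>(Q ` C))"
    using C by (intro emeasure_UN_countable[symmetric]) (auto simp: C_def[symmetric] disjoint_family_on_def Q_def)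
  also have "(\<Union>(Q ` C)) = A \<inter> {0..<1}"
  proof (intro equalityI subsetI)
    fix y assume y: "y \<in> A \<inter> {0..<1}"
    then have "y - k y \<in> C" unfolding C_def using hk[of y] r(2)[of y] by (intro image_eqI[of _ _ "k y"]) auto
    then show "y \<in> \<Union>(Q ` C)" using y by (auto simp: Q_def)
  qed (auto simp: Q_def)
  finally show ?thesis .
qed

lemma piecewise_translation_emeasure':
  assumes h: "piecewise_translation h k" and A: "A \<in> sets borel"
  shows "emeasure lborel (h -` A \<inter> {0..1}) = emeasure lborel (A \<inter> {0..1})"
proof -
  have [measurable]: "h \<in> borel_measurable borel" "A \<in> sets borel"
    using h A by (auto simp: piecewise_translation_def)
  have m: "h -` A \<in> sets borel" using measurable_sets[of h borel borel A] by simp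
  have one: "{1::real} \<in> null_sets lborel" by (auto intro: null_setsI)
  have "emeasure lborel (h -` A \<inter> {0..1}) = emeasure lborel ((h -` A \<inter> {0..1}) - {1})"
    using m by (intro emeasure_Diff_null_set[OF one, symmetric]) auto
  also have "(h -` A \<inter> {0..1}) - {1} = {x \<in> {0..<1}. h x \<in> A}" by auto
  also have "emeasure lborel \<dots> = emeasure lborel (A \<inter> {0..<1})" by (rule piecewise_translation_emeasure[OF h A])
  also have "A \<inter> {0..<1} = (A \<inter> {0..1}) - {1}" by auto
  also have "emeasure lborel \<dots> = emeasure lborel (A \<inter> {0..1})"
    by (intro emeasure_Diff_null_set[OF one]) auto
  finally show ?thesis .
qed

section \<open>Models of the unit interval\<close>

definition interval_model :: "real measure \<Rightarrow> bool" where
  "interval_model N \<longleftrightarrow> N = restrict_space lborel {0..1} \<or> N = lebesgue_on {0..1}"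

lemma interval_model:
  assumes "interval_model N"
  shows "space N = {0..1}"
    and "X \<in> sets borel \<Longrightarrow> X \<inter> {0..1} \<in> sets N"
    and "X \<in> sets N \<Longrightarrow> X \<in> sets lebesgue \<and> X \<subseteq> {0..1} \<and> emeasure N X = emeasure lebesgue X"
proof -
  show "space N = {0..1}" using assms by (auto simp: interval_model_def space_restrict_space)
  show "X \<inter> {0..1} \<in> sets N" if "X \<in> sets borel"
    using assms that by (auto simp: interval_model_def sets_restrict_space_iff)
  show "X \<in> sets lebesgue \<and> X \<subseteq> {0..1} \<and> emeasure N X = emeasure lebesgue X" if "X \<in> sets N"
  proof -
    from assms consider "N = restrict_space lborel {0..1}" | "N = lebesgue_on {0..1}"
      by (auto simp: interval_model_def)
    then show ?thesis
    proof cases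
      case 1
      then have "X \<in> sets lborel" "X \<subseteq> {0..1}" using that by (auto simp: sets_restrict_space_iff)
      then show ?thesis unfolding 1 by (auto simp: emeasure_restrict_space)
    next
      case 2
      then have "X \<in> sets lebesgue" "X \<subseteq> {0..1}" using that by (auto simp: sets_restrict_space_iff)
      then show ?thesis unfolding 2 by (auto simp: emeasure_restrict_space)
    qed
  qed
qed

lemma interval_model_prob_space:
  assumes "interval_model N" shows "prob_space N"
proof
  have "{0..1} \<in> sets N" using interval_model(1)[OF assms] sets.top[of N] by simp
  then show "emeasure N (space N) = 1"
    using interval_model[OF assms] by auto
qed

text \<open>
  For the Lebesgue sets one writes \<open>X\<close> as a Borel set \<open>S\<close> and a subset \<open>Z\<close> of a Borel null set; the
  preimage of that null set is null by the Borel case.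
\<close>

lemma piecewise_translation_ess_iso:
  assumes h: "piecewise_translation h k" and k: "piecewise_translation k h" and N: "interval_model N"
  shows "ess_iso N N h k"
proof -
  note Nm = interval_model[OF N]
  have key: "h -` X \<inter> {0..1} \<in> sets N \<and> emeasure N (h -` X \<inter> {0..1}) = emeasure N X"
    if h: "piecewise_translation h k" and X: "X \<in> sets N" for h k X
  proof -
    have hm[measurable]: "h \<in> borel_measurable borel"
      using h by (auto simp: piecewise_translation_def)
    have hS: "h -` S \<in> sets borel" if "S \<in> sets borel" for S
      using measurable_sets[OF hm that] by simp
    have XL: "X \<in> sets lebesgue" "X \<subseteq> {0..1}" "emeasure N X = emeasure lebesgue X" using Nm(3)[OF X] by auto
    define S where "S = main_part lborel X"
    define Z where "Z = null_part lborel X"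
    have S: "S \<in> sets borel" using XL(1) unfolding S_def by (metis main_part_sets sets_lborel)
    have SZ: "S \<union> Z = X" using XL(1) unfolding S_def Z_def by (rule main_part_null_part_Un)
    obtain Z' where Z': "Z' \<in> null_sets lborel" "Z \<subseteq> Z'" using null_part[OF XL(1)] unfolding Z_def by auto
    have "emeasure lborel (h -` Z' \<inter> {0..1}) = emeasure lborel (Z' \<inter> {0..1})"
      using Z' by (intro piecewise_translation_emeasure'[OF h]) auto
    also have "\<dots> = 0" using Z'(1) by (metis emeasure_eq_0 inf_le1 null_setsD1 null_setsD2)
    finally have nz: "h -` Z' \<inter> {0..1} \<in> null_sets lborel"
      using Z' hS[of Z'] by (intro null_setsI) auto
    have hZ: "h -` Z \<inter> {0..1} \<in> null_sets lebesgue"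
      by (rule null_sets_completion_subset[OF _ null_sets_completionI[OF nz]]) (use Z'(2) in auto)
    have Zn: "Z \<in> null_sets lebesgue" by (rule null_sets_completion_subset[OF Z'(2) null_sets_completionI[OF Z'(1)]])
    have eq: "h -` X \<inter> {0..1} = (h -` S \<inter> {0..1}) \<union> (h -` Z \<inter> {0..1})" using SZ by auto
    have hS': "h -` S \<inter> {0..1} \<in> sets borel" using hS[OF S] by auto
    have lX: "h -` X \<inter> {0..1} \<in> sets lebesgue" unfolding eq using hS' hZ by auto
    have s1: "h -` X \<inter> {0..1} \<in> sets N"
    proof (cases "N = lebesgue_on {0..1}")
      case True
      then show ?thesis using lX by (auto simp: sets_restrict_space_iff)
    next
      case False
      then have N0: "N = restrict_space lborel {0..1}" using N by (auto simp: interval_model_def)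
      then have "X \<in> sets borel" using X by (auto simp: sets_restrict_space_iff)
      then show ?thesis using hS[of X] unfolding N0 by (auto simp: sets_restrict_space_iff)
    qed
    have "emeasure N (h -` X \<inter> {0..1}) = emeasure lebesgue (h -` X \<inter> {0..1})" using Nm(3)[OF s1] by simp
    also have "\<dots> = emeasure lebesgue (h -` S \<inter> {0..1})"
      unfolding eq using hS' hZ by (intro emeasure_Un_null_set) auto
    also have "\<dots> = emeasure lborel (h -` S \<inter> {0..1})" using hS' by simp
    also have "\<dots> = emeasure lborel (S \<inter> {0..1})" by (rule piecewise_translation_emeasure'[OF h S])
    also have "\<dots> = emeasure lebesgue S" proof -
      have "S \<inter> {0..1} = S" using SZ XL(2) by auto
      then show ?thesis using S by simp
    qed
    also have "\<dots> = emeasure lebesgue (S \<union> Z)" using S Zn by (intro emeasure_Un_null_set[symmetric]) auto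
    also have "\<dots> = emeasure N X" using SZ XL by simp
    finally show ?thesis using s1 by simp
  qed
  have "h x \<in> {0..<1}" "k x \<in> {0..<1}" for x
    using h unfolding piecewise_translation_def by blast+
  then have hr: "h x \<in> {0..1}" "k x \<in> {0..1}" for x
    by (meson atLeastLessThan_iff atLeastAtMost_iff less_imp_le)+
  have m: "h \<in> N \<rightarrow>\<^sub>M N" "k \<in> N \<rightarrow>\<^sub>M N"
    using key[OF h] key[OF k] hr by (auto intro!: measurableI simp: Nm(1))
  moreover have "distr N N h = N"
    by (rule measure_eqI) (use key[OF h] m in \<open>auto simp: emeasure_distr Nm(1)\<close>)
  moreover have "AE x in N. x \<noteq> 1"
  proof -
    have "{1::real} \<in> sets N" using Nm(2)[of "{1}"] by simp
    moreover from Nm(3)[OF this] have "emeasure N {1} = 0" by simp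
    ultimately have "{1} \<in> null_sets N" by auto
    from AE_not_in[OF this] show ?thesis by simp
  qed
  then have "AE x in N. x \<in> {0..<1}" using AE_space by eventually_elim (auto simp: Nm(1))
  then have "AE x in N. k (h x) = x" "AE x in N. h (k x) = x"
    by (eventually_elim, use h in \<open>simp add: piecewise_translation_def\<close>)+
  ultimately show ?thesis by (auto simp: ess_iso_def)
qed

section \<open>Rotations and rearrangements of cells\<close>

text \<open>
  Rotation of the circle, with the circle written as \<open>[0,1)\<close>.
\<close>

definition rot :: "real \<Rightarrow> real \<Rightarrow> real" where
  "rot a x = frac (x + a)"

lemma rot_rot: "rot b (rot a x) = rot (a + b) x"
proof -
  have "frac (x + a) + b = (x + (a + b)) + of_int (- \<lfloor>x + a\<rfloor>)" by (simp add: frac_def)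
  then show ?thesis unfolding rot_def by (simp only: frac_add_of_int_right)
qed

lemma rot_0: "x \<in> {0..<1} \<Longrightarrow> rot 0 x = x" by (simp add: rot_def frac_eq)

lemma piecewise_translation_rot: "piecewise_translation (rot a) (rot (- a))"
  unfolding piecewise_translation_def
proof (intro conjI ballI)
  have "rot b \<in> borel_measurable borel" for b unfolding rot_def frac_def by measurable
  then show "rot a \<in> borel_measurable borel" "rot (- a) \<in> borel_measurable borel" by auto
  show "range (rot a) \<subseteq> {0..<1}" "range (rot (- a)) \<subseteq> {0..<1}" by (auto simp: rot_def frac_lt_1)
  show "rot (- a) (rot a x) = x" "rot a (rot (- a) x) = x" if "x \<in> {0..<1}" for x
    using rot_0[OF that] by (simp_all add: rot_rot)
  have "(\<lambda>x. rot a x - x) ` {0..<1} \<subseteq> range (\<lambda>i::int. a - of_int i)"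
    by (auto simp: rot_def frac_def)
  then show "countable ((\<lambda>x. rot a x - x) ` {0..<1})" by (rule countable_subset) auto
qed

text \<open>
  The number of the interval \<open>[j/q, (j+1)/q)\<close> that contains a point of \<open>[0,1)\<close>.
\<close>

definition cell :: "nat \<Rightarrow> real \<Rightarrow> nat" where
  "cell q x = nat \<lfloor>real q * x\<rfloor>"

lemma cell_less: "q > 0 \<Longrightarrow> x \<in> {0..<1} \<Longrightarrow> cell q x < q"
  unfolding cell_def by (auto simp: nat_less_iff floor_less_iff)

lemma cell_decomp:
  assumes "x \<in> {0..<1}" "q > 0"
  shows "x = (real (cell q x) + frac (real q * x)) / real q"
  using assms by (simp add: cell_def frac_def)

lemma cell_of_decomp:
  assumes "j < q" "0 \<le> r" "r < 1"
  defines "x \<equiv> (real j + r) / real q"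
  shows "x \<in> {0..<1}" "cell q x = j" "frac (real q * x) = r"
proof -
  have q: "real q > 0" using assms by auto
  have qx: "real q * x = real j + r" using q by (simp add: x_def)
  have f: "\<lfloor>real j + r\<rfloor> = int j" using assms by (simp add: floor_eq_iff)
  have "real j + r < real q" using assms by linarith
  then show "x \<in> {0..<1}" using assms q by (simp add: x_def)
  show "cell q x = j" by (simp add: cell_def qx f)
  show "frac (real q * x) = r" by (simp add: frac_def qx f)
qed

lemma measurable_cell [measurable]: "cell q \<in> borel \<rightarrow>\<^sub>M count_space UNIV"
  unfolding cell_def by measurable

text \<open>
  The interval exchange that translates cell \<open>j\<close> onto cell \<open>\<sigma> j\<close>. Taking the fractional part first
  makes the map send \<open>1\<close>, and every other real, into \<open>[0,1)\<close>.
\<close>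

definition permute_cells :: "nat \<Rightarrow> (nat \<Rightarrow> nat) \<Rightarrow> real \<Rightarrow> real" where
  "permute_cells q \<sigma> x = (real (\<sigma> (cell q (frac x))) + frac (real q * frac x)) / real q"

lemma permute_cells:
  assumes "q > 0" "\<sigma> ` {..<q} \<subseteq> {..<q}"
  shows "permute_cells q \<sigma> x \<in> {0..<1}" "cell q (permute_cells q \<sigma> x) = \<sigma> (cell q (frac x))"
    "frac (real q * permute_cells q \<sigma> x) = frac (real q * frac x)"
proof -
  have "cell q (frac x) < q" using assms(1) by (intro cell_less) (auto simp: frac_lt_1)
  then have "\<sigma> (cell q (frac x)) < q" using assms(2) by auto
  from cell_of_decomp[OF this frac_ge_0 frac_lt_1, of "real q * frac x"]
  show "permute_cells q \<sigma> x \<in> {0..<1}" "cell q (permute_cells q \<sigma> x) = \<sigma> (cell q (frac x))"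
    "frac (real q * permute_cells q \<sigma> x) = frac (real q * frac x)"
    by (auto simp: permute_cells_def)
qed

lemma piecewise_translation_permute_cells:
  assumes q: "q > 0" and s: "\<sigma> ` {..<q} \<subseteq> {..<q}" "\<tau> ` {..<q} \<subseteq> {..<q}"
    and inv: "\<And>j. j < q \<Longrightarrow> \<tau> (\<sigma> j) = j" "\<And>j. j < q \<Longrightarrow> \<sigma> (\<tau> j) = j"
  shows "piecewise_translation (permute_cells q \<sigma>) (permute_cells q \<tau>)"
  unfolding piecewise_translation_def
proof (intro conjI ballI)
  have fm: "frac \<in> borel_measurable (borel :: real measure)" unfolding frac_def[abs_def] by measurable
  have "permute_cells q \<rho> \<in> borel_measurable borel" for \<rho>
    unfolding permute_cells_def[abs_def] using fm by measurable
  then show "permute_cells q \<sigma> \<in> borel_measurable borel" "permute_cells q \<tau> \<in> borel_measurable borel" by auto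
  show "range (permute_cells q \<sigma>) \<subseteq> {0..<1}" "range (permute_cells q \<tau>) \<subseteq> {0..<1}"
    using permute_cells(1)[OF q s(1)] permute_cells(1)[OF q s(2)] by blast+
  have id: "permute_cells q \<rho> (permute_cells q \<pi> x) = x"
    if x: "x \<in> {0..<1}" and \<pi>: "\<pi> ` {..<q} \<subseteq> {..<q}" and e: "\<And>j. j < q \<Longrightarrow> \<rho> (\<pi> j) = j" for \<rho> \<pi> x
  proof -
    have fx: "frac x = x" using x by (simp add: frac_eq)
    note p = permute_cells[OF q \<pi>, of x]
    have fy: "frac (permute_cells q \<pi> x) = permute_cells q \<pi> x" using p(1) by (simp add: frac_eq)
    have "permute_cells q \<rho> (permute_cells q \<pi> x) = (real (\<rho> (\<pi> (cell q x))) + frac (real q * x)) / real q"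
      unfolding permute_cells_def[of q \<rho>] fy p(2,3) fx ..
    also have "\<dots> = (real (cell q x) + frac (real q * x)) / real q" using e[OF cell_less[OF q x]] by simp
    also have "\<dots> = x" by (rule cell_decomp[OF x q, symmetric])
    finally show ?thesis .
  qed
  show "permute_cells q \<tau> (permute_cells q \<sigma> x) = x" "permute_cells q \<sigma> (permute_cells q \<tau> x) = x"
    if "x \<in> {0..<1}" for x
    using id[OF that s(1) inv(1)] id[OF that s(2) inv(2)] by auto
  have "(\<lambda>x. permute_cells q \<sigma> x - x) ` {0..<1} \<subseteq> range (\<lambda>i::int. of_int i / real q)"
  proof
    fix d assume "d \<in> (\<lambda>x. permute_cells q \<sigma> x - x) ` {0..<1}"
    then obtain x where x: "x \<in> {0..<1}" "d = permute_cells q \<sigma> x - x" by auto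
    have fx: "frac x = x" using x by (simp add: frac_eq)
    have "d = (real (\<sigma> (cell q x)) + frac (real q * x)) / real q - (real (cell q x) + frac (real q * x)) / real q"
      using cell_decomp[OF x(1) q] unfolding x(2) permute_cells_def fx by simp
    also have "\<dots> = of_int (int (\<sigma> (cell q x)) - int (cell q x)) / real q"
      by (simp add: diff_divide_distrib add_divide_distrib)
    finally show "d \<in> range (\<lambda>i::int. of_int i / real q)" by blast
  qed
  then show "countable ((\<lambda>x. permute_cells q \<sigma> x - x) ` {0..<1})" by (rule countable_subset) auto
qed

section \<open>Coordinates\<close>

definition coordinate :: "'a measure \<Rightarrow> ('a \<Rightarrow> real) \<Rightarrow> (real \<Rightarrow> 'a) \<Rightarrow> real measure \<Rightarrow> bool" where
  "coordinate M u v N \<longleftrightarrow> interval_model N \<and> ess_iso M N u v"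

lemma standard_has_coordinate:
  assumes "standard_nonatomic_prob_space M"
  shows "\<exists>u v N. coordinate M u v N"
proof -
  have M: "prob_space M" using assms by (simp add: standard_nonatomic_prob_space_def)
  obtain N A B f where N: "interval_model N" "iso_mod_null M N A B f"
    using assms unfolding standard_nonatomic_prob_space_def interval_model_def by blast
  obtain a where a: "a \<in> space M" using prob_space.not_empty[OF M] by auto
  have "(0::real) \<in> space N" using interval_model(1)[OF N(1)] by simp
  from iso_mod_null_extend[OF N(2) this] iso_mod_null_imp_ess_iso(1)[OF _ _ a] N(1)
  show ?thesis unfolding coordinate_def by blast
qed

lemma coordinate_measure:
  assumes c: "coordinate M u v N" and X: "X \<in> sets borel"
  shows "u -` X \<inter> space M \<in> sets M" "measure M (u -` X \<inter> space M) = measure lborel (X \<inter> {0..1})"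
proof -
  note N = interval_model[OF conjunct1[OF c[unfolded coordinate_def]]]
  note u = ess_isoD[OF conjunct2[OF c[unfolded coordinate_def]]]
  have XN: "X \<inter> {0..1} \<in> sets N" by (rule N(2)[OF X])
  have eq: "u -` X \<inter> space M = u -` (X \<inter> {0..1}) \<inter> space M"
    using measurable_space[OF u(1)] N(1) by auto
  show "u -` X \<inter> space M \<in> sets M" unfolding eq by (rule measurable_sets[OF u(1) XN])
  have "emeasure M (u -` X \<inter> space M) = emeasure (distr M N u) (X \<inter> {0..1})"
    unfolding eq by (rule emeasure_distr[OF u(1) XN, symmetric])
  also have "\<dots> = emeasure lborel (X \<inter> {0..1})" using N(3)[OF XN] u(3) X by simp
  finally show "measure M (u -` X \<inter> space M) = measure lborel (X \<inter> {0..1})" by (simp add: measure_def)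
qed

lemma coordinate_measurable:
  assumes "coordinate M u v N" shows "u \<in> borel_measurable M"
  using coordinate_measure(1)[OF assms] by (intro measurableI) auto

lemma coordinate_range:
  assumes "coordinate M u v N" "x \<in> space M" shows "u x \<in> {0..1}"
  using assms interval_model(1)[of N] ess_isoD(1)[of M N u v] measurable_space[of u M N x]
  by (auto simp: coordinate_def)

lemma coordinate_AE_range:
  assumes c: "coordinate M u v N" shows "AE x in M. u x \<in> {0<..<1}"
proof -
  have N: "prob_space N" and u: "u \<in> M \<rightarrow>\<^sub>M N" "distr M N u = N"
    using c interval_model_prob_space ess_isoD by (auto simp: coordinate_def)
  interpret prob_space M using prob_space_distrD[OF u(1)] N u(2) by simp
  have "measure M (u -` {0, 1} \<inter> space M) = measure lborel ({0, 1} \<inter> {0..1::real})"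
    by (rule coordinate_measure(2)[OF c]) auto
  also have "\<dots> = 0"
    by (rule measure_eq_0_null_sets[OF finite_imp_null_set_lborel]) simp
  finally have "u -` {0, 1} \<inter> space M \<in> null_sets M"
    using coordinate_measure(1)[OF c, of "{0,1}"] by (intro null_setsI) (auto simp: emeasure_eq_measure)
  from AE_not_in[OF this] AE_space show ?thesis
  proof eventually_elim
    case (elim x)
    then show ?case using coordinate_range[OF c, of x] by auto
  qed
qed

text \<open>
  \<open>E\<close> corresponds under \<open>v\<close> to a Lebesgue set of the interval, which is squeezed between a compact and
  an open set by regularity of Lebesgue measure.
\<close>

lemma coordinate_approx:
  assumes c: "coordinate M u v N" and M: "prob_space M" and E: "E \<in> sets M" and \<epsilon>: "\<epsilon> > 0"
  obtains K U where "compact K" "open U" "K \<subseteq> U" "U \<subseteq> {0<..<1}"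
    "AE x in M. (u x \<in> K \<longrightarrow> x \<in> E) \<and> (x \<in> E \<longrightarrow> u x \<in> U)"
    "measure M (u -` (U - K) \<inter> space M) < \<epsilon>"
proof -
  have mod: "interval_model N" and iso: "ess_iso M N u v" using c by (auto simp: coordinate_def)
  note N = interval_model[OF mod] and u = ess_isoD[OF iso]
  define F where "F = (v -` E \<inter> space N) \<inter> {0<..<1}"
  have "v -` E \<inter> space N \<in> sets lebesgue" using N(3) measurable_sets[OF u(2) E] by blast
  then have F: "F \<in> sets lebesgue" unfolding F_def by auto
  have e2: "\<epsilon>/2 > 0" using \<epsilon> by simp
  obtain U0 where U0: "open U0" "F \<subseteq> U0" "U0 - F \<in> lmeasurable" "emeasure lebesgue (U0 - F) < ennreal (\<epsilon>/2)"
    using sets_lebesgue_outer_open[OF F e2] .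
  obtain K where K: "closed K" "K \<subseteq> F" "F - K \<in> lmeasurable" "emeasure lebesgue (F - K) < ennreal (\<epsilon>/2)"
    using sets_lebesgue_inner_closed[OF F e2] .
  define U where "U = U0 \<inter> {0<..<1}"
  have "K \<subseteq> {0..1}" using K(2) by (auto simp: F_def)
  then have "bounded K" by (rule bounded_subset[OF bounded_closed_interval])
  then have cK: "compact K" using K(1) compact_eq_bounded_closed by blast
  have oU: "open U" unfolding U_def using U0(1) by auto
  have FU: "F \<subseteq> U" using U0(2) by (auto simp: U_def F_def)
  have KU: "K \<subseteq> U" using FU K(2) by auto
  have AE: "AE x in M. (u x \<in> K \<longrightarrow> x \<in> E) \<and> (x \<in> E \<longrightarrow> u x \<in> U)"
    using u(4) coordinate_AE_range[OF c] AE_space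
  proof eventually_elim
    case (elim x)
    have "u x \<in> space N" using measurable_space[OF u(1)] elim by auto
    then have "x \<in> E \<longleftrightarrow> u x \<in> F" using elim by (auto simp: F_def)
    then show ?case using FU K(2) by auto
  qed
  have UK: "U - K \<in> sets borel" using oU cK by (auto intro: borel_compact)
  have "(U - K) \<inter> {0..1} = U - K" by (auto simp: U_def)
  then have m1: "measure M (u -` (U - K) \<inter> space M) = measure lebesgue (U - K)"
    using coordinate_measure(2)[OF c UK] UK by (simp add: measure_completion)
  have "emeasure lebesgue (U - K) \<le> emeasure lebesgue ((U0 - F) \<union> (F - K))"
    using F U0 K by (intro emeasure_mono) (auto simp: U_def fmeasurable_def)
  also have "\<dots> \<le> emeasure lebesgue (U0 - F) + emeasure lebesgue (F - K)"
    using U0 K by (intro emeasure_subadditive) (auto simp: fmeasurable_def)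
  also have "\<dots> < ennreal (\<epsilon>/2) + ennreal (\<epsilon>/2)" using U0(4) K(4) by (rule add_strict_mono)
  also have "\<dots> = ennreal \<epsilon>" using \<epsilon> by (simp add: ennreal_plus[symmetric] del: ennreal_plus)
  finally have m2: "emeasure lebesgue (U - K) < ennreal \<epsilon>" .
  have "enn2real (emeasure lebesgue (U - K)) < \<epsilon>"
    by (subst enn2real_less_iff) (use m2 \<epsilon> in \<open>auto intro: order.strict_trans\<close>)
  then have "measure M (u -` (U - K) \<inter> space M) < \<epsilon>"
    unfolding m1 by (simp add: measure_def)
  then show thesis using that[OF cK oU KU _ AE] by (simp add: U_def)
qed

text \<open>
  The cells that meet the compact set \<open>K\<close> cover it, and they stay inside the open set \<open>U\<close> as soon as they
  are shorter than the distance from \<open>K\<close> to the complement of \<open>U\<close>.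
\<close>

lemma coordinate_cells_approx:
  assumes c: "coordinate M u v N" and M: "prob_space M" and E: "E \<in> sets M" and \<epsilon>: "\<epsilon> > 0"
  shows "\<forall>\<^sub>F q in sequentially. \<exists>J\<subseteq>{..<q}. measure M (sym_diff E {x \<in> space M. cell q (u x) \<in> J}) < \<epsilon>"
proof -
  interpret prob_space M by fact
  note [measurable] = coordinate_measurable[OF c] E
  obtain K U where KU: "compact K" "open U" "K \<subseteq> U" "U \<subseteq> {0<..<1}"
    and AE: "AE x in M. (u x \<in> K \<longrightarrow> x \<in> E) \<and> (x \<in> E \<longrightarrow> u x \<in> U)"
    and me: "measure M (u -` (U - K) \<inter> space M) < \<epsilon>"
    by (rule coordinate_approx[OF c M E \<epsilon>])
  obtain d where d: "d > 0" "(\<Union>x\<in>K. ball x d) \<subseteq> U"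
    using compact_subset_open_imp_ball_epsilon_subset[OF KU(1-3)] .
  obtain n0 :: nat where n0: "1 / d < real n0" using reals_Archimedean2 by blast
  show ?thesis
  proof (rule eventually_sequentiallyI[of "Suc n0"])
    fix q assume q: "Suc n0 \<le> q"
    then have q0: "q > 0" and qd: "1 / real q < d" using n0 d(1)
      by (auto simp: divide_simps) (smt (verit, best) d(1) mult.commute mult_less_cancel_left of_nat_less_iff Suc_le_lessD)
    define J where "J = cell q ` K"
    have J: "J \<subseteq> {..<q}" unfolding J_def using KU(3,4) cell_less[OF q0] by fastforce
    have near: "u x \<in> U" if "cell q (u x) \<in> J" "u x \<in> {0<..<1}" for x
    proof -
      have "cell q (u x) \<in> cell q ` K" using that(1) by (simp only: J_def)
      then obtain y where y': "cell q (u x) = cell q y" "y \<in> K" by (rule imageE)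
      have y: "y \<in> K" "cell q y = cell q (u x)" using y' by simp_all
      have y01: "y \<in> {0<..<1}" using y KU by auto
      have "y = (real (cell q y) + frac (real q * y)) / real q" "u x = (real (cell q y) + frac (real q * u x)) / real q"
        using cell_decomp[of y q] cell_decomp[of "u x" q] y01 that(2) q0 y(2) by auto
      then have "y - u x = (frac (real q * y) - frac (real q * u x)) / real q"
        by (metis (no_types, lifting) add_diff_cancel_left diff_divide_distrib)
      then have "\<bar>y - u x\<bar> = \<bar>frac (real q * y) - frac (real q * u x)\<bar> / real q" by simp
      also have "\<dots> \<le> 1 / real q"
        using frac_lt_1[of "real q * y"] frac_lt_1[of "real q * u x"] frac_ge_0[of "real q * y"] frac_ge_0[of "real q * u x"]
        by (intro divide_right_mono) (auto simp: abs_le_iff simp del: frac_ge_0)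
      finally have "u x \<in> ball y d" using qd by (simp add: dist_real_def)
      then show ?thesis using d(2) y(1) by blast
    qed
    have UKs: "u -` (U - K) \<inter> space M \<in> sets M"
      using KU by (intro coordinate_measure(1)[OF c]) (auto intro: borel_compact)
    have "measure M (sym_diff E {x \<in> space M. cell q (u x) \<in> J}) \<le> measure M (u -` (U - K) \<inter> space M)"
    proof (rule finite_measure_mono_AE[OF _ UKs])
      show "AE x in M. x \<in> sym_diff E {x \<in> space M. cell q (u x) \<in> J} \<longrightarrow> x \<in> u -` (U - K) \<inter> space M"
        using AE coordinate_AE_range[OF c] AE_space
      proof eventually_elim
        case (elim x)
        have "u x \<in> K \<Longrightarrow> cell q (u x) \<in> J" by (auto simp: J_def)
        then show ?case using elim near[of x] by auto
      qed
    qed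
    then show "\<exists>J\<subseteq>{..<q}. measure M (sym_diff E {x \<in> space M. cell q (u x) \<in> J}) < \<epsilon>"
      using me J by (intro exI[of _ J]) auto
  qed
qed

section \<open>Trigonometric functions of a coordinate\<close>

text \<open>
  Closure under products (\<open>trig_poly_mult\<close>) makes every real polynomial of \<open>cis (2 \<pi> x)\<close> a
  trigonometric polynomial, which is the form in which the Stone--Weierstrass theorem is applied.
\<close>

inductive trig_poly :: "(real \<Rightarrow> complex) \<Rightarrow> bool" where
  cis: "trig_poly (\<lambda>x. cis (2 * pi * of_int k * x))"
| add: "trig_poly f \<Longrightarrow> trig_poly g \<Longrightarrow> trig_poly (\<lambda>x. f x + g x)"
| scale: "trig_poly f \<Longrightarrow> trig_poly (\<lambda>x. c * f x)"

lemma trig_poly_const: "trig_poly (\<lambda>x. c)"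
  using trig_poly.scale[OF trig_poly.cis[of 0], of c] by simp

lemma trig_poly_cis_mult: "trig_poly g \<Longrightarrow> trig_poly (\<lambda>x. cis (2 * pi * of_int k * x) * g x)"
proof (induction rule: trig_poly.induct)
  case (cis l)
  have "(\<lambda>x. cis (2 * pi * of_int k * x) * cis (2 * pi * of_int l * x)) = (\<lambda>x. cis (2 * pi * of_int (k + l) * x))"
    by (simp add: cis_mult algebra_simps)
  then show ?case by (simp only: trig_poly.cis)
next
  case (add f g)
  from trig_poly.add[OF add.IH] show ?case by (simp add: distrib_left)
next
  case (scale f c)
  from trig_poly.scale[OF scale.IH, of c] show ?case by (simp add: mult_ac)
qed

lemma trig_poly_mult: "trig_poly f \<Longrightarrow> trig_poly g \<Longrightarrow> trig_poly (\<lambda>x. f x * g x)"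
proof (induction rule: trig_poly.induct)
  case (cis k) then show ?case by (rule trig_poly_cis_mult)
next
  case (add f h)
  from trig_poly.add[OF add.IH(1)[OF add.prems] add.IH(2)[OF add.prems]] show ?case
    by (simp add: distrib_right)
next
  case (scale f c)
  from trig_poly.scale[OF scale.IH[OF scale.prems], of c] show ?case by (simp add: mult_ac)
qed

lemma trig_poly_polynomial:
  assumes "real_polynomial_function (p :: complex \<Rightarrow> real)"
  shows "trig_poly (\<lambda>x. of_real (p (cis (2 * pi * x))))"
  using assms
proof (induction rule: real_polynomial_function.induct)
  case (linear f)
  interpret bounded_linear f by fact
  define c where "c x = cis (2 * pi * of_int 1 * x)" for x
  define d where "d x = cis (2 * pi * of_int (-1) * x)" for x
  have tc: "trig_poly c" "trig_poly d" unfolding c_def[abs_def] d_def[abs_def] by (rule trig_poly.cis)+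
  have eq: "of_real (f (cis (2 * pi * x))) = (of_real (f 1) / 2 + of_real (f \<i>) / (2 * \<i>)) * c x
      + (of_real (f 1) / 2 - of_real (f \<i>) / (2 * \<i>)) * d x" for x
  proof -
    have "cis (2 * pi * x) = cos (2 * pi * x) *\<^sub>R 1 + sin (2 * pi * x) *\<^sub>R \<i>" by (simp add: complex_eq_iff)
    then have "f (cis (2 * pi * x)) = cos (2 * pi * x) * f 1 + sin (2 * pi * x) * f \<i>"
      by (simp only: add scaleR real_scaleR_def)
    then show ?thesis by (simp add: c_def d_def complex_eq_iff field_simps)
  qed
  from trig_poly.add[OF trig_poly.scale[OF tc(1)] trig_poly.scale[OF tc(2)]] show ?case by (simp only: eq)
next
  case (const c) show ?case by (rule trig_poly_const)
next
  case (add f g) from trig_poly.add[OF add.IH] show ?case by simp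
next
  case (mult f g) from trig_poly_mult[OF mult.IH] show ?case by simp
qed

definition fourier :: "('a \<Rightarrow> real) \<Rightarrow> int \<Rightarrow> 'a \<Rightarrow> complex" where
  "fourier u k x = cis (2 * pi * of_int k * u x)"

lemma borel_measurable_cis [measurable]:
  "f \<in> borel_measurable M \<Longrightarrow> (\<lambda>x. cis (f x)) \<in> borel_measurable M"
  using measurable_compose[OF _ borel_measurable_continuous_onI[OF continuous_on_cis[OF continuous_on_id]]] .

lemma fourier_l2:
  assumes "prob_space M" "u \<in> borel_measurable M"
  shows "fourier u k \<in> l2_fun M" "nrm M (fourier u k) = 1"
proof -
  have [measurable]: "u \<in> borel_measurable M" by fact
  have "fourier u k \<in> borel_measurable M" unfolding fourier_def[abs_def] by measurable
  then show "fourier u k \<in> l2_fun M" using l2_fun_bounded(1)[OF assms(1), of _ 1] by (simp add: fourier_def)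
  show "nrm M (fourier u k) = 1" using prob_space.prob_space[OF assms(1)] by (simp add: nrm_def fourier_def)
qed

lemma closed_subspace_trig_poly:
  assumes W: "l2_closed_subspace M W" and "\<And>k. fourier u k \<in> W" and "trig_poly g"
  shows "(\<lambda>x. g (u x)) \<in> W"
  using assms(3)
proof (induction rule: trig_poly.induct)
  case (cis k) then show ?case using assms(2)[of k] by (simp add: fourier_def[abs_def])
qed (auto intro: closed_subspaceD[OF W])

text \<open>
  It is enough to approximate indicators. By regularity and Urysohn's lemma an indicator is
  close to a continuous function of the coordinate, and by Stone--Weierstrass that function is
  uniformly close to a trigonometric polynomial.
\<close>

theorem fourier_total:
  assumes c: "coordinate M u v N" and M: "prob_space M"
  shows "cspan M (range (fourier u)) = l2_fun M"
proof -
  interpret prob_space M by fact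
  note um [measurable] = coordinate_measurable[OF c]
  have sub: "range (fourier u) \<subseteq> l2_fun M" using fourier_l2(1)[OF M um] by auto
  note W = cspan_closed[OF sub]
  show ?thesis
  proof (rule closed_subspace_eq_l2_fun[OF M W])
    fix E assume E [measurable]: "E \<in> sets M"
    define f where "f x = complex_of_real (indicator E x)" for x
    have fl: "f \<in> l2_fun M"
    proof (rule l2_fun_bounded(1)[OF M, of _ 1])
      show "f \<in> borel_measurable M" unfolding f_def by measurable
      show "cmod (f x) \<le> 1" for x by (simp add: f_def indicator_def)
    qed
    have "f \<in> cspan M (range (fourier u))"
    proof (rule closed_subspaceD(5)[OF W fl])
      fix \<epsilon> :: real assume \<epsilon>: "\<epsilon> > 0"
      then have e2: "(\<epsilon>/2)\<^sup>2 > 0" by simp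
      obtain K U where KU: "compact K" "open U" "K \<subseteq> U" "U \<subseteq> {0<..<1}"
        and AE: "AE x in M. (u x \<in> K \<longrightarrow> x \<in> E) \<and> (x \<in> E \<longrightarrow> u x \<in> U)"
        and me: "measure M (u -` (U - K) \<inter> space M) < (\<epsilon>/2)\<^sup>2"
        by (rule coordinate_approx[OF c M E e2])
      have cc: "continuous_on S (\<lambda>x. cis (2 * pi * x))" for S by (intro continuous_intros)
      \<comment> \<open>Urysohn's lemma is applied to the images on the circle: this yields a function that is
        continuous across the point where the ends of the interval meet.\<close>
      define K' where "K' = (\<lambda>x. cis (2 * pi * x)) ` K"
      define L' where "L' = (\<lambda>x. cis (2 * pi * x)) ` ({0..1} - U)"
      have "compact K'" unfolding K'_def by (rule compact_continuous_image[OF cc KU(1)])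
      moreover have "compact L'" unfolding L'_def
        by (rule compact_continuous_image[OF cc]) (intro compact_diff compact_Icc KU(2))
      moreover have "K' \<inter> L' = {}"
      proof -
        have False if x: "x \<in> K" and y: "y \<in> {0..1} - U" and e: "cis (2 * pi * x) = cis (2 * pi * y)" for x y
        proof -
          have "sin (2 * pi * x) = sin (2 * pi * y) \<and> cos (2 * pi * x) = cos (2 * pi * y)"
            using e by (simp add: complex_eq_iff)
          then obtain n :: int where "2 * pi * x = 2 * pi * y + 2 * pi * n" unfolding sin_cos_eq_iff by blast
          then have "2 * pi * x = 2 * pi * (y + n)" by (simp add: distrib_left)
          then have xy: "x = y + of_int n" by simp
          have "0 < x" "x < 1" "0 \<le> y" "y \<le> 1" using x y KU by auto
          then have "real_of_int n < 1" "real_of_int n > -1" using xy by linarith+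
          then have "n = 0" by linarith
          then show False using xy x y KU(3) by auto
        qed
        then show ?thesis unfolding K'_def L'_def by blast
      qed
      ultimately obtain g :: "complex \<Rightarrow> real" where g: "continuous_on UNIV g" "\<And>z. g z \<in> closed_segment 1 0"
        "\<And>z. z \<in> K' \<Longrightarrow> g z = 1" "\<And>z. z \<in> L' \<Longrightarrow> g z = 0"
        using Urysohn[of K' L' "1::real" "0::real"] compact_imp_closed by metis
      have g01: "0 \<le> g z \<and> g z \<le> 1" for z using g(2)[of z] by (simp add: closed_segment_eq_real_ivl)
      have h: "\<epsilon>/2 > 0" using \<epsilon> by simp
      obtain p where p: "real_polynomial_function p" "\<And>z. z \<in> sphere 0 1 \<Longrightarrow> \<bar>g z - p z\<bar> < \<epsilon>/2"
        using Stone_Weierstrass_real_polynomial_function[OF compact_sphere continuous_on_subset[OF g(1)] h, of "0::complex" 1]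
        by auto
      define G where "G x = complex_of_real (g (cis (2 * pi * u x)))" for x
      define H where "H x = complex_of_real (p (cis (2 * pi * u x)))" for x
      have HW: "H \<in> cspan M (range (fourier u))" unfolding H_def[abs_def]
        by (rule closed_subspace_trig_poly[OF W _ trig_poly_polynomial[OF p(1)]])
          (use cspan_superset[OF sub] in blast)
      have Hl: "H \<in> l2_fun M" using HW by (simp add: cspan_def)
      have [measurable]: "g \<in> borel_measurable borel" using g(1) by (rule borel_measurable_continuous_onI)
      have Gm [measurable]: "G \<in> borel_measurable M" unfolding G_def by measurable
      have Gl: "G \<in> l2_fun M" by (rule l2_fun_bounded(1)[OF M Gm, of 1]) (use g01 in \<open>simp add: G_def\<close>)
      have "nrm M (\<lambda>x. G x - H x) \<le> \<epsilon>/2"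
      proof (rule l2_fun_bounded(2)[OF M])
        show "(\<lambda>x. G x - H x) \<in> borel_measurable M" using l2_funD(1)[OF l2_fun_diff[OF Gl Hl]] .
        have "cmod (G x - H x) = \<bar>g (cis (2 * pi * u x)) - p (cis (2 * pi * u x))\<bar>" for x
          unfolding G_def H_def by (simp only: of_real_diff[symmetric] norm_of_real)
        then show "cmod (G x - H x) \<le> \<epsilon>/2" for x using p(2)[of "cis (2 * pi * u x)"] by simp
      qed (use h in simp)
      moreover have "nrm M (\<lambda>x. f x - G x) < \<epsilon>/2"
      proof -
        define Y where "Y = u -` (U - K) \<inter> space M"
        have Y [measurable]: "Y \<in> sets M" unfolding Y_def using KU
          by (intro coordinate_measure(1)[OF c]) (auto intro: borel_compact)
        have "(\<integral>x. (cmod (f x - G x))\<^sup>2 \<partial>M) \<le> (\<integral>x. indicator Y x \<partial>M)"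
        proof (rule integral_mono_AE)
          show "integrable M (\<lambda>x. (cmod (f x - G x))\<^sup>2)" using l2_funD(2)[OF l2_fun_diff[OF fl Gl]] .
          show "AE x in M. (cmod (f x - G x))\<^sup>2 \<le> indicator Y x"
            using AE AE_space
          proof eventually_elim
            case (elim x)
            have u01: "u x \<in> {0..1}" using coordinate_range[OF c] elim by auto
            have fG: "cmod (f x - G x) = \<bar>indicator E x - g (cis (2 * pi * u x))\<bar>"
              unfolding G_def f_def by (simp only: of_real_diff[symmetric] norm_of_real)
            consider "u x \<in> K" | "u x \<notin> U" | "x \<in> Y" using elim by (auto simp: Y_def)
            then show ?case
            proof cases
              case 1
              then have "g (cis (2 * pi * u x)) = 1" "x \<in> E" using elim by (auto intro!: g(3) simp: K'_def)
              then show ?thesis unfolding fG by simp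
            next
              case 2
              then have "g (cis (2 * pi * u x)) = 0" "x \<notin> E" using elim u01 by (auto intro!: g(4) simp: L'_def)
              then show ?thesis unfolding fG by simp
            next
              case 3
              have "\<bar>indicator E x - g (cis (2 * pi * u x))\<bar> \<le> 1" using g01[of "cis (2 * pi * u x)"] by (auto simp: indicator_def abs_le_iff)
              then have "(cmod (f x - G x))\<^sup>2 \<le> 1" unfolding fG by (simp add: abs_square_le_1)
              then show ?thesis using 3 by simp
            qed
          qed
        qed (rule integrable_real_indicator, use Y in \<open>auto simp: less_top[symmetric]\<close>)
        also have "\<dots> = measure M Y" by simp
        also have "\<dots> < (\<epsilon>/2)\<^sup>2" using me by (simp add: Y_def)
        finally show ?thesis unfolding nrm_def using h by (intro real_less_lsqrt) auto
      qed
      ultimately have "nrm M (\<lambda>x. f x - H x) < \<epsilon>" using nrm_triangle_diff[OF fl Gl Hl] by simp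
      then show "\<exists>g\<in>cspan M (range (fourier u)). nrm M (\<lambda>x. f x - g x) < \<epsilon>" using HW by (rule bexI)
    qed
    then show "(\<lambda>x. complex_of_real (indicator E x)) \<in> cspan M (range (fourier u))"
      by (simp add: f_def[abs_def])
  qed
qed

section \<open>Systems with an eigenbasis and distinct eigenvalues\<close>

locale diagonal_system = prob_space M for M :: "'a measure" +
  fixes s :: "'a \<Rightarrow> 'a" and e :: "int \<Rightarrow> 'a \<Rightarrow> complex" and lam :: "int \<Rightarrow> complex"
  assumes s: "s \<in> M \<rightarrow>\<^sub>M M" "distr M M s = M"
    and e: "\<And>k. e k \<in> l2_fun M" "\<And>k. nrm M (e k) = 1"
    and eig: "\<And>k. AE x in M. e k (s x) = lam k * e k x"
    and total: "cspan M (range e) = l2_fun M"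
    and inj_lam: "inj lam"
begin

lemma prob: "prob_space M" by unfold_locales

lemma norm_lam: "cmod (lam k) = 1"
proof -
  have "nrm M (\<lambda>x. e k (s x)) = nrm M (\<lambda>x. lam k * e k x)"
    using measure_preserving_l2(1)[OF s e(1)] e(1) eig
    by (intro nrm_cong_AE l2_funD(1) l2_fun_scale) auto
  then show ?thesis using measure_preserving_l2(2)[OF s e(1)[of k]] e(2)[of k] by (simp add: nrm_scale)
qed

lemma lam_cnj: "lam k * cnj (lam k) = 1" "cnj (lam k) * lam k = 1" "lam k \<noteq> 0"
  using norm_lam[of k] complex_norm_square[of "lam k"] by (auto simp: mult.commute)

lemma ip_self: "ip M (e k) (e k) = 1"
proof -
  have "ip M (e k) (e k) = (\<integral>x. of_real ((cmod (e k x))\<^sup>2) \<partial>M)"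
    unfolding ip_def by (simp only: complex_norm_square)
  also have "\<dots> = of_real ((nrm M (e k))\<^sup>2)" unfolding nrm_power2 by (rule integral_complex_of_real)
  finally show ?thesis by (simp add: e(2))
qed

text \<open>
  An isometry preserves inner products, and a common factor \<open>lam k * cnj (lam l)\<close> different from one can
  only multiply zero into itself.
\<close>

lemma ip_orth: assumes "k \<noteq> l" shows "ip M (e k) (e l) = 0"
proof -
  have "ip M (e k) (e l) = ip M (\<lambda>x. e k (s x)) (\<lambda>x. e l (s x))"
    by (rule measure_preserving_ip[OF s e(1) e(1), symmetric])
  also have "\<dots> = ip M (\<lambda>x. lam k * e k x) (\<lambda>x. lam l * e l x)"
    by (rule ip_cong_AE[OF eig eig]) (intro measure_preserving_l2[OF s] l2_fun_scale e(1))+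
  also have "\<dots> = lam k * cnj (lam l) * ip M (e k) (e l)" by (simp add: ip_scale_left ip_scale_right)
  finally have *: "(1 - lam k * cnj (lam l)) * ip M (e k) (e l) = 0" by (simp add: algebra_simps)
  have "lam k * cnj (lam l) \<noteq> 1"
  proof
    assume "lam k * cnj (lam l) = 1"
    then have "lam k * cnj (lam l) * lam l = lam l" by simp
    then have "lam k = lam l" using lam_cnj(2)[of l] by (simp add: mult.assoc)
    then show False using assms inj_lam by (auto dest: injD)
  qed
  then show ?thesis using * by simp
qed

lemma orbit_e: "AE x in M. orbit_fun s (e k) n x = lam k ^ n * e k x"
proof (induction n)
  case (Suc n)
  from AE_distr_pullback[OF s Suc] eig[of k] show ?case
    by eventually_elim (simp add: orbit_fun_def funpow_swap1 mult_ac)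
qed (simp add: orbit_fun_def)

text \<open>
  The ergodic average of \<open>f\<close> for the rotated operator \<open>cnj (lam k)\<close> times composition with \<open>s\<close>. Only
  nonnegative powers of the operator occur, so the averages lie in the cyclic subspace of \<open>f\<close>.
\<close>

definition avg :: "int \<Rightarrow> nat \<Rightarrow> ('a \<Rightarrow> complex) \<Rightarrow> 'a \<Rightarrow> complex" where
  "avg k n f x = (\<Sum>j<n. (cnj (lam k) ^ j / of_nat n) * orbit_fun s f j x)"

lemma avg_l2: "f \<in> l2_fun M \<Longrightarrow> avg k n f \<in> l2_fun M"
  unfolding avg_def[abs_def] by (intro l2_fun_lincomb orbit_fun_l2[OF s])

lemma nrm_avg:
  assumes "f \<in> l2_fun M" shows "nrm M (avg k n f) \<le> nrm M f"
proof (cases "n = 0")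
  case False
  have "nrm M (avg k n f) \<le> (\<Sum>j<n. nrm M (\<lambda>x. (cnj (lam k) ^ j / of_nat n) * orbit_fun s f j x))"
    unfolding avg_def[abs_def] by (intro nrm_sum l2_fun_scale orbit_fun_l2[OF s assms])
  also have "\<dots> = (\<Sum>j<n. nrm M f / n)"
    unfolding nrm_scale orbit_fun_l2(2)[OF s assms] by (simp add: norm_divide norm_power norm_lam)
  also have "\<dots> = nrm M f" using False by simp
  finally show ?thesis .
qed (simp add: avg_def[abs_def])

definition mean_set :: "int \<Rightarrow> ('a \<Rightarrow> complex) set" where
  "mean_set k = {f \<in> l2_fun M. (\<lambda>n. nrm M (\<lambda>x. avg k n f x - ip M f (e k) * e k x)) \<longlonglongrightarrow> 0}"

lemma resid_l2: "f \<in> l2_fun M \<Longrightarrow> (\<lambda>x. avg k n f x - ip M f (e k) * e k x) \<in> l2_fun M"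
  by (intro l2_fun_diff avg_l2 l2_fun_scale e(1))

lemma mean_set_closed: "l2_closed_subspace M (mean_set k)"
  unfolding l2_closed_subspace_def
proof (intro conjI ballI allI impI)
  show "mean_set k \<subseteq> l2_fun M" by (auto simp: mean_set_def)
  show "(\<lambda>x. 0) \<in> mean_set k" by (simp add: mean_set_def avg_def orbit_fun_def ip_def)
next
  fix f g assume "f \<in> mean_set k" "g \<in> mean_set k"
  then have f: "f \<in> l2_fun M" "(\<lambda>n. nrm M (\<lambda>x. avg k n f x - ip M f (e k) * e k x)) \<longlonglongrightarrow> 0"
    and g: "g \<in> l2_fun M" "(\<lambda>n. nrm M (\<lambda>x. avg k n g x - ip M g (e k) * e k x)) \<longlonglongrightarrow> 0"
    by (auto simp: mean_set_def)
  have eq: "(\<lambda>x. avg k n (\<lambda>x. f x + g x) x - ip M (\<lambda>x. f x + g x) (e k) * e k x) =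
    (\<lambda>x. (avg k n f x - ip M f (e k) * e k x) + (avg k n g x - ip M g (e k) * e k x))" for n
    by (simp add: ip_add_left[OF f(1) g(1) e(1)] avg_def orbit_fun_def distrib_left sum.distrib algebra_simps)
  have "(\<lambda>n. nrm M (\<lambda>x. avg k n (\<lambda>x. f x + g x) x - ip M (\<lambda>x. f x + g x) (e k) * e k x)) \<longlonglongrightarrow> 0"
    unfolding eq
    by (rule tendsto_sandwich[OF _ _ tendsto_const tendsto_add_zero[OF f(2) g(2)]])
       (auto intro!: always_eventually nrm_triangle resid_l2 f(1) g(1))
  then show "(\<lambda>x. f x + g x) \<in> mean_set k" using f g by (simp add: mean_set_def l2_fun_add)
next
  fix c f assume "f \<in> mean_set k"
  then have f: "f \<in> l2_fun M" "(\<lambda>n. nrm M (\<lambda>x. avg k n f x - ip M f (e k) * e k x)) \<longlonglongrightarrow> 0"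
    by (auto simp: mean_set_def)
  have eq: "(\<lambda>x. avg k n (\<lambda>x. c * f x) x - ip M (\<lambda>x. c * f x) (e k) * e k x) =
    (\<lambda>x. c * (avg k n f x - ip M f (e k) * e k x))" for n
    by (simp add: ip_scale_left avg_def orbit_fun_def sum_distrib_left right_diff_distrib mult_ac)
  have "(\<lambda>n. nrm M (\<lambda>x. avg k n (\<lambda>x. c * f x) x - ip M (\<lambda>x. c * f x) (e k) * e k x)) \<longlonglongrightarrow> 0"
    unfolding eq nrm_scale by (rule tendsto_mult_right_zero[OF f(2)])
  then show "(\<lambda>x. c * f x) \<in> mean_set k" using f by (simp add: mean_set_def l2_fun_scale)
next
  fix f assume f: "f \<in> l2_fun M" and app: "\<forall>\<epsilon>>0. \<exists>g\<in>mean_set k. nrm M (\<lambda>x. f x - g x) < \<epsilon>"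
  have "(\<lambda>n. nrm M (\<lambda>x. avg k n f x - ip M f (e k) * e k x)) \<longlonglongrightarrow> 0"
  proof (rule LIMSEQ_I)
    fix \<epsilon> :: real assume \<epsilon>: "\<epsilon> > 0"
    then have "\<epsilon>/3 > 0" by simp
    then obtain g where g: "g \<in> mean_set k" "nrm M (\<lambda>x. f x - g x) < \<epsilon>/3" using app by blast
    then have gl: "g \<in> l2_fun M" and gt: "(\<lambda>n. nrm M (\<lambda>x. avg k n g x - ip M g (e k) * e k x)) \<longlonglongrightarrow> 0"
      by (auto simp: mean_set_def)
    obtain n0 where n0: "\<And>n. n \<ge> n0 \<Longrightarrow> nrm M (\<lambda>x. avg k n g x - ip M g (e k) * e k x) < \<epsilon>/3"
      using LIMSEQ_D[OF gt \<open>\<epsilon>/3 > 0\<close>] by auto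
    have d: "(\<lambda>x. f x - g x) \<in> l2_fun M" by (rule l2_fun_diff[OF f gl])
    have "nrm M (\<lambda>x. avg k n f x - ip M f (e k) * e k x) < \<epsilon>" if n: "n \<ge> n0" for n
    proof -
      let ?R = "\<lambda>x. avg k n g x - ip M g (e k) * e k x" and ?D = "\<lambda>x. f x - g x"
      have eq: "(\<lambda>x. avg k n f x - ip M f (e k) * e k x) =
        (\<lambda>x. ?R x + (avg k n ?D x + (- ip M ?D (e k)) * e k x))"
        by (simp add: ip_diff_left[OF f gl e(1)] avg_def orbit_fun_def right_diff_distrib sum_subtractf algebra_simps)
      have l: "(\<lambda>x. (- ip M ?D (e k)) * e k x) \<in> l2_fun M" by (intro l2_fun_scale e(1))
      have "nrm M (\<lambda>x. avg k n f x - ip M f (e k) * e k x) \<le> nrm M ?R + nrm M (\<lambda>x. avg k n ?D x + (- ip M ?D (e k)) * e k x)"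
        unfolding eq by (intro nrm_triangle resid_l2 gl l2_fun_add avg_l2 d l)
      also have "nrm M (\<lambda>x. avg k n ?D x + (- ip M ?D (e k)) * e k x) \<le> nrm M (avg k n ?D) + nrm M (\<lambda>x. (- ip M ?D (e k)) * e k x)"
        by (intro nrm_triangle avg_l2 d l)
      also have "nrm M (\<lambda>x. (- ip M ?D (e k)) * e k x) = cmod (ip M ?D (e k))"
        unfolding nrm_scale e(2) by simp
      finally show ?thesis
        using nrm_avg[OF d, of k n] ip_bound[OF d e(1)[of k]] n0[OF n] g(2) by (simp add: e(2))
    qed
    then show "\<exists>no. \<forall>n\<ge>no. norm (nrm M (\<lambda>x. avg k n f x - ip M f (e k) * e k x) - 0) < \<epsilon>" by auto
  qed
  then show "f \<in> mean_set k" using f by (simp add: mean_set_def)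
qed

lemma e_mean_set: "e l \<in> mean_set k"
proof -
  define z where "z = cnj (lam k) * lam l"
  have z1: "cmod z = 1" by (simp add: z_def norm_mult norm_lam)
  have avg: "AE x in M. avg k n (e l) x = ((\<Sum>j<n. z ^ j) / of_nat n) * e l x" for n
  proof -
    have "AE x in M. \<forall>j\<in>{..<n}. orbit_fun s (e l) j x = lam l ^ j * e l x"
      by (intro AE_finite_allI orbit_e) simp
    then show ?thesis
      by eventually_elim (simp add: avg_def z_def sum_divide_distrib sum_distrib_right power_mult_distrib mult.assoc)
  qed
  have nr: "nrm M (\<lambda>x. avg k n (e l) x - ip M (e l) (e k) * e l' x) =
      nrm M (\<lambda>x. ((\<Sum>j<n. z ^ j) / of_nat n) * e l x - ip M (e l) (e k) * e l' x)" for n l'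
  proof (rule nrm_cong_AE)
    show "AE x in M. avg k n (e l) x - ip M (e l) (e k) * e l' x = (\<Sum>j<n. z ^ j) / of_nat n * e l x - ip M (e l) (e k) * e l' x"
      using avg[of n] by eventually_elim simp
  qed (intro l2_funD(1) l2_fun_diff avg_l2 l2_fun_scale e(1))+
  have "(\<lambda>n. nrm M (\<lambda>x. avg k n (e l) x - ip M (e l) (e k) * e k x)) \<longlonglongrightarrow> 0"
  proof (cases "l = k")
    case True
    have "nrm M (\<lambda>x. avg k n (e l) x - ip M (e l) (e k) * e k x) = 0" if "n \<ge> 1" for n
    proof -
      have "z = 1" using lam_cnj(2)[of k] True by (simp add: z_def)
      then show ?thesis unfolding nr using that by (simp add: True ip_self)
    qed
    then show ?thesis by (intro tendsto_eventually eventually_sequentiallyI[of 1])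
  next
    case False
    then have z: "z \<noteq> 1"
    proof -
      have "z = 1 \<Longrightarrow> lam k * (cnj (lam k) * lam l) = lam k" by (simp add: z_def)
      then have "z = 1 \<Longrightarrow> lam l = lam k" using lam_cnj(1)[of k] by (simp add: mult.assoc[symmetric])
      then show ?thesis using False inj_lam by (auto dest: injD)
    qed
    have "nrm M (\<lambda>x. avg k n (e l) x - ip M (e l) (e k) * e k x) \<le> (2 / cmod (1 - z)) / real n" for n
    proof -
      have "nrm M (\<lambda>x. avg k n (e l) x - ip M (e l) (e k) * e k x) = cmod ((\<Sum>j<n. z ^ j) / of_nat n)"
        unfolding nr unfolding ip_orth[OF False] by (simp only: mult_zero_left diff_zero nrm_scale e(2) mult_1_right)
      also have "\<dots> = cmod (1 - z ^ n) / cmod (1 - z) / real n"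
        using z by (simp add: sum_gp_strict norm_divide norm_mult)
      also have "\<dots> \<le> 2 / cmod (1 - z) / real n"
        using norm_triangle_ineq4[of 1 "z ^ n"] by (intro divide_right_mono) (auto simp: norm_power z1)
      finally show ?thesis .
    qed
    then show ?thesis
      by (intro tendsto_sandwich[OF _ _ tendsto_const lim_const_over_n[of "2 / cmod (1 - z)"]]) auto
  qed
  then show ?thesis using e(1) by (simp add: mean_set_def)
qed

text \<open>
  The averages are contractions, so the functions for which they converge to the component along
  \<open>e k\<close> form a closed subspace. It contains every \<open>e l\<close>: on \<open>e l\<close> the average is multiplication by the mean
  of a geometric progression, whose ratio is one exactly if \<open>l = k\<close>.
\<close>

lemma mean_ergodic:
  assumes "f \<in> l2_fun M"
  shows "(\<lambda>n. nrm M (\<lambda>x. avg k n f x - ip M f (e k) * e k x)) \<longlonglongrightarrow> 0"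
proof -
  have "cspan M (range e) \<subseteq> mean_set k" using e_mean_set by (intro cspan_subset[OF mean_set_closed]) auto
  then show ?thesis using assms by (auto simp: mean_set_def total)
qed

text \<open>
  By the mean ergodic theorem the closed span of the orbit contains the multiple \<open>ip M f (e k)\<close> of
  \<open>e k\<close>, hence every \<open>e k\<close>.
\<close>

lemma cyclicI:
  assumes f: "f \<in> l2_fun M" and nz: "\<And>k. ip M f (e k) \<noteq> 0"
  shows "cspan M (range (orbit_fun s f)) = l2_fun M"
proof -
  have sub: "range (orbit_fun s f) \<subseteq> l2_fun M" using orbit_fun_l2[OF s f] by auto
  note W = cspan_closed[OF sub]
  have "e k \<in> cspan M (range (orbit_fun s f))" for k
  proof -
    have "(\<lambda>x. ip M f (e k) * e k x) \<in> cspan M (range (orbit_fun s f))"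
    proof (rule closed_subspaceD(5)[OF W])
      show "(\<lambda>x. ip M f (e k) * e k x) \<in> l2_fun M" by (intro l2_fun_scale e(1))
      fix \<epsilon> :: real assume "\<epsilon> > 0"
      from LIMSEQ_D[OF mean_ergodic[OF f, of k] this] obtain n where
        n: "nrm M (\<lambda>x. avg k n f x - ip M f (e k) * e k x) < \<epsilon>" by auto
      have "avg k n f \<in> cspan M (range (orbit_fun s f))" unfolding avg_def[abs_def]
        by (intro closed_subspace_sum[OF W] closed_subspaceD(4)[OF W]) (use cspan_superset[OF sub] in auto)
      moreover have "nrm M (\<lambda>x. ip M f (e k) * e k x - avg k n f x) < \<epsilon>"
        using n by (subst nrm_minus_commute)
      ultimately have "avg k n f \<in> cspan M (range (orbit_fun s f)) \<and> nrm M (\<lambda>x. ip M f (e k) * e k x - avg k n f x) < \<epsilon>"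
        by (rule conjI)
      then show "\<exists>g\<in>cspan M (range (orbit_fun s f)). nrm M (\<lambda>x. ip M f (e k) * e k x - g x) < \<epsilon>"
        by (intro bexI[of _ "avg k n f"]) auto
    qed
    from closed_subspaceD(4)[OF W this, of "inverse (ip M f (e k))"] nz[of k] show ?thesis
      by (simp add: mult.assoc[symmetric])
  qed
  then have "cspan M (range e) \<subseteq> cspan M (range (orbit_fun s f))" by (intro cspan_subset[OF W]) auto
  then show ?thesis using closed_subspaceD(1)[OF W] total by auto
qed

lemma ip_open:
  assumes "f \<in> l2_fun M" "ip M f (e k) \<noteq> 0"
  shows "\<exists>\<delta>>0. \<forall>g\<in>l2_fun M. nrm M (\<lambda>x. f x - g x) < \<delta> \<longrightarrow> ip M g (e k) \<noteq> 0"
proof (intro exI[of _ "cmod (ip M f (e k))"] conjI ballI impI)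
  fix g assume g: "g \<in> l2_fun M" "nrm M (\<lambda>x. f x - g x) < cmod (ip M f (e k))"
  have "cmod (ip M f (e k) - ip M g (e k)) \<le> nrm M (\<lambda>x. f x - g x)"
    using ip_bound[OF l2_fun_diff[OF assms(1) g(1)] e(1)[of k]] by (simp add: ip_diff_left assms(1) g(1) e)
  then show "ip M g (e k) \<noteq> 0" using g(2) by auto
qed (use assms in auto)

lemma ip_dense:
  assumes f: "f \<in> l2_fun M" and \<epsilon>: "\<epsilon> > 0"
  shows "\<exists>g\<in>l2_fun M. ip M g (e k) \<noteq> 0 \<and> nrm M (\<lambda>x. f x - g x) < \<epsilon>"
proof (cases "ip M f (e k) = 0")
  case True
  let ?c = "complex_of_real (\<epsilon>/2)"
  have l: "(\<lambda>x. ?c * e k x) \<in> l2_fun M" by (intro l2_fun_scale e(1))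
  have "ip M (\<lambda>x. f x + ?c * e k x) (e k) \<noteq> 0"
    using \<epsilon> by (simp add: ip_add_left[OF f l e(1)] ip_scale_left ip_self True del: of_real_divide)
  moreover have "nrm M (\<lambda>x. f x - (f x + ?c * e k x)) < \<epsilon>"
  proof -
    have "nrm M (\<lambda>x. f x - (f x + ?c * e k x)) = nrm M (\<lambda>x. (- ?c) * e k x)" by simp
    also have "\<dots> = cmod (- ?c) * 1" unfolding nrm_scale e(2) ..
    also have "\<dots> < \<epsilon>" using \<epsilon> by (simp del: of_real_divide)
    finally show ?thesis .
  qed
  ultimately show ?thesis using l2_fun_add[OF f l] by blast
next
  case False
  then show ?thesis using f \<epsilon> by (intro bexI[OF _ f]) auto
qed

lemma exists_probe: "\<exists>g\<in>l2_fun M. \<forall>k. ip M g (e k) \<noteq> 0"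
  using generic_L2I(2)[OF prob, of "UNIV :: int set" "\<lambda>k f. ip M f (e k) \<noteq> 0"] ip_open ip_dense by auto

context
  fixes T assumes T: "T \<in> MPT M" and sT: "s = tinv M T"
begin

lemma generic_predictive: "generic_in (L2_topology M) {f \<in> L2 M. asymp_lin_predictive M T f}"
proof (rule generic_L2I(1)[OF prob, of "UNIV :: int set" "\<lambda>k f. ip M f (e k) \<noteq> 0"])
  show "l2_class M f \<in> {f \<in> L2 M. asymp_lin_predictive M T f}"
    if "f \<in> l2_fun M" "\<And>i. i \<in> UNIV \<Longrightarrow> ip M f (e i) \<noteq> 0" for f
    using cyclicI[OF that(1)] that(2) asymp_lin_predictive_iff[OF prob T that(1)] l2_class_in_L2[OF that(1)]
    by (simp add: sT)
qed (use ip_open ip_dense in auto)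

text \<open>
  The complex line through a vector \<open>g\<close> all of whose coefficients are nonzero is a probe: the \<open>k\<close>-th
  coefficient of \<open>f + c g\<close> vanishes for just one \<open>c\<close>, so on each translate of the line only countably many
  points can fail to be cyclic.
\<close>

lemma prevalent_predictive: "prevalent_in_L2 M {f \<in> L2 M. asymp_lin_predictive M T f}"
proof -
  obtain g where g: "g \<in> l2_fun M" "\<And>k. ip M g (e k) \<noteq> 0" using exists_probe by auto
  let ?S = "{f \<in> L2 M. asymp_lin_predictive M T f}"
  have lc: "l2_lincomb M 1 c (\<lambda>i. l2_class M g) = l2_class M (\<lambda>x. c 0 * g x)" for c
    using l2_lincomb_class[of 1 "\<lambda>i. g" M c] g(1) by simp
  have indep: "c 0 = 0" if "l2_lincomb M 1 c (\<lambda>i. l2_class M g) = l2_zero M" for c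
  proof -
    have "AE x in M. c 0 * g x = 0"
      using that unfolding lc l2_zero_def by (subst (asm) l2_class_eq_iff) (auto intro: l2_fun_scale g(1))
    then have "ip M (\<lambda>x. c 0 * g x) (e 0) = ip M (\<lambda>x. 0) (e 0)"
      by (intro ip_cong_AE l2_fun_scale g(1) e(1)) auto
    then show ?thesis using g(2)[of 0] by (simp add: ip_scale_left) (simp add: ip_def)
  qed
  have ae: "AE c in (\<Pi>\<^sub>M i\<in>{..<1::nat}. (lborel :: complex measure)).
            l2_add M v (l2_lincomb M 1 c (\<lambda>i. l2_class M g)) \<in> ?S" if v: "v \<in> L2 M" for v
  proof -
    obtain f where f: "f \<in> l2_fun M" "v = l2_class M f" using v by (rule L2_cases)
    define Z where "Z = range (\<lambda>k. - ip M f (e k) / ip M g (e k))"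
    have Z: "countable Z" by (simp add: Z_def)
    have good: "l2_add M v (l2_lincomb M 1 c (\<lambda>i. l2_class M g)) \<in> ?S" if c: "c 0 \<notin> Z" for c
    proof -
      have cg: "(\<lambda>x. c 0 * g x) \<in> l2_fun M" by (intro l2_fun_scale g(1))
      have h: "(\<lambda>x. f x + c 0 * g x) \<in> l2_fun M" by (intro l2_fun_add f(1) cg)
      have "l2_add M v (l2_lincomb M 1 c (\<lambda>i. l2_class M g)) = l2_class M (\<lambda>x. f x + c 0 * g x)"
        unfolding l2_add_def lc f(2)
      proof (subst l2_class_eq_iff)
        show "AE x in M. rep (l2_class M f) x + rep (l2_class M (\<lambda>x. c 0 * g x)) x = f x + c 0 * g x"
          using rep_l2_class[OF f(1)] rep_l2_class[OF cg] by eventually_elim simp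
      qed (intro l2_fun_add rep_L2 l2_class_in_L2 f(1) cg TrueI)+
      moreover have "ip M (\<lambda>x. f x + c 0 * g x) (e k) \<noteq> 0" for k
      proof
        assume "ip M (\<lambda>x. f x + c 0 * g x) (e k) = 0"
        then have "ip M f (e k) + c 0 * ip M g (e k) = 0"
          by (simp add: ip_add_left[OF f(1) cg e(1)] ip_scale_left)
        then have "c 0 * ip M g (e k) = - ip M f (e k)" by (simp only: add_eq_0_iff)
        then have "c 0 = - ip M f (e k) / ip M g (e k)"
          by (rule nonzero_eq_divide_eq[OF g(2), THEN iffD2])
        then show False using c unfolding Z_def by blast
      qed
      ultimately show ?thesis
        using cyclicI[OF h] asymp_lin_predictive_iff[OF prob T h] l2_class_in_L2[OF h] by (simp add: sT)
    qed
    interpret P: product_sigma_finite "\<lambda>i::nat. lborel :: complex measure"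
      by standard
    have Zs: "Z \<in> sets lborel" by (rule sets.countable[OF _ Z]) simp
    have Zn: "emeasure lborel Z = 0" using Z by (rule emeasure_lborel_countable)
    let ?P = "\<Pi>\<^sub>M i\<in>{..<1::nat}. (lborel :: complex measure)"
    have "emeasure ?P (Pi\<^sub>E {..<1::nat} (\<lambda>i. Z)) = (\<Prod>i\<in>{..<1::nat}. emeasure lborel Z)"
      by (rule P.emeasure_PiM) (use Zs in auto)
    also have "\<dots> = 0" using Zn by simp
    finally have "Pi\<^sub>E {..<1::nat} (\<lambda>i. Z) \<in> null_sets ?P"
      using Zs by (intro null_setsI sets_PiM_I_finite) auto
    moreover have "{c \<in> space ?P. \<not> l2_add M v (l2_lincomb M 1 c (\<lambda>i. l2_class M g)) \<in> ?S} \<subseteq> Pi\<^sub>E {..<1::nat} (\<lambda>i. Z)"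
    proof
      fix c assume c: "c \<in> {c \<in> space ?P. \<not> l2_add M v (l2_lincomb M 1 c (\<lambda>i. l2_class M g)) \<in> ?S}"
      then have "c 0 \<in> Z" using good[of c] by blast
      moreover have "c \<in> extensional {..<1}" using c by (auto simp: space_PiM PiE_def)
      ultimately show "c \<in> Pi\<^sub>E {..<1::nat} (\<lambda>i. Z)" by (auto simp: PiE_iff)
    qed
    ultimately show ?thesis by (rule AE_I'[rotated, OF _ , rotated])
  qed
  show ?thesis unfolding prevalent_in_L2_def
    by (intro conjI exI[of _ "1::nat"] exI[of _ "\<lambda>i. l2_class M g"])
       (use ae indep l2_class_in_L2[OF g(1)] in auto)
qed

lemma discrete_spectrum: "discrete_spectrum M T"
proof -
  note t = ess_isoD[OF ess_iso_rep_tinv[OF prob T]]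
  let ?E = "\<lambda>k. l2_class M (e k)"
  have EL: "?E k \<in> L2 M" for k by (rule l2_class_in_L2[OF e(1)])
  have ip: "l2_inner M (?E k) (?E l) = ip M (e k) (e l)" for k l
    unfolding l2_inner_def ip_def[symmetric]
    by (rule ip_cong_AE) (auto intro: rep_l2_class e(1) rep_L2 EL)
  have Eneq: "?E k \<noteq> ?E l" if "k \<noteq> l" for k l
    using ip[of k k] ip[of k l] ip_self[of k] ip_orth[OF that] by auto
  have eigT: "AE x in M. e k (rep T x) = cnj (lam k) * e k x" for k
    using AE_distr_pullback[OF t(1,3) eig[of k]] t(4)
  proof eventually_elim
    case (elim x)
    then have "e k x = lam k * e k (rep T x)" by (simp add: sT)
    then show ?case using lam_cnj(2)[of k] by (simp add: mult.assoc[symmetric])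
  qed
  have ef: "eigenfunction M T (cnj (lam k)) (?E k)" for k
    unfolding eigenfunction_def
  proof (intro conjI EL)
    show "?E k \<noteq> l2_zero M"
    proof
      assume "?E k = l2_zero M"
      then have "AE x in M. e k x = 0" unfolding l2_zero_def by (subst (asm) l2_class_eq_iff) (auto intro: e(1))
      then have "nrm M (e k) = 0" using nrm_eq_0_iff[OF e(1)] by blast
      then show False using e(2)[of k] by simp
    qed
    have "koopman M T (?E k) = l2_class M (\<lambda>x. e k (rep T x))" by (rule koopman_class[OF t(1,3) e(1)])
    also have "\<dots> = l2_scale M (cnj (lam k)) (?E k)" unfolding l2_scale_def
    proof (subst l2_class_eq_iff)
      show "AE x in M. e k (rep T x) = cnj (lam k) * rep (?E k) x"
        using eigT[of k] rep_l2_class[OF e(1)[of k]] by eventually_elim simp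
    qed (auto intro: measure_preserving_l2[OF t(1,3)] l2_fun_scale rep_L2 EL e(1))
    finally show "koopman M T (?E k) = l2_scale M (cnj (lam k)) (?E k)" .
  qed
  have onb: "orthonormal_basis_L2 M (range ?E)"
    unfolding orthonormal_basis_L2_def
  proof (intro conjI ballI)
    show "range ?E \<subseteq> L2 M" using EL by auto
    show "l2_inner M F G = (if F = G then 1 else 0)" if FG: "F \<in> range ?E" "G \<in> range ?E" for F G
    proof -
      obtain k where "F = ?E k" using FG(1) by (rule rangeE)
      moreover obtain l where "G = ?E l" using FG(2) by (rule rangeE)
      ultimately have "F = ?E k" "G = ?E l" by auto
      then show ?thesis using ip[of k l] ip_self ip_orth[of k l] Eneq[of k l] by (cases "k = l") auto
    qed
    have "range ?E = l2_class M ` range e" by auto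
    then show "L2_topology M closure_of l2_span M (range ?E) = L2 M"
      using closure_l2_span_eq_L2[OF _ total] e(1) by auto
  qed
  show ?thesis unfolding discrete_spectrum_def
    by (rule exI[of _ "range (\<lambda>k. cnj (lam k))"], rule exI[of _ "range ?E"]) (use ef onb in blast)
qed

end

end

section \<open>Irrational rotations in a coordinate\<close>

lemma rotation_ess_iso:
  assumes c: "coordinate M u v N" and M: "prob_space M"
  shows "ess_iso M M (v \<circ> rot a \<circ> u) (v \<circ> rot (- a) \<circ> u)"
    "AE x in M. u ((v \<circ> rot (- a) \<circ> u) x) = rot (- a) (u x)"
proof -
  have N: "interval_model N" and u: "ess_iso M N u v" using c by (auto simp: coordinate_def)
  have r: "ess_iso N N (rot a) (rot (- a))" for a
    using piecewise_translation_ess_iso[OF piecewise_translation_rot _ N] piecewise_translation_rot[of "- a"] by simp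
  have "ess_iso M M (v \<circ> (rot a \<circ> u)) ((v \<circ> rot (- a)) \<circ> u)"
    by (rule ess_iso_trans[OF ess_iso_trans[OF u r] ess_iso_sym[OF u]])
  then show "ess_iso M M (v \<circ> rot a \<circ> u) (v \<circ> rot (- a) \<circ> u)" by (simp add: comp_assoc)
  note ru = ess_isoD[OF ess_iso_trans[OF u r[of "- a"]]]
  from AE_distr_pullback[OF ru(1,3) ess_isoD(5)[OF u]]
  show "AE x in M. u ((v \<circ> rot (- a) \<circ> u) x) = rot (- a) (u x)" by simp
qed

lemma cis_rot: "cis (2 * pi * of_int k * rot a y) = cis (2 * pi * of_int k * a) * cis (2 * pi * of_int k * y)"
proof -
  have "2 * pi * of_int k * rot a y = 2 * pi * of_int k * a + 2 * pi * of_int k * y + 2 * pi * of_int (- k * \<lfloor>y + a\<rfloor>)"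
    by (simp add: rot_def frac_def algebra_simps)
  moreover have "cis (2 * pi * of_int m) = 1" for m :: int by (rule cis_multiple_2pi) simp
  ultimately show ?thesis by (simp only: cis_mult[symmetric] mult_1_right)
qed

text \<open>
  The functions \<open>fourier u k\<close> are eigenfunctions, and irrationality of \<open>a\<close> is what makes the eigenvalues
  distinct.
\<close>

lemma rotation_diagonal:
  assumes c: "coordinate M u v N" and M: "prob_space M" and a: "a \<notin> \<rat>"
  defines "T \<equiv> mpt_class M (v \<circ> rot a \<circ> u)"
  shows "diagonal_system M (tinv M T) (fourier u) (\<lambda>k. cis (2 * pi * of_int k * (- a)))"
proof -
  note um = coordinate_measurable[OF c]
  note r = rotation_ess_iso[OF c M, of a]
  note T = mpt_class[OF M r(1), folded T_def]
  note s = ess_isoD[OF ess_iso_sym[OF ess_iso_rep_tinv[OF M T(1)]]]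
  interpret prob_space M by fact
  show ?thesis
  proof
    show "tinv M T \<in> M \<rightarrow>\<^sub>M M" "distr M M (tinv M T) = M" using s by auto
    show "fourier u k \<in> l2_fun M" "nrm M (fourier u k) = 1" for k by (rule fourier_l2[OF M um])+
    show "cspan M (range (fourier u)) = l2_fun M" by (rule fourier_total[OF c M])
    show "AE x in M. fourier u k (tinv M T x) = cis (2 * pi * of_int k * (- a)) * fourier u k x" for k
      using T(3) r(2)
    proof eventually_elim
      case (elim x)
      then have "u (tinv M T x) = rot (- a) (u x)" by simp
      then show ?case by (simp only: fourier_def cis_rot)
    qed
    show "inj (\<lambda>k. cis (2 * pi * of_int k * (- a)))"
    proof (rule injI)
      fix k l :: int assume e: "cis (2 * pi * of_int k * (- a)) = cis (2 * pi * of_int l * (- a))"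
      then have "sin (2 * pi * of_int k * (- a)) = sin (2 * pi * of_int l * (- a)) \<and>
        cos (2 * pi * of_int k * (- a)) = cos (2 * pi * of_int l * (- a))" by (simp only: complex_eq_iff cis.sel)
      then obtain n :: int where n: "2 * pi * of_int k * (- a) = 2 * pi * of_int l * (- a) + 2 * pi * n"
        unfolding sin_cos_eq_iff by blast
      then have "2 * pi * (of_int (l - k) * a) = 2 * pi * of_int n" by (simp add: algebra_simps)
      then have na: "of_int (l - k) * a = of_int n" by simp
      show "k = l"
      proof (rule ccontr)
        assume "k \<noteq> l"
        then have "a = of_int n / of_int (l - k)" using na by (simp add: field_simps)
        then have "a \<in> \<rat>" by simp
        then show False using a by blast
      qed
    qed
  qed
qed

section \<open>Discrete spectrum forces weak predictivity\<close>

lemma cmod_cis_minus_1: "cmod (cis t - 1) \<le> \<bar>t\<bar>"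
proof -
  have c: "cos t = 1 - 2 * (sin (t/2))\<^sup>2" using cos_double_sin[of "t/2"] by simp
  have "(cmod (cis t - 1))\<^sup>2 = (cos t - 1)\<^sup>2 + (sin t)\<^sup>2" by (simp add: cmod_power2)
  also have "\<dots> = 2 - 2 * cos t" using sin_cos_squared_add[of t] by (simp add: power2_diff)
  also have "\<dots> = 4 * (sin (t/2))\<^sup>2" by (simp add: c)
  also have "\<dots> \<le> 4 * (t/2)\<^sup>2"
    using power_mono[OF abs_sin_x_le_abs_x[of "t/2"], of 2] by (simp add: power_divide)
  also have "\<dots> = \<bar>t\<bar>\<^sup>2" by (simp add: power2_eq_square)
  finally show ?thesis by (rule power2_le_imp_le) simp
qed

lemma orbit_eigen:
  assumes "s \<in> M \<rightarrow>\<^sub>M M" "distr M M s = M" "AE x in M. f (s x) = \<alpha> * f x"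
  shows "AE x in M. orbit_fun s f n x = \<alpha> ^ n * f x"
proof (induction n)
  case (Suc n)
  from AE_distr_pullback[OF assms(1,2) Suc] assms(3) show ?case
    by eventually_elim (simp add: orbit_fun_def funpow_swap1 mult_ac)
qed (simp add: orbit_fun_def)

text \<open>
  Dirichlet's simultaneous approximation theorem provides a power that brings all the finitely many
  unimodular eigenvalues close to one at the same time.
\<close>

lemma eigen_combination_recurrent:
  fixes \<alpha> c :: "nat \<Rightarrow> complex"
  assumes t: "t \<in> M \<rightarrow>\<^sub>M M" "distr M M t = M"
    and \<phi>: "\<And>i. i < m \<Longrightarrow> \<phi> i \<in> l2_fun M" "\<And>i. i < m \<Longrightarrow> AE x in M. \<phi> i (t x) = \<alpha> i * \<phi> i x"
    and \<alpha>: "\<And>i. i < m \<Longrightarrow> cmod (\<alpha> i) = 1" and \<epsilon>: "\<epsilon> > 0"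
  defines "g \<equiv> \<lambda>x. \<Sum>i<m. c i * \<phi> i x"
  shows "\<exists>n\<ge>1. nrm M (\<lambda>x. g x - orbit_fun t g n x) < \<epsilon>"
proof -
  define C where "C = (\<Sum>i<m. cmod (c i) * nrm M (\<phi> i))"
  have C: "C \<ge> 0" unfolding C_def by (intro sum_nonneg) auto
  define \<theta> where "\<theta> i = Arg (\<alpha> i) / (2 * pi)" for i
  have \<theta>: "\<alpha> i = cis (2 * pi * \<theta> i)" if "i < m" for i
  proof -
    have "\<alpha> i \<noteq> 0" using \<alpha>[OF that] by auto
    from cis_Arg[OF this] have "cis (Arg (\<alpha> i)) = \<alpha> i" using \<alpha>[OF that] by (simp add: sgn_eq)
    then show ?thesis by (simp add: \<theta>_def)
  qed
  obtain N0 :: nat where N0: "2 * pi * C / \<epsilon> < real N0" using reals_Archimedean2 by blast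
  define N where "N = Suc N0"
  have N: "N > 0" "2 * pi * C / \<epsilon> < real N" using N0 by (auto simp: N_def)
  obtain q p where q: "0 < q" "\<And>i. i < m \<Longrightarrow> \<bar>of_int q * \<theta> i - of_int (p i)\<bar> < 1/N"
    using Dirichlet_approx_simult[OF N(1), of m \<theta>] by metis
  define n where "n = nat q"
  have n: "n \<ge> 1" "real n = of_int q" using q(1) by (auto simp: n_def)
  have near: "cmod (1 - \<alpha> i ^ n) \<le> 2 * pi / N" if i: "i < m" for i
  proof -
    have "\<alpha> i ^ n = cis (2 * pi * (of_int q * \<theta> i - of_int (p i)) + 2 * pi * of_int (p i))"
    proof -
      have "\<alpha> i ^ n = cis (of_int q * (2 * pi * \<theta> i))" by (subst \<theta>[OF i]) (simp only: Complex.DeMoivre n(2))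
      then show ?thesis by (simp add: algebra_simps)
    qed
    also have "\<dots> = cis (2 * pi * (of_int q * \<theta> i - of_int (p i))) * cis (2 * pi * of_int (p i))"
      by (simp only: cis_mult)
    also have "cis (2 * pi * of_int (p i)) = 1" by (rule cis_multiple_2pi) simp
    finally have "cmod (1 - \<alpha> i ^ n) \<le> \<bar>2 * pi * (of_int q * \<theta> i - of_int (p i))\<bar>"
      using cmod_cis_minus_1 by (simp add: norm_minus_commute)
    also have "\<dots> \<le> 2 * pi * (1 / N)"
      unfolding abs_mult using q(2)[OF i] by (intro mult_mono) auto
    finally show ?thesis by simp
  qed
  have "AE x in M. \<forall>i\<in>{..<m}. orbit_fun t (\<phi> i) n x = \<alpha> i ^ n * \<phi> i x"
    by (intro AE_finite_allI orbit_eigen[OF t \<phi>(2)]) auto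
  then have AE: "AE x in M. g x - orbit_fun t g n x = (\<Sum>i<m. (c i * (1 - \<alpha> i ^ n)) * \<phi> i x)"
    by eventually_elim (simp add: g_def orbit_fun_def sum_subtractf[symmetric] algebra_simps)
  have gl: "g \<in> l2_fun M" unfolding g_def by (intro l2_fun_lincomb \<phi>)
  have sl: "(\<lambda>x. \<Sum>i<m. (c i * (1 - \<alpha> i ^ n)) * \<phi> i x) \<in> l2_fun M" by (intro l2_fun_lincomb \<phi>)
  have "nrm M (\<lambda>x. g x - orbit_fun t g n x) = nrm M (\<lambda>x. \<Sum>i<m. (c i * (1 - \<alpha> i ^ n)) * \<phi> i x)"
    by (rule nrm_cong_AE[OF AE l2_funD(1)[OF l2_fun_diff[OF gl orbit_fun_l2(1)[OF t gl]]] l2_funD(1)[OF sl]])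
  also have "\<dots> \<le> (\<Sum>i<m. nrm M (\<lambda>x. (c i * (1 - \<alpha> i ^ n)) * \<phi> i x))"
    by (intro nrm_sum l2_fun_scale \<phi>) auto
  also have "\<dots> \<le> (\<Sum>i<m. (cmod (c i) * (2 * pi / N)) * nrm M (\<phi> i))"
    unfolding nrm_scale norm_mult using near by (intro sum_mono mult_right_mono mult_left_mono) auto
  also have "\<dots> = 2 * pi * C / N" by (simp add: C_def sum_distrib_left sum_divide_distrib mult_ac)
  also have "\<dots> < \<epsilon>" using N \<epsilon> by (simp add: field_simps)
  finally show ?thesis using n(1) by blast
qed

lemma funpow_left_inverse:
  assumes "ess_iso M M t s"
  shows "AE x in M. (s ^^ n) ((t ^^ n) x) = x"
proof (induction n)
  case (Suc n)
  note t = ess_isoD[OF assms]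
  have "AE x in M. s (t ((t ^^ n) x)) = (t ^^ n) x"
    by (rule AE_distr_pullback[OF funpow_measure_preserving[OF t(1,3)] t(4)])
  with Suc show ?case by eventually_elim (simp add: funpow_swap1)
qed simp

text \<open>
  If \<open>f\<close> nearly returns to itself after \<open>n \<ge> 1\<close> steps, then one step forward is nearly the same as \<open>n - 1\<close>
  steps backward, which is available to the predictor. The return time is found for a finite
  combination of eigenfunctions close to \<open>f\<close>.
\<close>

lemma discrete_spectrum_weakly_predictive:
  assumes M: "prob_space M" and T: "T \<in> MPT M" and d: "discrete_spectrum M T" and F: "F \<in> L2 M"
  shows "weakly_lin_asymp_predictive M T F"
proof -
  obtain f where f: "f \<in> l2_fun M" "F = l2_class M f" using F by (rule L2_cases)
  define t where "t = rep T"
  define s where "s = tinv M T"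
  have iso: "ess_iso M M t s" unfolding t_def s_def by (rule ess_iso_rep_tinv[OF M T])
  note t = ess_isoD[OF iso] and s = ess_isoD[OF ess_iso_sym[OF iso]]
  obtain B where B: "\<And>F. F \<in> B \<Longrightarrow> \<exists>\<alpha>. eigenfunction M T \<alpha> F" "orthonormal_basis_L2 M B"
    using d unfolding discrete_spectrum_def by blast
  have BL: "B \<subseteq> L2 M" "L2_topology M closure_of (l2_span M B) = L2 M"
    using B(2) by (auto simp: orthonormal_basis_L2_def)
  have sub: "rep ` B \<subseteq> l2_fun M" using BL(1) rep_L2(1) by blast
  have "(\<lambda>G. l2_class M (rep G)) ` B = (\<lambda>G. G) ` B"
    by (rule image_cong[OF refl]) (use BL(1) rep_L2(2) in blast)
  then have "l2_class M ` rep ` B = B" by (simp add: image_image)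
  then have total: "cspan M (rep ` B) = l2_fun M"
    using cspan_eq_l2_fun_if_closure[OF sub] BL(2) by simp
  have eig: "\<exists>\<alpha>. cmod \<alpha> = 1 \<and> (AE x in M. \<phi> (t x) = \<alpha> * \<phi> x)" if mem: "\<phi> \<in> rep ` B" for \<phi>
  proof -
    obtain G where G: "G \<in> B" "\<phi> = rep G" using mem by blast
    obtain \<alpha> where \<alpha>: "eigenfunction M T \<alpha> G" using B(1)[OF G(1)] by blast
    have "G \<in> L2 M" using G(1) BL(1) by blast
    then have \<phi>: "\<phi> \<in> l2_fun M" "l2_class M \<phi> = G" using rep_L2[of G M] G(2) by simp_all
    have "koopman M T G = l2_class M (\<lambda>x. \<phi> (t x))"
      using koopman_class[of T M \<phi>] t(1,3) \<phi> by (simp add: t_def)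
    moreover have "koopman M T G = l2_class M (\<lambda>x. \<alpha> * \<phi> x)"
      using \<alpha> G(2) by (simp add: eigenfunction_def l2_scale_def)
    ultimately have AE: "AE x in M. \<phi> (t x) = \<alpha> * \<phi> x"
      using l2_class_eq_iff[OF measure_preserving_l2(1)[OF t(1,3) \<phi>(1)] l2_fun_scale[OF \<phi>(1), of \<alpha>]] by simp
    have "nrm M (\<lambda>x. \<phi> (t x)) = nrm M (\<lambda>x. \<alpha> * \<phi> x)"
      by (rule nrm_cong_AE[OF AE]) (intro l2_funD(1) measure_preserving_l2[OF t(1,3)] l2_fun_scale \<phi>(1))+
    then have "nrm M \<phi> = cmod \<alpha> * nrm M \<phi>"
      using measure_preserving_l2(2)[OF t(1,3) \<phi>(1)] by (simp add: nrm_scale)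
    moreover have "nrm M \<phi> \<noteq> 0"
    proof
      assume "nrm M \<phi> = 0"
      then have "l2_class M \<phi> = l2_zero M" unfolding l2_zero_def
        using nrm_eq_0_iff[OF \<phi>(1)] l2_class_eq_iff[OF \<phi>(1) l2_fun_zero] by simp
      then show False using \<alpha> \<phi>(2) by (simp add: eigenfunction_def)
    qed
    ultimately show ?thesis using AE by auto
  qed
  show ?thesis unfolding f(2)
  proof (rule weakly_lin_asymp_predictiveI[OF M T f(1)])
    fix \<epsilon> :: real assume \<epsilon>: "\<epsilon> > 0"
    then have e3: "\<epsilon>/3 > 0" by simp
    have "f \<in> cspan M (rep ` B)" using f(1) total by simp
    then obtain m :: nat and c \<phi> where \<phi>: "\<forall>i<m. \<phi> i \<in> rep ` B" "nrm M (\<lambda>x. f x - (\<Sum>i<m. c i * \<phi> i x)) < \<epsilon>/3"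
      unfolding cspan_def using e3 by blast
    define g where "g = (\<lambda>x. \<Sum>i<m. c i * \<phi> i x)"
    have \<phi>l: "\<And>i. i < m \<Longrightarrow> \<phi> i \<in> l2_fun M" using \<phi>(1) sub by blast
    have "\<forall>i. \<exists>\<alpha>. i < m \<longrightarrow> cmod \<alpha> = 1 \<and> (AE x in M. \<phi> i (t x) = \<alpha> * \<phi> i x)"
      using \<phi>(1) eig by blast
    then obtain \<alpha> where \<alpha>: "\<And>i. i < m \<Longrightarrow> cmod (\<alpha> i) = 1" "\<And>i. i < m \<Longrightarrow> AE x in M. \<phi> i (t x) = \<alpha> i * \<phi> i x"
      unfolding choice_iff by blast
    have "\<exists>n\<ge>1. nrm M (\<lambda>x. g x - orbit_fun t g n x) < \<epsilon>/3"
      unfolding g_def by (rule eigen_combination_recurrent[OF t(1,3) \<phi>l \<alpha>(2,1) e3])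
    then obtain n where n: "n \<ge> 1" "nrm M (\<lambda>x. g x - orbit_fun t g n x) < \<epsilon>/3" by blast
    have gl: "g \<in> l2_fun M" unfolding g_def by (intro l2_fun_lincomb \<phi>l)
    note ot = orbit_fun_l2[OF t(1,3)] and os = orbit_fun_l2[OF s(1,3)]
    have fg: "nrm M (\<lambda>x. f x - g x) < \<epsilon>/3" using \<phi>(2) by (simp add: g_def)
    have "orbit_fun t (\<lambda>x. f x - g x) n = (\<lambda>x. orbit_fun t f n x - orbit_fun t g n x)"
      by (simp add: orbit_fun_def)
    then have fgn: "nrm M (\<lambda>x. orbit_fun t g n x - orbit_fun t f n x) < \<epsilon>/3"
      using ot(2)[OF l2_fun_diff[OF f(1) gl], of n] fg by (subst nrm_minus_commute) simp
    have close: "nrm M (\<lambda>x. f x - orbit_fun t f n x) < \<epsilon>"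
      using nrm_triangle_diff[OF f(1) gl ot(1)[OF f(1), of n]]
        nrm_triangle_diff[OF gl ot(1)[OF gl, of n] ot(1)[OF f(1), of n]] fg fgn n(2) by linarith
    obtain k where k: "n = Suc k" using n(1) by (cases n) auto
    have ft: "(\<lambda>x. f (t x)) \<in> l2_fun M" by (rule measure_preserving_l2(1)[OF t(1,3) f(1)])
    have d: "(\<lambda>x. f (t x) - orbit_fun s f k x) \<in> l2_fun M" by (intro l2_fun_diff ft os f(1))
    have "nrm M (\<lambda>x. f (t x) - orbit_fun s f k x) = nrm M (orbit_fun t (\<lambda>x. f (t x) - orbit_fun s f k x) k)"
      using ot(2)[OF d] by simp
    also have "\<dots> = nrm M (\<lambda>x. orbit_fun t f n x - f x)"
    proof (rule nrm_cong_AE)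
      show "AE x in M. orbit_fun t (\<lambda>x. f (t x) - orbit_fun s f k x) k x = orbit_fun t f n x - f x"
        using funpow_left_inverse[OF iso, of k] by eventually_elim (simp add: orbit_fun_def k)
    qed (intro l2_funD(1) ot(1) d l2_fun_diff f(1))+
    also have "\<dots> < \<epsilon>" using close by (subst nrm_minus_commute)
    finally show "\<exists>k. nrm M (\<lambda>x. f (rep T x) - orbit_fun (tinv M T) f k x) < \<epsilon>"
      unfolding t_def s_def by blast
  qed
qed

section \<open>The weak topology\<close>

text \<open>
  The pseudometric of the weak topology that belongs to the measurable set \<open>E\<close>.
\<close>

definition wdist :: "'a measure \<Rightarrow> 'a set \<Rightarrow> ('a \<Rightarrow> 'a) set \<Rightarrow> ('a \<Rightarrow> 'a) set \<Rightarrow> real" where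
  "wdist M E T S = measure M (sym_diff (tinv M T -` E \<inter> space M) (tinv M S -` E \<inter> space M))"

lemma tinv_sets:
  assumes "prob_space M" "T \<in> MPT M" "E \<in> sets M"
  shows "tinv M T -` E \<inter> space M \<in> sets M"
  using measurable_sets[OF ess_isoD(2)[OF ess_iso_rep_tinv[OF assms(1,2)]] assms(3)] .

lemma measure_sym_diff_triangle:
  assumes "prob_space M" "A \<in> sets M" "B \<in> sets M" "C \<in> sets M"
  shows "measure M (sym_diff A C) \<le> measure M (sym_diff A B) + measure M (sym_diff B C)"
proof -
  interpret prob_space M by fact
  have "measure M (sym_diff A C) \<le> measure M (sym_diff A B \<union> sym_diff B C)"
    using assms by (intro finite_measure_mono) auto
  also have "\<dots> \<le> measure M (sym_diff A B) + measure M (sym_diff B C)"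
    using assms by (intro measure_Un_le) auto
  finally show ?thesis .
qed

lemma wdist_triangle:
  assumes "prob_space M" "E \<in> sets M" "S \<in> MPT M" "T \<in> MPT M" "R \<in> MPT M"
  shows "wdist M E S R \<le> wdist M E S T + wdist M E T R"
  unfolding wdist_def using assms by (intro measure_sym_diff_triangle tinv_sets)

lemma image_AE_eq_vimage_tinv:
  assumes M: "prob_space M" and T: "T \<in> MPT M" and t: "t \<in> T" and i: "iso_mod_null M M A B t"
    and E: "E \<in> sets M"
  shows "t ` (E - A) \<in> sets M" "AE x in M. x \<in> t ` (E - A) \<longleftrightarrow> x \<in> tinv M T -` E \<inter> space M"
proof -
  obtain a where a: "a \<in> space M" using prob_space.not_empty[OF M] by auto
  have tm: "t \<in> mpt_maps M" "AE x in M. rep T x = t x" using MPT_mem_iff[OF T] t by auto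
  define g where "g = (\<lambda>y. if y \<in> space M - B then inv_into (space M - A) t y else a)"
  have tM: "t \<in> M \<rightarrow>\<^sub>M M" using tm(1) by (simp add: mpt_maps_def)
  have g: "ess_iso M M t g" "t ` (E - A) = g -` E \<inter> (space M - B)"
    using iso_mod_null_imp_ess_iso[OF i tM a] E unfolding g_def by auto
  have B: "B \<in> null_sets M" using i by (simp add: iso_mod_null_def)
  have "g -` E \<inter> (space M - B) = (g -` E \<inter> space M) - B" by auto
  then show "t ` (E - A) \<in> sets M" using g measurable_sets[OF ess_isoD(2)[OF g(1)] E] B by auto
  show "AE x in M. x \<in> t ` (E - A) \<longleftrightarrow> x \<in> tinv M T -` E \<inter> space M"
    using ess_iso_AE_unique[OF ess_iso_rep_tinv[OF M T] g(1) tm(2)] AE_not_in[OF B]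
    by eventually_elim (auto simp: g(2))
qed

text \<open>
  This removes the existential quantifiers over representatives and exceptional sets from the
  definition: all choices give the same measure.
\<close>

lemma weak_nbhd_eq:
  assumes M: "prob_space M" and T: "T \<in> MPT M" and E: "E \<in> sets M"
  shows "weak_nbhd M T E \<epsilon> = {S \<in> MPT M. wdist M E T S < \<epsilon>}"
proof -
  have eq: "measure M (sym_diff (t ` (E - A)) (s ` (E - C))) = wdist M E T S"
    if S: "S \<in> MPT M" and t: "t \<in> T" "s \<in> S" and i: "iso_mod_null M M A B t" "iso_mod_null M M C D s"
    for S t s A B C D
    unfolding wdist_def
  proof (rule measure_eq_AE)
    note 1 = image_AE_eq_vimage_tinv[OF M T t(1) i(1) E] and 2 = image_AE_eq_vimage_tinv[OF M S t(2) i(2) E]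
    show "AE x in M. x \<in> sym_diff (t ` (E - A)) (s ` (E - C)) \<longleftrightarrow>
        x \<in> sym_diff (tinv M T -` E \<inter> space M) (tinv M S -` E \<inter> space M)"
      using 1(2) 2(2) by eventually_elim blast
    show "sym_diff (t ` (E - A)) (s ` (E - C)) \<in> sets M" using 1(1) 2(1) by auto
    show "sym_diff (tinv M T -` E \<inter> space M) (tinv M S -` E \<inter> space M) \<in> sets M"
      using tinv_sets[OF M _ E] T S by auto
  qed
  have ex: "\<exists>t\<in>T. \<exists>A B. iso_mod_null M M A B t" if "T \<in> MPT M" for T
    using rep_in(1)[of T "mpt_maps M" M] ess_iso_imp_iso_mod_null[OF ess_iso_rep_tinv[OF M that]] that
    by (auto simp: MPT_def)
  show ?thesis
  proof (intro equalityI subsetI)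
    fix S assume "S \<in> weak_nbhd M T E \<epsilon>"
    then show "S \<in> {S \<in> MPT M. wdist M E T S < \<epsilon>}" unfolding weak_nbhd_def using eq by fastforce
  next
    fix S assume S: "S \<in> {S \<in> MPT M. wdist M E T S < \<epsilon>}"
    obtain t A B where t: "t \<in> T" "iso_mod_null M M A B t" using ex[OF T] by blast
    obtain s C D where s: "s \<in> S" "iso_mod_null M M C D s" using ex[of S] S by blast
    have "measure M (sym_diff (t ` (E - A)) (s ` (E - C))) < \<epsilon>"
      using eq[OF _ t(1) s(1) t(2) s(2)] S by simp
    then show "S \<in> weak_nbhd M T E \<epsilon>" unfolding weak_nbhd_def using S t s by blast
  qed
qed

lemma wdist_self [simp]: "wdist M E T T = 0" by (simp add: wdist_def)

lemma openin_wball: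
  assumes "prob_space M" "T \<in> MPT M" "E \<in> sets M" "\<epsilon> > 0"
  shows "openin (weak_topology M) {S \<in> MPT M. wdist M E T S < \<epsilon>}"
proof -
  have "openin (weak_topology M) (weak_nbhd M T E \<epsilon>)"
    unfolding weak_topology_def by (rule topology_generated_by_Basis) (use assms in blast)
  then show ?thesis using weak_nbhd_eq[OF assms(1-3)] by simp
qed

lemma topspace_weak: 
  assumes M: "prob_space M"
  shows "topspace (weak_topology M) = MPT M"
proof -
  have "\<Union>{weak_nbhd M T E \<epsilon> | T E \<epsilon>. T \<in> MPT M \<and> E \<in> sets M \<and> \<epsilon> > 0} = MPT M"
  proof (intro equalityI subsetI)
    fix T assume T: "T \<in> MPT M"
    have "T \<in> weak_nbhd M T (space M) 1" using weak_nbhd_eq[OF M T sets.top] T by simp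
    then show "T \<in> \<Union>{weak_nbhd M T E \<epsilon> | T E \<epsilon>. T \<in> MPT M \<and> E \<in> sets M \<and> \<epsilon> > 0}"
      using T sets.top[of M] zero_less_one by blast
  qed (auto simp: weak_nbhd_def)
  then show ?thesis unfolding weak_topology_def topology_generated_by_topspace .
qed

lemma weak_nbhd_base:
  assumes M: "prob_space M" and W: "openin (weak_topology M) W" and T: "T \<in> W"
  shows "\<exists>F \<delta>. finite F \<and> F \<subseteq> sets M \<and> \<delta> > 0 \<and> {S \<in> MPT M. \<forall>E\<in>F. wdist M E T S < \<delta>} \<subseteq> W"
proof -
  have "generate_topology_on {weak_nbhd M T E \<epsilon> | T E \<epsilon>. T \<in> MPT M \<and> E \<in> sets M \<and> \<epsilon> > 0} W"
    using W unfolding weak_topology_def openin_topology_generated_by_iff .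
  then show ?thesis using T
  proof (induction rule: generate_topology_on.induct)
    case Empty then show ?case by simp
  next
    case (Int a b)
    obtain F \<delta> where F: "finite F" "F \<subseteq> sets M" "\<delta> > 0" "{S \<in> MPT M. \<forall>E\<in>F. wdist M E T S < \<delta>} \<subseteq> a"
      using Int by blast
    obtain F' \<delta>' where F': "finite F'" "F' \<subseteq> sets M" "\<delta>' > 0" "{S \<in> MPT M. \<forall>E\<in>F'. wdist M E T S < \<delta>'} \<subseteq> b"
      using Int by blast
    have "{S \<in> MPT M. \<forall>E\<in>F \<union> F'. wdist M E T S < min \<delta> \<delta>'} \<subseteq> a \<inter> b" using F(4) F'(4) by force
    then show ?case using F F' by (intro exI[of _ "F \<union> F'"] exI[of _ "min \<delta> \<delta>'"]) auto
  next
    case (UN K)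
    then obtain k where k: "k \<in> K" "T \<in> k" by blast
    from UN.IH[OF this] obtain F \<delta> where "finite F" "F \<subseteq> sets M" "\<delta> > 0" "{S \<in> MPT M. \<forall>E\<in>F. wdist M E T S < \<delta>} \<subseteq> k"
      by blast
    then show ?case using k(1) by (intro exI[of _ F] exI[of _ \<delta>]) auto
  next
    case (Basis w)
    then obtain R E \<epsilon> where w: "w = weak_nbhd M R E \<epsilon>" "R \<in> MPT M" "E \<in> sets M" "\<epsilon> > 0" by auto
    then have T: "T \<in> MPT M" "wdist M E R T < \<epsilon>" using Basis.prems weak_nbhd_eq[OF M w(2,3)] by auto
    have "{S \<in> MPT M. \<forall>E\<in>{E}. wdist M E T S < \<epsilon> - wdist M E R T} \<subseteq> w"
      unfolding w(1) weak_nbhd_eq[OF M w(2,3)]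
      using wdist_triangle[OF M w(3,2) T(1)] by fastforce
    then show ?case using w T by (intro exI[of _ "{E}"] exI[of _ "\<epsilon> - wdist M E R T"]) auto
  qed
qed

lemma dense_in_weakI:
  assumes M: "prob_space M" and D: "D \<subseteq> MPT M"
    and app: "\<And>T F \<delta>. T \<in> MPT M \<Longrightarrow> finite F \<Longrightarrow> F \<subseteq> sets M \<Longrightarrow> \<delta> > 0 \<Longrightarrow>
      \<exists>S\<in>D. \<forall>E\<in>F. wdist M E T S < \<delta>"
  shows "dense_in (weak_topology M) D"
  unfolding dense_in_def topspace_weak[OF M]
proof (intro conjI D equalityI subsetI)
  show "T \<in> MPT M" if "T \<in> weak_topology M closure_of D" for T
    using that in_closure_of[of T "weak_topology M" D] topspace_weak[OF M] by blast
  fix T assume T: "T \<in> MPT M"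
  show "T \<in> weak_topology M closure_of D"
    unfolding in_closure_of topspace_weak[OF M]
  proof (intro conjI allI impI T)
    fix W assume W: "T \<in> W \<and> openin (weak_topology M) W"
    then obtain F \<delta> where F: "finite F" "F \<subseteq> sets M" "\<delta> > 0" "{S \<in> MPT M. \<forall>E\<in>F. wdist M E T S < \<delta>} \<subseteq> W"
      using weak_nbhd_base[OF M conjunct2[OF W] conjunct1[OF W]] by blast
    from app[OF T F(1-3)] obtain S where "S \<in> D" "\<forall>E\<in>F. wdist M E T S < \<delta>" by blast
    then show "\<exists>y. y \<in> D \<and> y \<in> W" using F(4) D by blast
  qed
qed

section \<open>Continuity of the Koopman representation\<close>

text \<open>
  Continuity of a map from transformations to square-integrable functions, for the weak topology and
  the norm.
\<close>

definition weakly_continuous :: "'a measure \<Rightarrow> (('a \<Rightarrow> 'a) set \<Rightarrow> 'a \<Rightarrow> complex) \<Rightarrow> bool" where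
  "weakly_continuous M h \<longleftrightarrow> (\<forall>T\<in>MPT M. h T \<in> l2_fun M) \<and>
     (\<forall>T\<in>MPT M. \<forall>\<epsilon>>0. \<exists>W. openin (weak_topology M) W \<and> T \<in> W \<and>
        (\<forall>S\<in>W. nrm M (\<lambda>x. h S x - h T x) < \<epsilon>))"

lemma weakly_continuousD:
  assumes "weakly_continuous M h" "T \<in> MPT M"
  shows "h T \<in> l2_fun M"
    "\<epsilon> > 0 \<Longrightarrow> \<exists>W. openin (weak_topology M) W \<and> T \<in> W \<and> (\<forall>S\<in>W. nrm M (\<lambda>x. h S x - h T x) < \<epsilon>)"
  using assms unfolding weakly_continuous_def by blast+

lemma openin_weak_subset:
  assumes "prob_space M" "openin (weak_topology M) W" "S \<in> W" shows "S \<in> MPT M"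
  using openin_subset[OF assms(2)] assms(3) topspace_weak[OF assms(1)] by auto

lemma weakly_continuous_const:
  assumes M: "prob_space M" and "f \<in> l2_fun M" shows "weakly_continuous M (\<lambda>T. f)"
  unfolding weakly_continuous_def
proof (intro conjI ballI allI impI assms)
  fix T and \<epsilon> :: real assume "T \<in> MPT M" "\<epsilon> > 0"
  then show "\<exists>W. openin (weak_topology M) W \<and> T \<in> W \<and> (\<forall>S\<in>W. nrm M (\<lambda>x. f x - f x) < \<epsilon>)"
    using openin_topspace[of "weak_topology M"] topspace_weak[OF M] by auto
qed

lemma weakly_continuous_add:
  assumes M: "prob_space M" and g: "weakly_continuous M g" and h: "weakly_continuous M h"
  shows "weakly_continuous M (\<lambda>T x. g T x + h T x)"
  unfolding weakly_continuous_def
proof (intro conjI ballI allI impI)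
  fix T assume T: "T \<in> MPT M"
  note gT = weakly_continuousD[OF g T] and hT = weakly_continuousD[OF h T]
  show "(\<lambda>x. g T x + h T x) \<in> l2_fun M" using gT(1) hT(1) by (rule l2_fun_add)
  fix \<epsilon> :: real assume "\<epsilon> > 0"
  then have e: "\<epsilon>/2 > 0" by simp
  obtain V where V: "openin (weak_topology M) V" "T \<in> V" "\<And>S. S \<in> V \<Longrightarrow> nrm M (\<lambda>x. g S x - g T x) < \<epsilon>/2"
    using gT(2)[OF e] by blast
  obtain W where W: "openin (weak_topology M) W" "T \<in> W" "\<And>S. S \<in> W \<Longrightarrow> nrm M (\<lambda>x. h S x - h T x) < \<epsilon>/2"
    using hT(2)[OF e] by blast
  have "nrm M (\<lambda>x. (g S x + h S x) - (g T x + h T x)) < \<epsilon>" if S: "S \<in> V \<inter> W" for S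
  proof -
    have SM: "S \<in> MPT M" using openin_weak_subset[OF M W(1)] S by auto
    have "nrm M (\<lambda>x. (g S x - g T x) + (h S x - h T x)) \<le> nrm M (\<lambda>x. g S x - g T x) + nrm M (\<lambda>x. h S x - h T x)"
      by (intro nrm_triangle l2_fun_diff gT hT weakly_continuousD(1)[OF g SM] weakly_continuousD(1)[OF h SM])
    also have "\<dots> < \<epsilon>" using V(3)[of S] W(3)[of S] S by simp
    finally show ?thesis by (simp add: algebra_simps)
  qed
  then show "\<exists>W. openin (weak_topology M) W \<and> T \<in> W \<and>
      (\<forall>S\<in>W. nrm M (\<lambda>x. (g S x + h S x) - (g T x + h T x)) < \<epsilon>)"
    using V(1,2) W(1,2) by (intro exI[of _ "V \<inter> W"]) auto
qed

lemma weakly_continuous_scale: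
  assumes h: "weakly_continuous M h"
  shows "weakly_continuous M (\<lambda>T x. c * h T x)"
  unfolding weakly_continuous_def
proof (intro conjI ballI allI impI)
  fix T assume T: "T \<in> MPT M"
  note hT = weakly_continuousD[OF h T]
  show "(\<lambda>x. c * h T x) \<in> l2_fun M" using hT(1) by (rule l2_fun_scale)
  fix \<epsilon> :: real assume \<epsilon>: "\<epsilon> > 0"
  then have e: "\<epsilon>/(cmod c + 1) > 0" by (simp add: add_nonneg_pos)
  obtain W where W: "openin (weak_topology M) W" "T \<in> W" "\<And>S. S \<in> W \<Longrightarrow> nrm M (\<lambda>x. h S x - h T x) < \<epsilon>/(cmod c + 1)"
    using hT(2)[OF e] by blast
  have "nrm M (\<lambda>x. c * h S x - c * h T x) < \<epsilon>" if "S \<in> W" for S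
  proof -
    have "nrm M (\<lambda>x. c * h S x - c * h T x) = cmod c * nrm M (\<lambda>x. h S x - h T x)"
      by (simp only: right_diff_distrib[symmetric] nrm_scale)
    also have "\<dots> \<le> (cmod c + 1) * nrm M (\<lambda>x. h S x - h T x)" by (intro mult_right_mono) auto
    also have "\<dots> < \<epsilon>" using W(3)[OF that] by (simp add: pos_less_divide_eq add_nonneg_pos mult.commute)
    finally show ?thesis .
  qed
  then show "\<exists>W. openin (weak_topology M) W \<and> T \<in> W \<and> (\<forall>S\<in>W. nrm M (\<lambda>x. c * h S x - c * h T x) < \<epsilon>)"
    using W(1,2) by blast
qed

text \<open>
  For an indicator the claim is the definition of the weak topology. The functions that satisfy
  it form a closed subspace, because the operators are isometries.
\<close>

lemma weakly_continuous_koopman_fixed: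
  assumes M: "prob_space M" and f: "f \<in> l2_fun M"
  shows "weakly_continuous M (\<lambda>T x. f (tinv M T x))"
proof -
  interpret prob_space M by fact
  define W where "W = {f \<in> l2_fun M. weakly_continuous M (\<lambda>T x. f (tinv M T x))}"
  note tD = ess_isoD[OF ess_iso_sym[OF ess_iso_rep_tinv[OF M]]]
  note l2t = measure_preserving_l2[OF tD(1) tD(3)]
  have "l2_closed_subspace M W" unfolding l2_closed_subspace_def
  proof (intro conjI ballI allI impI)
    show "W \<subseteq> l2_fun M" by (auto simp: W_def)
    show "(\<lambda>x. 0) \<in> W" using weakly_continuous_const[OF M l2_fun_zero] by (simp add: W_def)
    show "(\<lambda>x. f x + g x) \<in> W" if "f \<in> W" "g \<in> W" for f g
      using that weakly_continuous_add[OF M, of "\<lambda>T x. f (tinv M T x)" "\<lambda>T x. g (tinv M T x)"]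
      by (simp add: W_def l2_fun_add)
    show "(\<lambda>x. c * f x) \<in> W" if "f \<in> W" for c f
      using that weakly_continuous_scale[of M "\<lambda>T x. f (tinv M T x)" c] by (simp add: W_def l2_fun_scale)
  next
    fix f assume f: "f \<in> l2_fun M" and app: "\<forall>\<epsilon>>0. \<exists>g\<in>W. nrm M (\<lambda>x. f x - g x) < \<epsilon>"
    have "weakly_continuous M (\<lambda>T x. f (tinv M T x))"
      unfolding weakly_continuous_def
    proof (intro conjI ballI allI impI)
      fix T assume T: "T \<in> MPT M"
      show "(\<lambda>x. f (tinv M T x)) \<in> l2_fun M" by (rule l2t(1)[OF T T f])
      fix \<epsilon> :: real assume "\<epsilon> > 0"
      then have e: "\<epsilon>/3 > 0" by simp
      then obtain g where g: "g \<in> W" "nrm M (\<lambda>x. f x - g x) < \<epsilon>/3" using app by blast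
      then have gl: "g \<in> l2_fun M" and gc: "weakly_continuous M (\<lambda>T x. g (tinv M T x))" by (auto simp: W_def)
      obtain V where V: "openin (weak_topology M) V" "T \<in> V"
        "\<And>S. S \<in> V \<Longrightarrow> nrm M (\<lambda>x. g (tinv M S x) - g (tinv M T x)) < \<epsilon>/3"
        using weakly_continuousD(2)[OF gc T e] by blast
      have fg: "nrm M (\<lambda>x. f (tinv M S x) - g (tinv M S x)) < \<epsilon>/3" if "S \<in> MPT M" for S
        using l2t(2)[OF that that l2_fun_diff[OF f gl]] g(2) by simp
      have "nrm M (\<lambda>x. f (tinv M S x) - f (tinv M T x)) < \<epsilon>" if S: "S \<in> V" for S
      proof -
        have SM: "S \<in> MPT M" using openin_weak_subset[OF M V(1) S] .
        have 1: "nrm M (\<lambda>x. f (tinv M S x) - f (tinv M T x)) \<le>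
            nrm M (\<lambda>x. f (tinv M S x) - g (tinv M S x)) + nrm M (\<lambda>x. g (tinv M S x) - f (tinv M T x))"
          by (rule nrm_triangle_diff[OF l2t(1)[OF SM SM f] l2t(1)[OF SM SM gl] l2t(1)[OF T T f]])
        have 2: "nrm M (\<lambda>x. g (tinv M S x) - f (tinv M T x)) \<le>
            nrm M (\<lambda>x. g (tinv M S x) - g (tinv M T x)) + nrm M (\<lambda>x. g (tinv M T x) - f (tinv M T x))"
          by (rule nrm_triangle_diff[OF l2t(1)[OF SM SM gl] l2t(1)[OF T T gl] l2t(1)[OF T T f]])
        have "nrm M (\<lambda>x. g (tinv M T x) - f (tinv M T x)) < \<epsilon>/3"
          using fg[OF T] by (subst nrm_minus_commute)
        then show ?thesis using 1 2 fg[OF SM] V(3)[OF S] by linarith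
      qed
      then show "\<exists>W. openin (weak_topology M) W \<and> T \<in> W \<and>
          (\<forall>S\<in>W. nrm M (\<lambda>x. f (tinv M S x) - f (tinv M T x)) < \<epsilon>)" using V(1,2) by blast
    qed
    then show "f \<in> W" using f by (simp add: W_def)
  qed
  moreover have "(\<lambda>x. of_real (indicator E x)) \<in> W" if E: "E \<in> sets M" for E
  proof -
    define i where "i = (\<lambda>x. complex_of_real (indicator E x))"
    have il: "i \<in> l2_fun M" using E
      by (intro l2_fun_bounded(1)[OF M, of _ 1]) (auto simp: i_def indicator_def)
    have "weakly_continuous M (\<lambda>T x. i (tinv M T x))"
      unfolding weakly_continuous_def
    proof (intro conjI ballI allI impI)
      fix T assume T: "T \<in> MPT M"
      show "(\<lambda>x. i (tinv M T x)) \<in> l2_fun M" by (rule l2t(1)[OF T T il])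
      fix \<epsilon> :: real assume \<epsilon>: "\<epsilon> > 0"
      then have e2: "\<epsilon>\<^sup>2 > 0" by simp
      have "nrm M (\<lambda>x. i (tinv M S x) - i (tinv M T x)) < \<epsilon>" if S: "S \<in> MPT M" "wdist M E T S < \<epsilon>\<^sup>2" for S
      proof -
        let ?D = "sym_diff (tinv M T -` E \<inter> space M) (tinv M S -` E \<inter> space M)"
        have D: "?D \<in> sets M" using tinv_sets[OF M _ E] T S by auto
        have "(\<integral>x. (cmod (i (tinv M S x) - i (tinv M T x)))\<^sup>2 \<partial>M) = (\<integral>x. indicator ?D x \<partial>M)"
          by (rule Bochner_Integration.integral_cong) (auto simp: i_def indicator_def)
        also have "\<dots> = wdist M E T S" using D by (simp add: wdist_def)
        finally show ?thesis unfolding nrm_def using S(2) \<epsilon> by (intro real_less_lsqrt) auto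
      qed
      then show "\<exists>W. openin (weak_topology M) W \<and> T \<in> W \<and>
          (\<forall>S\<in>W. nrm M (\<lambda>x. i (tinv M S x) - i (tinv M T x)) < \<epsilon>)"
        using openin_wball[OF M T E e2] T e2 by (intro exI[of _ "{S \<in> MPT M. wdist M E T S < \<epsilon>\<^sup>2}"]) auto
    qed
    then show ?thesis using il by (simp add: W_def i_def)
  qed
  ultimately have "W = l2_fun M" by (rule closed_subspace_eq_l2_fun[OF M])
  then show ?thesis using f by (auto simp: W_def)
qed

lemma weakly_continuous_koopman:
  assumes M: "prob_space M" and h: "weakly_continuous M h"
  shows "weakly_continuous M (\<lambda>T x. h T (tinv M T x))"
  unfolding weakly_continuous_def
proof (intro conjI ballI allI impI)
  note tD = ess_isoD[OF ess_iso_sym[OF ess_iso_rep_tinv[OF M]]]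
  note l2t = measure_preserving_l2[OF tD(1) tD(3)]
  fix T assume T: "T \<in> MPT M"
  note hT = weakly_continuousD[OF h T]
  show "(\<lambda>x. h T (tinv M T x)) \<in> l2_fun M" by (rule l2t(1)[OF T T hT(1)])
  fix \<epsilon> :: real assume "\<epsilon> > 0"
  then have e: "\<epsilon>/2 > 0" by simp
  obtain V where V: "openin (weak_topology M) V" "T \<in> V" "\<And>S. S \<in> V \<Longrightarrow> nrm M (\<lambda>x. h S x - h T x) < \<epsilon>/2"
    using hT(2)[OF e] by blast
  obtain W where W: "openin (weak_topology M) W" "T \<in> W"
    "\<And>S. S \<in> W \<Longrightarrow> nrm M (\<lambda>x. h T (tinv M S x) - h T (tinv M T x)) < \<epsilon>/2"
    using weakly_continuousD(2)[OF weakly_continuous_koopman_fixed[OF M hT(1)] T e] by blast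
  have "nrm M (\<lambda>x. h S (tinv M S x) - h T (tinv M T x)) < \<epsilon>" if S: "S \<in> V \<inter> W" for S
  proof -
    have SM: "S \<in> MPT M" using openin_weak_subset[OF M W(1)] S by auto
    have hS: "h S \<in> l2_fun M" by (rule weakly_continuousD(1)[OF h SM])
    have "nrm M (\<lambda>x. h S (tinv M S x) - h T (tinv M T x)) \<le>
        nrm M (\<lambda>x. h S (tinv M S x) - h T (tinv M S x)) + nrm M (\<lambda>x. h T (tinv M S x) - h T (tinv M T x))"
      by (rule nrm_triangle_diff[OF l2t(1)[OF SM SM hS] l2t(1)[OF SM SM hT(1)] l2t(1)[OF T T hT(1)]])
    moreover have "nrm M (\<lambda>x. h S (tinv M S x) - h T (tinv M S x)) = nrm M (\<lambda>x. h S x - h T x)"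
      by (rule l2t(2)[OF SM SM l2_fun_diff[OF hS hT(1)]])
    ultimately show ?thesis using V(3)[of S] W(3)[of S] S by simp
  qed
  then show "\<exists>W. openin (weak_topology M) W \<and> T \<in> W \<and>
      (\<forall>S\<in>W. nrm M (\<lambda>x. h S (tinv M S x) - h T (tinv M T x)) < \<epsilon>)"
    using V(1,2) W(1,2) by (intro exI[of _ "V \<inter> W"]) auto
qed

lemma weakly_continuous_orbit:
  assumes M: "prob_space M" and f: "f \<in> l2_fun M"
  shows "weakly_continuous M (\<lambda>T. orbit_fun (tinv M T) f k)"
proof (induction k)
  case 0 then show ?case using weakly_continuous_const[OF M f] by (simp add: orbit_fun_def)
next
  case (Suc k)
  from weakly_continuous_koopman[OF M this] show ?case by (simp add: orbit_fun_def funpow_swap1)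
qed

lemma weakly_continuous_orbit_comb:
  fixes n :: nat
  assumes M: "prob_space M" and f: "f \<in> l2_fun M"
  shows "weakly_continuous M (\<lambda>T x. \<Sum>i<n. c i * orbit_fun (tinv M T) f i x)"
proof (induction n)
  case 0 then show ?case using weakly_continuous_const[OF M l2_fun_zero] by simp
next
  case (Suc n)
  from weakly_continuous_add[OF M this weakly_continuous_scale[OF weakly_continuous_orbit[OF M f]]]
  show ?case by simp
qed

section \<open>Ordering labelled cells\<close>

text \<open>
  Along a trail the label \<open>a\<close> of an item is the label \<open>b\<close> of the next one, so the two counts of a
  label can differ only through the two ends of the trail.
\<close>

lemma trail_count:
  assumes "successively (\<lambda>x y. a x = b y) p" "p \<noteq> []"
  shows "length (filter (\<lambda>x. a x = l) p) + (if b (hd p) = l then 1 else 0) =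
    length (filter (\<lambda>x. b x = l) p) + (if a (last p) = l then 1 else 0)"
  using assms
proof (induction p)
  case (Cons x p)
  show ?case
  proof (cases "p = []")
    case False
    then have s: "a x = b (hd p)" "successively (\<lambda>x y. a x = b y) p"
      using Cons.prems(1) by (auto simp: successively_Cons)
    from Cons.IH[OF s(2) False] show ?thesis using False by (auto simp: s(1) split: if_splits)
  qed simp
qed simp

lemma concat_trails_nth:
  assumes "\<And>p. p \<in> set ps \<Longrightarrow> successively (\<lambda>x y. a x = b y) p" "t < length (concat ps)"
  shows "concat ps ! t \<in> last ` set ps \<or>
    (Suc t < length (concat ps) \<and> a (concat ps ! t) = b (concat ps ! Suc t))"
  using assms
proof (induction ps arbitrary: t)
  case (Cons p ps)
  consider "Suc t < length p" | "Suc t = length p" | "length p \<le> t" by linarith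
  then show ?case
  proof cases
    case 1
    then have "a (p ! t) = b (p ! Suc t)"
      using Cons.prems(1)[of p] by (simp add: successively_conv_nth)
    then show ?thesis using 1 by (auto simp: nth_append)
  next
    case 2
    then have "p \<noteq> []" "length p - 1 = t" by auto
    then have "p \<noteq> []" "p ! t = last p" using last_conv_nth[of p] by auto
    then show ?thesis using 2 by (auto simp: nth_append)
  next
    case 3
    have "concat ps ! (t - length p) \<in> last ` set ps \<or>
      (Suc (t - length p) < length (concat ps) \<and> a (concat ps ! (t - length p)) = b (concat ps ! Suc (t - length p)))"
      using 3 Cons.prems by (intro Cons.IH) auto
    then show ?thesis using 3 by (auto simp: nth_append Suc_diff_le)
  qed
qed simp

text \<open>
  The items are regarded as directed edges, from the vertex \<open>b j\<close> to the vertex \<open>a j\<close>; a trail cover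
  decomposes this multigraph into edge-disjoint trails.
\<close>

definition trail_cover :: "nat \<Rightarrow> (nat \<Rightarrow> 'l) \<Rightarrow> (nat \<Rightarrow> 'l) \<Rightarrow> nat list set \<Rightarrow> bool" where
  "trail_cover q a b P \<longleftrightarrow> finite P \<and> (\<forall>p\<in>P. p \<noteq> [] \<and> distinct p \<and> successively (\<lambda>x y. a x = b y) p) \<and>
     (\<forall>p\<in>P. \<forall>r\<in>P. p \<noteq> r \<longrightarrow> set p \<inter> set r = {}) \<and> (\<Union>p\<in>P. set p) = {..<q}"

lemma trail_coverD:
  assumes "trail_cover q a b P"
  shows "finite P" "p \<in> P \<Longrightarrow> p \<noteq> [] \<and> distinct p \<and> successively (\<lambda>x y. a x = b y) p"
    "p \<in> P \<Longrightarrow> r \<in> P \<Longrightarrow> p \<noteq> r \<Longrightarrow> set p \<inter> set r = {}" "(\<Union>p\<in>P. set p) = {..<q}"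
  using assms unfolding trail_cover_def by simp_all

lemma trail_cover_merge:
  assumes P: "trail_cover q a b P" and pr: "p \<in> P" "r \<in> P" "p \<noteq> r" "a (last p) = b (hd r)"
  shows "trail_cover q a b (insert (p @ r) (P - {p, r}))" "card (insert (p @ r) (P - {p, r})) < card P"
proof -
  note fin = trail_coverD(1)[OF P] and tr = trail_coverD(2)[OF P]
    and dj = trail_coverD(3)[OF P] and un = trail_coverD(4)[OF P]
  show "trail_cover q a b (insert (p @ r) (P - {p, r}))" unfolding trail_cover_def
  proof (intro conjI ballI impI)
    show "finite (insert (p @ r) (P - {p, r}))" using fin by simp
    fix x assume x: "x \<in> insert (p @ r) (P - {p, r})"
    show "x \<noteq> []" using x tr pr by auto
    show "distinct x" using x tr[OF pr(1)] tr[OF pr(2)] tr dj[OF pr(1-3)] by auto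
    show "successively (\<lambda>x y. a x = b y) x" using x tr[OF pr(1)] tr[OF pr(2)] tr pr(4)
      by (auto simp: successively_append_iff)
    fix y assume y: "y \<in> insert (p @ r) (P - {p, r})" "x \<noteq> y"
    have *: "set z \<inter> set (p @ r) = {}" if "z \<in> P - {p, r}" for z
      using that dj[of z p] dj[of z r] pr by auto
    show "set x \<inter> set y = {}" using x y * dj[of x y] by (auto simp del: set_append)
  next
    show "(\<Union>p\<in>insert (p @ r) (P - {p, r}). set p) = {..<q}" using un pr(1,2) by auto
  qed
  have "card (insert (p @ r) (P - {p, r})) \<le> Suc (card (P - {p, r}))" by (rule card_insert_le_m1) simp_all
  moreover have "card (P - {p, r}) = card P - 2" using pr fin by (simp add: card_Diff_subset)
  moreover have "card P \<ge> 2" using card_mono[OF fin, of "{p, r}"] pr by simp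
  ultimately show "card (insert (p @ r) (P - {p, r})) < card P" by linarith
qed

text \<open>
  Two trails can be merged when one ends where the other begins; a cover with as few trails as possible
  permits no merging. A closed trail may still end where it begins itself.
\<close>

lemma exists_minimal_trail_cover:
  "\<exists>P. trail_cover q a b P \<and> (\<forall>p\<in>P. \<forall>r\<in>P. a (last p) = b (hd r) \<longrightarrow> p = r)"
proof -
  have "trail_cover q a b ((\<lambda>j. [j]) ` {..<q})" by (auto simp: trail_cover_def)
  then obtain P where P: "trail_cover q a b P" "\<And>P'. trail_cover q a b P' \<Longrightarrow> card P \<le> card P'"
    using ex_has_least_nat[of "trail_cover q a b" _ card] by metis
  have "p = r" if "p \<in> P" "r \<in> P" "a (last p) = b (hd r)" for p r
  proof (rule ccontr)
    assume "p \<noteq> r"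
    from trail_cover_merge[OF P(1) that(1,2) this that(3)] P(2) show False by fastforce
  qed
  then show ?thesis using P(1) by blast
qed

text \<open>
  The trails of a minimal cover are put one behind the other; mismatches occur only at their ends. At a
  vertex \<open>l\<close> where some trail ends and some trail begins, both are one and the same trail; elsewhere the
  number of trails that end in \<open>l\<close> is zero or the surplus of incoming over outgoing edges. Summing over the
  vertices bounds the number of trails by the total imbalance plus the number of vertices. It is
  essential that the last term does not depend on the number \<open>q\<close> of edges.
\<close>

lemma exists_cyclic_ordering:
  fixes a b :: "nat \<Rightarrow> 'l"
  assumes L: "finite L" "\<And>j. j < q \<Longrightarrow> a j \<in> L"
  shows "\<exists>xs. distinct xs \<and> set xs = {..<q} \<and>
    real (card {t. t < q \<and> a (xs ! t) \<noteq> b (xs ! (Suc t mod q))}) \<le>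
      (\<Sum>l\<in>L. \<bar>real (card {j. j < q \<and> a j = l}) - real (card {j. j < q \<and> b j = l})\<bar>) + real (card L)"
proof -
  obtain P where P: "trail_cover q a b P" and min: "\<And>p r. p \<in> P \<Longrightarrow> r \<in> P \<Longrightarrow> a (last p) = b (hd r) \<Longrightarrow> p = r"
    using exists_minimal_trail_cover[of q a b] by blast
  note fin = trail_coverD(1)[OF P] and tr = trail_coverD(2)[OF P]
    and dj = trail_coverD(3)[OF P] and un = trail_coverD(4)[OF P]
  define St where "St l = {p \<in> P. b (hd p) = l}" for l
  define En where "En l = {p \<in> P. a (last p) = l}" for l
  have cnt: "card {j. j < q \<and> c j = l} = (\<Sum>p\<in>P. length (filter (\<lambda>x. c x = l) p))" for c :: "nat \<Rightarrow> 'l" and l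
  proof -
    have "j < q \<longleftrightarrow> j \<in> (\<Union>p\<in>P. set p)" for j by (simp only: un lessThan_iff)
    then have "{j. j < q \<and> c j = l} = (\<Union>p\<in>P. set (filter (\<lambda>x. c x = l) p))" by auto
    also have "card \<dots> = (\<Sum>p\<in>P. card (set (filter (\<lambda>x. c x = l) p)))"
      using fin dj by (intro card_UN_disjoint) fastforce+
    also have "\<dots> = (\<Sum>p\<in>P. length (filter (\<lambda>x. c x = l) p))"
      using tr by (intro sum.cong refl distinct_card) auto
    finally show ?thesis .
  qed
  have bal: "card {j. j < q \<and> a j = l} + card (St l) = card {j. j < q \<and> b j = l} + card (En l)" for l
  proof -
    have "card (St l) = (\<Sum>p\<in>P. if b (hd p) = l then 1 else 0)" "card (En l) = (\<Sum>p\<in>P. if a (last p) = l then 1 else 0)"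
      using fin by (simp_all add: St_def En_def sum.If_cases Int_def)
    then show ?thesis unfolding cnt by (simp only: sum.distrib[symmetric]) (intro sum.cong refl trail_count, use tr in auto)
  qed
  have En_le: "real (card (En l)) \<le> \<bar>real (card {j. j < q \<and> a j = l}) - real (card {j. j < q \<and> b j = l})\<bar> + 1" for l
  proof -
    consider "En l = {}" | "St l = {}" | p r where "p \<in> En l" "r \<in> St l" by blast
    then show ?thesis
    proof cases
      case 2
      then show ?thesis using bal[of l] by simp
    next
      case 3
      have "En l \<subseteq> {r}" using 3(2) min by (auto simp: En_def St_def)
      then have "card (En l) \<le> 1" using card_mono[of "{r}" "En l"] by simp
      then show ?thesis by linarith
    qed simp
  qed
  have lastL: "a (last p) \<in> L" if "p \<in> P" for p
  proof -
    have "last p \<in> set p" using tr[OF that] by simp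
    then have "last p < q" using un that by blast
    then show ?thesis by (rule L(2))
  qed
  have "P = (\<Union>l\<in>L. En l)" using lastL by (auto simp: En_def)
  then have "card P \<le> (\<Sum>l\<in>L. card (En l))" using card_UN_le[OF L(1)] by metis
  then have "real (card P) \<le> (\<Sum>l\<in>L. real (card (En l)))" by (metis of_nat_le_iff of_nat_sum)
  also have "\<dots> \<le> (\<Sum>l\<in>L. \<bar>real (card {j. j < q \<and> a j = l}) - real (card {j. j < q \<and> b j = l})\<bar> + 1)"
    by (intro sum_mono En_le)
  finally have cP: "real (card P) \<le> (\<Sum>l\<in>L. \<bar>real (card {j. j < q \<and> a j = l}) - real (card {j. j < q \<and> b j = l})\<bar>) + real (card L)"
    by (simp add: sum.distrib)
  obtain ps where ps: "set ps = P" "distinct ps" using finite_distinct_list[OF fin] by blast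
  define xs where "xs = concat ps"
  have dx: "distinct xs" unfolding xs_def
    using ps tr dj by (intro distinct_concat) auto
  have sx: "set xs = {..<q}" using ps un by (auto simp: xs_def)
  have lx: "length xs = q" using distinct_card[OF dx] sx by simp
  have "{t. t < q \<and> a (xs ! t) \<noteq> b (xs ! (Suc t mod q))} \<subseteq> {t. t < q \<and> xs ! t \<in> last ` P}"
  proof
    fix t assume t: "t \<in> {t. t < q \<and> a (xs ! t) \<noteq> b (xs ! (Suc t mod q))}"
    then have "xs ! t \<in> last ` P \<or> (Suc t < q \<and> a (xs ! t) = b (xs ! Suc t))"
      using concat_trails_nth[of ps a b t] tr ps lx unfolding xs_def by auto
    then show "t \<in> {t. t < q \<and> xs ! t \<in> last ` P}" using t by auto
  qed
  then have "card {t. t < q \<and> a (xs ! t) \<noteq> b (xs ! (Suc t mod q))} \<le> card {t. t < q \<and> xs ! t \<in> last ` P}"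
    by (intro card_mono) auto
  also have "\<dots> \<le> card (last ` P)"
  proof (rule card_inj_on_le[of "\<lambda>t. xs ! t"])
    show "inj_on ((!) xs) {t. t < q \<and> xs ! t \<in> last ` P}"
      using dx lx by (auto simp: inj_on_def nth_eq_iff_index_eq)
  qed (use fin in auto)
  also have "\<dots> \<le> card P" by (rule card_image_le[OF fin])
  finally show ?thesis using cP dx sx by (intro exI[of _ xs] conjI) linarith+
qed

section \<open>Density of the conjugated irrational rotations\<close>

lemma measure_cells:
  assumes c: "coordinate M u v N" and M: "prob_space M" and q: "q > 0" and J: "J \<subseteq> {..<q}"
  shows "{x \<in> space M. cell q (u x) \<in> J} \<in> sets M" "measure M {x \<in> space M. cell q (u x) \<in> J} = real (card J) / real q"
proof -
  interpret prob_space M by fact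
  note um [measurable] = coordinate_measurable[OF c]
  have one: "{x \<in> space M. cell q (u x) = j} \<in> sets M \<and> measure M {x \<in> space M. cell q (u x) = j} = 1 / real q" if j: "j < q" for j
  proof -
    have ivl: "cell q y = j \<longleftrightarrow> y \<in> {real j / real q..<(real j + 1) / real q}" if y: "y \<in> {0..1}" for y
    proof -
      have "cell q y = j \<longleftrightarrow> \<lfloor>real q * y\<rfloor> = int j" using y q by (auto simp: cell_def)
      also have "\<dots> \<longleftrightarrow> real j \<le> real q * y \<and> real q * y < real j + 1" by (simp add: floor_eq_iff)
      also have "\<dots> \<longleftrightarrow> y \<in> {real j / real q..<(real j + 1) / real q}"
        using q by (auto simp: field_simps)
      finally show ?thesis .
    qed
    have eq: "{x \<in> space M. cell q (u x) = j} = u -` {real j / real q..<(real j + 1) / real q} \<inter> space M"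
      using ivl coordinate_range[OF c] by blast
    have "real j + 1 \<le> real q" using j by linarith
    then have "(real j + 1) / real q \<le> 1" using q by simp
    then have "{real j / real q..<(real j + 1) / real q} \<inter> {0..1} = {real j / real q..<(real j + 1) / real q}"
      using order_trans[of 0 "real j / real q"] by fastforce
    moreover have "real j / real q \<le> (real j + 1) / real q" by (simp add: divide_right_mono)
    ultimately show ?thesis unfolding eq using coordinate_measure[OF c, of "{real j / real q..<(real j + 1) / real q}"]
      by (simp add: diff_divide_distrib[symmetric])
  qed
  have fJ: "finite J" using J finite_subset by blast
  have un: "{x \<in> space M. cell q (u x) \<in> J} = (\<Union>j\<in>J. {x \<in> space M. cell q (u x) = j})" by auto
  show "{x \<in> space M. cell q (u x) \<in> J} \<in> sets M" unfolding un using one J fJ by (intro sets.finite_UN) auto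
  have "measure M {x \<in> space M. cell q (u x) \<in> J} = (\<Sum>j\<in>J. measure M {x \<in> space M. cell q (u x) = j})"
    unfolding un using fJ one J by (intro finite_measure_finite_Union) (auto simp: disjoint_family_on_def)
  also have "\<dots> = (\<Sum>j\<in>J. 1 / real q)" using one J by (intro sum.cong) auto
  finally show "measure M {x \<in> space M. cell q (u x) \<in> J} = real (card J) / real q" by simp
qed

lemma measure_near_cell_boundary:
  assumes c: "coordinate M u v N" and M: "prob_space M" and q: "q > 0" and \<eta>: "\<eta> > 0"
  shows "{x \<in> space M. frac (real q * u x) < \<eta>} \<in> sets M" "measure M {x \<in> space M. frac (real q * u x) < \<eta>} \<le> 2 * \<eta>"
proof -
  interpret prob_space M by fact
  note um [measurable] = coordinate_measurable[OF c]
  show m: "{x \<in> space M. frac (real q * u x) < \<eta>} \<in> sets M" unfolding frac_def by measurable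
  define I where "I j = {real j / real q..(real j + \<eta>) / real q}" for j
  have Im: "u -` I j \<inter> space M \<in> sets M" for j by (rule coordinate_measure(1)[OF c]) (simp add: I_def)
  have Ile: "measure M (u -` I j \<inter> space M) \<le> \<eta> / real q" for j
  proof -
    have "measure M (u -` I j \<inter> space M) = measure lborel (I j \<inter> {0..1})"
      by (rule coordinate_measure(2)[OF c]) (simp add: I_def)
    also have "\<dots> \<le> measure lborel (I j)"
      by (rule measure_mono_fmeasurable) (auto simp: I_def fmeasurable_def emeasure_lborel_Icc_eq)
    also have "\<dots> = \<eta> / real q"
      using q \<eta> by (simp add: I_def divide_right_mono add_divide_distrib)
    finally show ?thesis .
  qed
  have "{x \<in> space M. frac (real q * u x) < \<eta>} \<subseteq> (\<Union>j\<in>{..q}. u -` I j \<inter> space M)"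
  proof
    fix x assume x: "x \<in> {x \<in> space M. frac (real q * u x) < \<eta>}"
    define j where "j = nat \<lfloor>real q * u x\<rfloor>"
    have u01: "0 \<le> u x" "u x \<le> 1" using coordinate_range[OF c, of x] x by auto
    then have "0 \<le> real q * u x" "real q * u x \<le> real q" using mult_left_mono[of "u x" 1 "real q"] by auto
    then have j: "real j = of_int \<lfloor>real q * u x\<rfloor>" "j \<le> q" by (auto simp: j_def nat_le_iff floor_le_iff)
    then have "real q * u x = real j + frac (real q * u x)" by (simp add: frac_def)
    then have "real j \<le> real q * u x" "real q * u x \<le> real j + \<eta>" using x frac_ge_0[of "real q * u x"] by (simp_all only: mem_Collect_eq) linarith+
    then have "u x \<in> I j" using q by (auto simp: I_def field_simps)
    then show "x \<in> (\<Union>j\<in>{..q}. u -` I j \<inter> space M)" using x j by auto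
  qed
  then have "measure M {x \<in> space M. frac (real q * u x) < \<eta>} \<le> measure M (\<Union>j\<in>{..q}. u -` I j \<inter> space M)"
    by (rule finite_measure_mono) (intro sets.finite_UN Im finite_atMost)
  also have "\<dots> \<le> (\<Sum>j\<in>{..q}. measure M (u -` I j \<inter> space M))"
    using Im by (intro finite_measure_subadditive_finite) auto
  also have "\<dots> \<le> (\<Sum>j\<in>{..q}. \<eta> / real q)" by (intro sum_mono Ile)
  also have "\<dots> = (real q + 1) * \<eta> / real q" by simp
  also have "\<dots> \<le> 2 * \<eta>" using q \<eta> by (simp add: divide_simps)
  finally show "measure M {x \<in> space M. frac (real q * u x) < \<eta>} \<le> 2 * \<eta>" .
qed

text \<open>
  Rotating backwards by slightly more than one cell length moves a point to the preceding cell,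
  cyclically, unless the point lies within the excess of the left end of its cell.
\<close>

lemma cell_rot:
  assumes y: "y \<in> {0..<1}" and q: "q > 0" and \<alpha>: "1 / real q < \<alpha>" "\<alpha> < (1 + \<eta>) / real q"
    and r: "\<eta> \<le> frac (real q * y)"
  shows "cell q (rot (- \<alpha>) y) < q" "Suc (cell q (rot (- \<alpha>) y)) mod q = cell q y"
proof -
  define p where "p = cell q y"
  define r' where "r' = frac (real q * y) - (real q * \<alpha> - 1)"
  have qp: "real q > 0" using q by simp
  have b: "0 < real q * \<alpha> - 1" "real q * \<alpha> - 1 < \<eta>" using \<alpha> qp by (auto simp: field_simps)
  have r': "0 \<le> r'" "r' < 1" using b r frac_lt_1[of "real q * y"] by (auto simp: r'_def)
  have pq: "p < q" unfolding p_def by (rule cell_less[OF q y])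
  have "real q * y = real p + frac (real q * y)" using y q by (simp add: p_def cell_def frac_def)
  then have yq: "real q * (y - \<alpha>) = real p - 1 + r'" by (simp add: r'_def algebra_simps)
  then have y\<alpha>: "y - \<alpha> = (real p - 1 + r') / real q" using qp by (simp add: field_simps)
  \<comment> \<open>For \<open>p = 0\<close> the point passes \<open>0\<close> and reappears in the last cell.\<close>
  define t where "t = (if p = 0 then q - 1 else p - 1)"
  have t: "t < q" using pq by (auto simp: t_def)
  note ct = cell_of_decomp[OF t r']
  have "frac (y - \<alpha>) = (real t + r') / real q"
    unfolding frac_unique_iff
  proof (intro conjI)
    show "0 \<le> (real t + r') / real q" "(real t + r') / real q < 1" using ct(1) by auto
    show "y - \<alpha> - (real t + r') / real q \<in> \<int>"
    proof (cases "p = 0")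
      case True
      have "y - \<alpha> - (real t + r') / real q = (real p - 1 - real t) / real q"
        unfolding y\<alpha> by (simp add: diff_divide_distrib[symmetric])
      also have "\<dots> = - 1" using True q by (simp add: t_def of_nat_diff)
      finally show ?thesis by simp
    next
      case False
      then have "y - \<alpha> - (real t + r') / real q = 0" unfolding y\<alpha> by (simp add: t_def of_nat_diff)
      then show ?thesis by simp
    qed
  qed
  then have "cell q (rot (- \<alpha>) y) = t" using ct(2) by (simp add: rot_def)
  then show "cell q (rot (- \<alpha>) y) < q" "Suc (cell q (rot (- \<alpha>) y)) mod q = cell q y"
    using t pq by (auto simp: t_def p_def[symmetric])
qed

lemma exists_irrational_between:
  assumes "(l::real) < r" shows "\<exists>x. l < x \<and> x < r \<and> x \<notin> \<rat>"
proof -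
  have "uncountable {l<..<r}" using assms by (simp add: uncountable_open_interval)
  then have "\<not> {l<..<r} \<subseteq> \<rat>" using countable_rat countable_subset by blast
  then show ?thesis by auto
qed

lemma measure_diff_le_sym_diff:
  assumes "prob_space M" "A \<in> sets M" "B \<in> sets M"
  shows "\<bar>measure M A - measure M B\<bar> \<le> measure M (sym_diff A B)"
proof -
  interpret prob_space M by fact
  have "measure M A \<le> measure M (B \<union> sym_diff A B)" "measure M B \<le> measure M (A \<union> sym_diff A B)"
    using assms by (auto intro!: finite_measure_mono)
  moreover have "measure M (B \<union> sym_diff A B) \<le> measure M B + measure M (sym_diff A B)"
    "measure M (A \<union> sym_diff A B) \<le> measure M A + measure M (sym_diff A B)"
    using assms by (auto intro!: measure_Un_le)
  ultimately show ?thesis by linarith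
qed

lemma measure_preserving_vimage:
  assumes "t \<in> M \<rightarrow>\<^sub>M M" "distr M M t = M" "A \<in> sets M"
  shows "measure M (t -` A \<inter> space M) = measure M A"
  using measure_distr[OF assms(1,3)] assms(2) by simp

text \<open>
  The atoms of the finite algebra generated by the sets \<open>A E\<close> change little if the generators do.
\<close>

lemma label_measure_close:
  assumes M: "prob_space M" and F: "finite F" and A: "\<And>E. E \<in> F \<Longrightarrow> A E \<in> sets M" and B: "\<And>E. E \<in> F \<Longrightarrow> B E \<in> sets M"
    and ab: "\<And>E. E \<in> F \<Longrightarrow> measure M (sym_diff (A E) (B E)) \<le> \<eta>"
  shows "\<bar>measure M {x \<in> space M. {E \<in> F. x \<in> A E} = l} - measure M {x \<in> space M. {E \<in> F. x \<in> B E} = l}\<bar> \<le> real (card F) * \<eta>"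
    and "{x \<in> space M. {E \<in> F. x \<in> A E} = l} \<in> sets M"
proof -
  interpret prob_space M by fact
  have meas: "{x \<in> space M. {E \<in> F. x \<in> A E} = l} \<in> sets M" if "\<And>E. E \<in> F \<Longrightarrow> A E \<in> sets M" for A
  proof (cases "l \<subseteq> F")
    case True
    have "{x \<in> space M. {E \<in> F. x \<in> A E} = l} = {x \<in> space M. \<forall>E\<in>F. x \<in> A E \<longleftrightarrow> E \<in> l}" using True by auto
    also have "\<dots> = {x \<in> space M. \<forall>E\<in>F. x \<in> (if E \<in> l then A E else space M - A E)}" by auto
    also have "\<dots> \<in> sets M"
    proof (rule sets.sets_Collect_finite_All[OF _ F])
      fix E assume E: "E \<in> F"
      have "{x \<in> space M. x \<in> (if E \<in> l then A E else space M - A E)} = (if E \<in> l then A E else space M - A E)"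
        using sets.sets_into_space[OF that[OF E]] by auto
      then show "{x \<in> space M. x \<in> (if E \<in> l then A E else space M - A E)} \<in> sets M" using that[OF E] by auto
    qed
    finally show ?thesis .
  next
    case False
    then have "{x \<in> space M. {E \<in> F. x \<in> A E} = l} = {}" by auto
    then show ?thesis by (simp only: sets.empty_sets)
  qed
  show mA: "{x \<in> space M. {E \<in> F. x \<in> A E} = l} \<in> sets M" by (rule meas[OF A])
  note mB = meas[of B, OF B]
  have "\<bar>measure M {x \<in> space M. {E \<in> F. x \<in> A E} = l} - measure M {x \<in> space M. {E \<in> F. x \<in> B E} = l}\<bar>
     \<le> measure M (sym_diff {x \<in> space M. {E \<in> F. x \<in> A E} = l} {x \<in> space M. {E \<in> F. x \<in> B E} = l})"
    by (rule measure_diff_le_sym_diff[OF M mA mB])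
  also have "\<dots> \<le> measure M (\<Union>E\<in>F. sym_diff (A E) (B E))"
    using A B F by (intro finite_measure_mono) auto
  also have "\<dots> \<le> (\<Sum>E\<in>F. measure M (sym_diff (A E) (B E)))"
    using A B F by (intro finite_measure_subadditive_finite) auto
  also have "\<dots> \<le> (\<Sum>E\<in>F. \<eta>)" by (intro sum_mono ab)
  finally show "\<bar>measure M {x \<in> space M. {E \<in> F. x \<in> A E} = l} - measure M {x \<in> space M. {E \<in> F. x \<in> B E} = l}\<bar> \<le> real (card F) * \<eta>"
    by simp
qed

definition irrational_rotations :: "'a measure \<Rightarrow> ('a \<Rightarrow> 'a) set set" where
  "irrational_rotations M = {mpt_class M (v \<circ> rot a \<circ> u) | u v N a. coordinate M u v N \<and> a \<notin> \<rat>}"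

text \<open>
  Each cell carries two labels: the sets \<open>E\<close> of \<open>F\<close> that it belongs to, and the sets \<open>E\<close> whose images \<open>T E\<close>
  it belongs to, both up to the approximation by cells. Since \<open>T\<close> preserves measure, each label occurs
  about equally often in both roles, so the cells can be arranged on a circle in such a way that almost
  always the first label of a cell is the second label of its successor. A transformation that
  moves each cell to its successor then sends \<open>E\<close> nearly to \<open>T E\<close>. The rotation by an irrational angle slightly
  above \<open>1/q\<close>, in the coordinate in which the cells are arranged in this order, does so up to a small set.
\<close>

lemma exists_close_rotation:
  assumes M: "prob_space M" and c: "coordinate M u v N" and T: "T \<in> MPT M"
    and F: "finite F" "F \<subseteq> sets M" and \<eta>: "\<eta> > 0" and q: "q > 0" "real (card (Pow F)) \<le> \<eta> * real q"
    and J: "\<And>E. E \<in> F \<Longrightarrow> J E \<subseteq> {..<q} \<and> measure M (sym_diff E {x \<in> space M. cell q (u x) \<in> J E}) \<le> \<eta>"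
    and J': "\<And>E. E \<in> F \<Longrightarrow> J' E \<subseteq> {..<q} \<and>
      measure M (sym_diff (tinv M T -` E \<inter> space M) {x \<in> space M. cell q (u x) \<in> J' E}) \<le> \<eta>"
  shows "\<exists>S\<in>irrational_rotations M. \<forall>E\<in>F.
    wdist M E T S \<le> (5 + 2 * real (card (Pow F)) * real (card F)) * \<eta>"
proof -
  interpret prob_space M by fact
  note tD = ess_isoD[OF ess_iso_sym[OF ess_iso_rep_tinv[OF M T]]]
  define C where "C J = {x \<in> space M. cell q (u x) \<in> J}" for J
  have Cm: "C J \<in> sets M" and Cme: "measure M (C J) = real (card J) / real q" if "J \<subseteq> {..<q}" for J
    using measure_cells[OF c M q(1) that] by (simp_all add: C_def)
  define a where "a j = {E \<in> F. j \<in> J E}" for j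
  define b where "b j = {E \<in> F. j \<in> J' E}" for j
  have imb: "\<bar>real (card {j. j < q \<and> a j = l}) - real (card {j. j < q \<and> b j = l})\<bar> \<le> 2 * real (card F) * \<eta> * real q" for l
  proof -
    have lab: "measure M {x \<in> space M. {E \<in> F. x \<in> C (K E)} = l} = real (card {j. j < q \<and> {E \<in> F. j \<in> K E} = l}) / real q"
      if K: "\<And>E. E \<in> F \<Longrightarrow> K E \<subseteq> {..<q}" for K
    proof -
      have "measure M {x \<in> space M. {E \<in> F. x \<in> C (K E)} = l} = measure M (C {j. j < q \<and> {E \<in> F. j \<in> K E} = l})"
      proof (rule measure_eq_AE)
        show "AE x in M. x \<in> {x \<in> space M. {E \<in> F. x \<in> C (K E)} = l} \<longleftrightarrow> x \<in> C {j. j < q \<and> {E \<in> F. j \<in> K E} = l}"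
          using coordinate_AE_range[OF c] AE_space
        proof eventually_elim
          case (elim x)
          then have "cell q (u x) < q" by (intro cell_less q) auto
          moreover have "{E \<in> F. x \<in> C (K E)} = {E \<in> F. cell q (u x) \<in> K E}" using elim by (auto simp: C_def)
          ultimately show ?case using elim by (auto simp: C_def)
        qed
        show "C {j. j < q \<and> {E \<in> F. j \<in> K E} = l} \<in> sets M" by (rule Cm) auto
        show "{x \<in> space M. {E \<in> F. x \<in> C (K E)} = l} \<in> sets M"
        proof (rule label_measure_close(2)[OF M F(1), where A = "\<lambda>E. C (K E)" and B = "\<lambda>E. C (K E)" and \<eta> = 0])
          show "C (K E) \<in> sets M" "C (K E) \<in> sets M" if E: "E \<in> F" for E by (rule Cm[OF K[OF E]])+
        qed simp
      qed
      also have "\<dots> = real (card {j. j < q \<and> {E \<in> F. j \<in> K E} = l}) / real q" by (rule Cme) auto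
      finally show ?thesis .
    qed
    have 1: "\<bar>measure M {x \<in> space M. {E \<in> F. x \<in> E} = l} - real (card {j. j < q \<and> a j = l}) / real q\<bar> \<le> real (card F) * \<eta>"
    proof -
      have "\<bar>measure M {x \<in> space M. {E \<in> F. x \<in> E} = l} - measure M {x \<in> space M. {E \<in> F. x \<in> C (J E)} = l}\<bar> \<le> real (card F) * \<eta>"
        by (rule label_measure_close(1)[OF M F(1)]) (use F J Cm in \<open>auto simp: C_def\<close>)
      then show ?thesis using lab[of J] J by (simp add: a_def)
    qed
    have 2: "\<bar>measure M {x \<in> space M. {E \<in> F. x \<in> tinv M T -` E \<inter> space M} = l} - real (card {j. j < q \<and> b j = l}) / real q\<bar> \<le> real (card F) * \<eta>"
    proof -
      have "\<bar>measure M {x \<in> space M. {E \<in> F. x \<in> tinv M T -` E \<inter> space M} = l} - measure M {x \<in> space M. {E \<in> F. x \<in> C (J' E)} = l}\<bar> \<le> real (card F) * \<eta>"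
        by (rule label_measure_close(1)[OF M F(1)]) (use F J' Cm tinv_sets[OF M T] in \<open>auto simp: C_def\<close>)
      then show ?thesis using lab[of J'] J' by (simp add: b_def)
    qed
    have 3: "measure M {x \<in> space M. {E \<in> F. x \<in> tinv M T -` E \<inter> space M} = l} = measure M {x \<in> space M. {E \<in> F. x \<in> E} = l}"
    proof -
      have X: "{x \<in> space M. {E \<in> F. x \<in> E} = l} \<in> sets M"
        by (rule label_measure_close(2)[OF M F(1), of "\<lambda>E. E" "\<lambda>E. E" 0]) (use F in auto)
      have "{x \<in> space M. {E \<in> F. x \<in> tinv M T -` E \<inter> space M} = l} = tinv M T -` {x \<in> space M. {E \<in> F. x \<in> E} = l} \<inter> space M"
        using measurable_space[OF tD(1)] by auto
      then show ?thesis using measure_preserving_vimage[OF tD(1,3) X] by simp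
    qed
    have "\<bar>real (card {j. j < q \<and> a j = l}) / real q - real (card {j. j < q \<and> b j = l}) / real q\<bar> \<le> 2 * real (card F) * \<eta>"
      using 1 2 3 by linarith
    then have "\<bar>real (card {j. j < q \<and> a j = l}) - real (card {j. j < q \<and> b j = l})\<bar> / real q \<le> 2 * real (card F) * \<eta>"
      by (simp add: diff_divide_distrib[symmetric])
    then show ?thesis using q(1) by (simp add: pos_divide_le_eq)
  qed
  obtain xs where xs: "distinct xs" "set xs = {..<q}"
    "real (card {t. t < q \<and> a (xs ! t) \<noteq> b (xs ! (Suc t mod q))}) \<le>
      (\<Sum>l\<in>Pow F. \<bar>real (card {j. j < q \<and> a j = l}) - real (card {j. j < q \<and> b j = l})\<bar>) + real (card (Pow F))"
    using exists_cyclic_ordering[of "Pow F" q a b] F(1) by (auto simp: a_def)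
  have lx: "length xs = q" using distinct_card[OF xs(1)] xs(2) by simp
  define bad where "bad = {t. t < q \<and> a (xs ! t) \<noteq> b (xs ! (Suc t mod q))}"
  have card_bad: "real (card bad) \<le> (2 * real (card (Pow F)) * real (card F) + 1) * \<eta> * real q"
  proof -
    have "real (card bad) \<le> (\<Sum>l\<in>Pow F. 2 * real (card F) * \<eta> * real q) + real (card (Pow F))"
      unfolding bad_def by (rule order_trans[OF xs(3)]) (intro add_mono sum_mono imb order_refl)
    also have "\<dots> \<le> real (card (Pow F)) * (2 * real (card F) * \<eta> * real q) + \<eta> * real q"
      using q(2) by simp
    finally show ?thesis by (simp add: algebra_simps)
  qed
  define \<tau> where "\<tau> t = xs ! t" for t
  define \<sigma> where "\<sigma> = inv_into {..<q} \<tau>"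
  have \<tau>: "inj_on \<tau> {..<q}" "\<tau> ` {..<q} = {..<q}"
    using xs lx by (auto simp: \<tau>_def inj_on_def nth_eq_iff_index_eq set_conv_nth image_def)
  have \<sigma>\<tau>: "\<sigma> (\<tau> j) = j" "\<tau> (\<sigma> j) = j" "\<sigma> j < q" if "j < q" for j
    using that \<tau> inv_into_f_f[OF \<tau>(1), of j] f_inv_into_f[of j \<tau> "{..<q}"] inv_into_into[of j \<tau> "{..<q}"]
    by (auto simp: \<sigma>_def)
  have sub: "\<sigma> ` {..<q} \<subseteq> {..<q}" "\<tau> ` {..<q} \<subseteq> {..<q}" using \<sigma>\<tau>(3) \<tau>(2) by auto
  define u' where "u' = permute_cells q \<sigma> \<circ> u"
  define v' where "v' = v \<circ> permute_cells q \<tau>"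
  have c': "coordinate M u' v' N"
    using c ess_iso_trans[OF _ piecewise_translation_ess_iso[OF
        piecewise_translation_permute_cells[OF q(1) sub \<sigma>\<tau>(2,1)]
        piecewise_translation_permute_cells[OF q(1) sub(2,1) \<sigma>\<tau>(1,2)]], of M N u v]
    by (simp add: coordinate_def u'_def v'_def)
  have cell_u: "cell q (u x) = xs ! cell q (u' x) \<and> cell q (u' x) < q" if "u x \<in> {0<..<1}" for x
  proof -
    have f: "frac (u x) = u x" using that by (simp add: frac_eq)
    have l: "cell q (u x) < q" using that by (intro cell_less q) auto
    have "cell q (u' x) = \<sigma> (cell q (u x))" using permute_cells(2)[OF q(1) sub(1), of "u x"] by (simp add: u'_def f)
    then show ?thesis using \<sigma>\<tau>[OF l] by (simp add: \<tau>_def)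
  qed
  have "1 / real q < (1 + \<eta>) / real q" using q(1) \<eta> by (simp add: divide_strict_right_mono)
  then obtain \<alpha> where \<alpha>: "1 / real q < \<alpha>" "\<alpha> < (1 + \<eta>) / real q" "\<alpha> \<notin> \<rat>"
    using exists_irrational_between by blast
  define S where "S = mpt_class M (v' \<circ> rot \<alpha> \<circ> u')"
  have SD: "S \<in> irrational_rotations M" unfolding irrational_rotations_def S_def using c' \<alpha>(3) by blast
  note r = rotation_ess_iso[OF c' M, of \<alpha>]
  note S = mpt_class[OF M r(1), folded S_def]
  note sD = ess_isoD[OF ess_iso_sym[OF ess_iso_rep_tinv[OF M S(1)]]]
  have us: "AE x in M. u' (tinv M S x) = rot (- \<alpha>) (u' x)"
    using S(3) r(2) by eventually_elim simp
  \<comment> \<open>Off \<open>Y\<close> the point comes from the preceding cell in the circular order, and the labels match.\<close>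
  define Y where "Y = {x \<in> space M. frac (real q * u' x) < \<eta>} \<union> {x \<in> space M. cell q (u' x) \<in> (\<lambda>t. Suc t mod q) ` bad}"
  have badq: "(\<lambda>t. Suc t mod q) ` bad \<subseteq> {..<q}" using q(1) by auto
  note Y1 = measure_near_cell_boundary[OF c' M q(1) \<eta>] and Y2 = measure_cells[OF c' M q(1) badq]
  have Ym: "Y \<in> sets M" unfolding Y_def using Y1(1) Y2(1) by (rule sets.Un)
  have Yle: "measure M Y \<le> (3 + 2 * real (card (Pow F)) * real (card F)) * \<eta>"
  proof -
    have "measure M Y \<le> 2 * \<eta> + real (card ((\<lambda>t. Suc t mod q) ` bad)) / real q"
      unfolding Y_def using measure_Un_le[OF Y1(1) Y2(1)] Y1(2) Y2(2) by linarith
    also have "real (card ((\<lambda>t. Suc t mod q) ` bad)) / real q \<le> real (card bad) / real q"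
      by (intro divide_right_mono) (auto intro!: card_image_le simp: bad_def)
    also have "\<dots> \<le> (2 * real (card (Pow F)) * real (card F) + 1) * \<eta>"
      using card_bad q(1) by (simp add: pos_divide_le_eq)
    finally show ?thesis by (simp add: algebra_simps)
  qed
  have "wdist M E T S \<le> (5 + 2 * real (card (Pow F)) * real (card F)) * \<eta>" if E: "E \<in> F" for E
  proof -
    let ?TE = "tinv M T -` E \<inter> space M" and ?SE = "tinv M S -` E \<inter> space M" and ?SC = "tinv M S -` C (J E) \<inter> space M"
    have Em: "E \<in> sets M" using E F by auto
    have CJ: "C (J E) \<in> sets M" "C (J' E) \<in> sets M" using J[OF E] J'[OF E] Cm by auto
    have m: "?TE \<in> sets M" "?SE \<in> sets M" "?SC \<in> sets M" using tinv_sets[OF M] T S(1) Em CJ by auto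
    have 1: "measure M (sym_diff ?TE (C (J' E))) \<le> \<eta>" using J'[OF E] by (simp add: C_def)
    have 2: "measure M (sym_diff (C (J' E)) ?SC) \<le> measure M Y"
    proof (rule finite_measure_mono_AE[OF _ Ym])
      show "AE x in M. x \<in> sym_diff (C (J' E)) ?SC \<longrightarrow> x \<in> Y"
        using us coordinate_AE_range[OF c] coordinate_AE_range[OF c'] AE_distr_pullback[OF sD(1,3) coordinate_AE_range[OF c]] AE_space
      proof eventually_elim
        case (elim x)
        show ?case
        proof (intro impI, rule ccontr)
          assume d: "x \<in> sym_diff (C (J' E)) ?SC" and n: "x \<notin> Y"
          define t where "t = cell q (u' (tinv M S x))"
          have ts: "tinv M S x \<in> space M" using measurable_space[OF sD(1)] elim by auto
          have "\<eta> \<le> frac (real q * u' x)" using n elim by (auto simp: Y_def)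
          then have t: "t < q" "Suc t mod q = cell q (u' x)"
            unfolding t_def elim(1) using cell_rot[OF _ q(1) \<alpha>(1,2)] elim(3) by auto
          have "t \<notin> bad"
          proof
            assume "t \<in> bad"
            then have "Suc t mod q \<in> (\<lambda>t. Suc t mod q) ` bad" by (rule imageI)
            then show False using n elim(5) unfolding t(2) by (simp add: Y_def)
          qed
          then have "a (xs ! t) = b (xs ! (Suc t mod q))" using t(1) by (simp add: bad_def)
          then have "xs ! t \<in> J E \<longleftrightarrow> xs ! cell q (u' x) \<in> J' E" unfolding t(2) using E by (auto simp: a_def b_def)
          then have "cell q (u (tinv M S x)) \<in> J E \<longleftrightarrow> cell q (u x) \<in> J' E"
            using cell_u[OF elim(2)] cell_u[OF elim(4)] by (simp add: t_def)
          then show False using d ts elim(5) by (auto simp: C_def)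
        qed
      qed
    qed
    have 3: "measure M (sym_diff ?SC ?SE) \<le> \<eta>"
    proof -
      have "sym_diff ?SC ?SE = tinv M S -` sym_diff E (C (J E)) \<inter> space M" by auto
      then show ?thesis using measure_preserving_vimage[OF sD(1,3), of "sym_diff E (C (J E))"] Em CJ J[OF E]
        by (simp add: C_def)
    qed
    have "wdist M E T S \<le> measure M (sym_diff ?TE (C (J' E))) + measure M (sym_diff (C (J' E)) ?SE)"
      unfolding wdist_def by (rule measure_sym_diff_triangle[OF M m(1) CJ(2) m(2)])
    also have "measure M (sym_diff (C (J' E)) ?SE) \<le> measure M (sym_diff (C (J' E)) ?SC) + measure M (sym_diff ?SC ?SE)"
      by (rule measure_sym_diff_triangle[OF M CJ(2) m(3,2)])
    finally have "wdist M E T S \<le> \<eta> + measure M Y + \<eta>" using 1 2 3 by linarith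
    also have "\<dots> \<le> (5 + 2 * real (card (Pow F)) * real (card F)) * \<eta>" using Yle by (simp add: algebra_simps)
    finally show ?thesis .
  qed
  then show ?thesis using SD by blast
qed

theorem irrational_rotations_dense:
  assumes M: "prob_space M" and c: "coordinate M u v N"
  shows "dense_in (weak_topology M) (irrational_rotations M)"
proof (rule dense_in_weakI[OF M])
  show "irrational_rotations M \<subseteq> MPT M"
    using mpt_class(1)[OF M] rotation_ess_iso(1)[OF _ M] by (fastforce simp: irrational_rotations_def)
  fix T F and \<delta> :: real
  assume T: "T \<in> MPT M" and F: "finite F" "F \<subseteq> sets M" and \<delta>: "\<delta> > 0"
  define K where "K = 5 + 2 * real (card (Pow F)) * real (card F)"
  have K: "K > 0" unfolding K_def by (intro add_pos_nonneg) auto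
  \<comment> \<open>\<open>K\<close> depends on \<open>F\<close> only, so \<open>\<eta>\<close> can be fixed before the number \<open>q\<close> of cells is chosen.\<close>
  define \<eta> where "\<eta> = \<delta> / (K + 1)"
  have \<eta>: "\<eta> > 0" "K * \<eta> < \<delta>" using K \<delta> by (auto simp: \<eta>_def field_simps)
  have "\<forall>\<^sub>F q in sequentially. \<forall>E\<in>F. \<exists>J\<subseteq>{..<q}. measure M (sym_diff E {x \<in> space M. cell q (u x) \<in> J}) < \<eta>"
    by (intro eventually_ball_finite F(1) ballI coordinate_cells_approx[OF c M _ \<eta>(1)]) (use F in auto)
  moreover have "\<forall>\<^sub>F q in sequentially. \<forall>E\<in>F. \<exists>J\<subseteq>{..<q}.
      measure M (sym_diff (tinv M T -` E \<inter> space M) {x \<in> space M. cell q (u x) \<in> J}) < \<eta>"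
    by (intro eventually_ball_finite F(1) ballI coordinate_cells_approx[OF c M _ \<eta>(1)] tinv_sets[OF M T]) (use F in auto)
  moreover have "\<forall>\<^sub>F q in sequentially. real (card (Pow F)) \<le> \<eta> * real q"
  proof -
    obtain n :: nat where n: "real (card (Pow F)) / \<eta> < real n" using reals_Archimedean2 by blast
    show ?thesis
    proof (rule eventually_sequentiallyI[of n])
      fix q assume "n \<le> q"
      then have "real (card (Pow F)) / \<eta> \<le> real q" using n by linarith
      then show "real (card (Pow F)) \<le> \<eta> * real q" using \<eta>(1) by (simp add: pos_divide_le_eq mult.commute)
    qed
  qed
  moreover have "\<forall>\<^sub>F q in sequentially. 0 < q" by (rule eventually_gt_at_top)
  ultimately have "\<forall>\<^sub>F q in sequentially. (\<forall>E\<in>F. \<exists>J\<subseteq>{..<q}. measure M (sym_diff E {x \<in> space M. cell q (u x) \<in> J}) < \<eta>) \<and>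
     (\<forall>E\<in>F. \<exists>J\<subseteq>{..<q}. measure M (sym_diff (tinv M T -` E \<inter> space M) {x \<in> space M. cell q (u x) \<in> J}) < \<eta>) \<and>
     real (card (Pow F)) \<le> \<eta> * real q \<and> 0 < q" by eventually_elim blast
  from eventually_happens'[OF sequentially_bot this] obtain q where
    q: "(\<forall>E\<in>F. \<exists>J\<subseteq>{..<q}. measure M (sym_diff E {x \<in> space M. cell q (u x) \<in> J}) < \<eta>) \<and>
     (\<forall>E\<in>F. \<exists>J\<subseteq>{..<q}. measure M (sym_diff (tinv M T -` E \<inter> space M) {x \<in> space M. cell q (u x) \<in> J}) < \<eta>) \<and>
     real (card (Pow F)) \<le> \<eta> * real q \<and> 0 < q" ..
  note q1 = conjunct1[OF q] and q2 = conjunct1[OF conjunct2[OF q]]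
  have q3: "real (card (Pow F)) \<le> \<eta> * real q" "0 < q" using conjunct2[OF conjunct2[OF q]] by auto
  obtain J where J: "\<forall>E\<in>F. J E \<subseteq> {..<q} \<and> measure M (sym_diff E {x \<in> space M. cell q (u x) \<in> J E}) < \<eta>"
    using bchoice[OF q1] by blast
  obtain J' where J': "\<forall>E\<in>F. J' E \<subseteq> {..<q} \<and> measure M (sym_diff (tinv M T -` E \<inter> space M) {x \<in> space M. cell q (u x) \<in> J' E}) < \<eta>"
    using bchoice[OF q2] by blast
  have "\<exists>S\<in>irrational_rotations M. \<forall>E\<in>F. wdist M E T S \<le> K * \<eta>" unfolding K_def
    by (rule exists_close_rotation[OF M c T F \<eta>(1) q3(2,1), of J J']) (use J J' in \<open>auto intro: less_imp_le\<close>)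
  then obtain S where S: "S \<in> irrational_rotations M" "\<And>E. E \<in> F \<Longrightarrow> wdist M E T S \<le> K * \<eta>" by blast
  show "\<exists>S\<in>irrational_rotations M. \<forall>E\<in>F. wdist M E T S < \<delta>"
    by (rule bexI[OF ballI S(1)]) (rule order.strict_trans1[OF S(2) \<eta>(2)])
qed

section \<open>Generic predictivity\<close>

text \<open>
  The condition that some polynomial in the operator maps \<open>f\<close> into the \<open>\<epsilon>\<close>-ball around \<open>h\<close>. It is open
  both in \<open>T\<close> and in \<open>f\<close>, and cyclicity is a countable conjunction of such conditions.
\<close>

definition approximable :: "'a measure \<Rightarrow> ('a \<Rightarrow> 'a) set \<Rightarrow> ('a \<Rightarrow> complex) \<Rightarrow> real \<Rightarrow> ('a \<Rightarrow> complex) \<Rightarrow> bool" where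
  "approximable M T h \<epsilon> f \<longleftrightarrow>
     (\<exists>n c. nrm M (\<lambda>x. h x - (\<Sum>i<(n::nat). c i * orbit_fun (tinv M T) f i x)) < \<epsilon>)"

lemma approximable_if_predictive:
  assumes M: "prob_space M" and T: "T \<in> MPT M" and f: "f \<in> l2_fun M" and h: "h \<in> l2_fun M"
    and p: "asymp_lin_predictive M T (l2_class M f)" and \<epsilon>: "\<epsilon> > 0"
  shows "approximable M T h \<epsilon> f"
proof -
  have "h \<in> cspan M (range (orbit_fun (tinv M T) f))" using p h asymp_lin_predictive_iff[OF M T f] by simp
  then obtain n :: nat and c e where e: "\<forall>i<n. e i \<in> range (orbit_fun (tinv M T) f)"
    "nrm M (\<lambda>x. h x - (\<Sum>i<n. c i * e i x)) < \<epsilon>" unfolding cspan_def using \<epsilon> by blast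
  have "\<forall>i. \<exists>k. i < n \<longrightarrow> e i = orbit_fun (tinv M T) f k" using e(1) by blast
  then obtain k where k: "\<And>i. i < n \<Longrightarrow> e i = orbit_fun (tinv M T) f (k i)" unfolding choice_iff by blast
  \<comment> \<open>The powers \<open>k i\<close> may be unordered and repeated; \<open>d j\<close> collects the coefficients of the \<open>j\<close>-th power.\<close>
  define m where "m = Suc (\<Sum>i<n. k i)"
  have km: "k i < m" if "i < n" for i
    unfolding m_def using member_le_sum[of i "{..<n}" k] that by (simp add: less_Suc_eq_le)
  define d where "d j = (\<Sum>i\<in>{i. i < n \<and> k i = j}. c i)" for j
  have "(\<Sum>i<n. c i * e i x) = (\<Sum>j<m. d j * orbit_fun (tinv M T) f j x)" for x
  proof -
    have "(\<Sum>j<m. d j * orbit_fun (tinv M T) f j x) = (\<Sum>j<m. \<Sum>i\<in>{i \<in> {..<n}. k i = j}. c i * e i x)"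
      unfolding d_def sum_distrib_right by (intro sum.cong) (auto simp: k)
    also have "\<dots> = (\<Sum>i<n. c i * e i x)" by (rule sum.group) (use km in auto)
    finally show ?thesis by simp
  qed
  then show ?thesis unfolding approximable_def using e(2) by (intro exI[of _ m] exI[of _ d]) simp
qed

lemma predictive_if_approximable:
  assumes M: "prob_space M" and T: "T \<in> MPT M" and f: "f \<in> l2_fun M"
    and H: "H \<subseteq> l2_fun M" "cspan M H = l2_fun M"
    and app: "\<And>h (m::nat). h \<in> H \<Longrightarrow> approximable M T h (1 / (real m + 1)) f"
  shows "asymp_lin_predictive M T (l2_class M f)"
proof -
  note s = ess_isoD[OF ess_iso_sym[OF ess_iso_rep_tinv[OF M T]]]
  let ?O = "range (orbit_fun (tinv M T) f)"
  have sub: "?O \<subseteq> l2_fun M" using orbit_fun_l2[OF s(1,3) f] by auto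
  note W = cspan_closed[OF sub]
  have "H \<subseteq> cspan M ?O"
  proof
    fix h assume h: "h \<in> H"
    show "h \<in> cspan M ?O"
    proof (rule closed_subspaceD(5)[OF W])
      show "h \<in> l2_fun M" using h H by auto
      fix \<epsilon> :: real assume "\<epsilon> > 0"
      then obtain m :: nat where m: "1 / (real m + 1) < \<epsilon>" using nat_approx_posE[of \<epsilon>] by (auto simp: add.commute)
      obtain n :: nat and c where n: "nrm M (\<lambda>x. h x - (\<Sum>i<n. c i * orbit_fun (tinv M T) f i x)) < 1 / (real m + 1)"
        using app[OF h, of m] unfolding approximable_def by blast
      have "(\<lambda>x. \<Sum>i<n. c i * orbit_fun (tinv M T) f i x) \<in> cspan M ?O"
        by (intro closed_subspace_sum[OF W] closed_subspaceD(4)[OF W]) (use cspan_superset[OF sub] in auto)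
      then show "\<exists>g\<in>cspan M ?O. nrm M (\<lambda>x. h x - g x) < \<epsilon>"
        by (rule bexI[rotated]) (use n m in linarith)
    qed
  qed
  then have "l2_fun M \<subseteq> cspan M ?O" using cspan_subset[OF W] H(2) by blast
  then show ?thesis using asymp_lin_predictive_iff[OF M T f] closed_subspaceD(1)[OF W] by blast
qed

lemma openin_approximable:
  assumes M: "prob_space M" and f: "f \<in> l2_fun M" and h: "h \<in> l2_fun M"
  shows "openin (weak_topology M) {T \<in> MPT M. approximable M T h \<epsilon> f}"
proof (subst openin_subopen, intro ballI)
  fix T assume T: "T \<in> {T \<in> MPT M. approximable M T h \<epsilon> f}"
  then have TM: "T \<in> MPT M" by simp
  obtain n :: nat and c where n: "nrm M (\<lambda>x. h x - (\<Sum>i<n. c i * orbit_fun (tinv M T) f i x)) < \<epsilon>"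
    using T unfolding approximable_def by blast
  define p where "p S x = (\<Sum>i<n. c i * orbit_fun (tinv M S) f i x)" for S x
  have wc: "weakly_continuous M p" unfolding p_def[abs_def] by (rule weakly_continuous_orbit_comb[OF M f])
  define \<gamma> where "\<gamma> = \<epsilon> - nrm M (\<lambda>x. h x - p T x)"
  have "\<gamma> > 0" using n by (simp add: \<gamma>_def p_def)
  from weakly_continuousD(2)[OF wc TM this] obtain W where
    W: "openin (weak_topology M) W" "T \<in> W" "\<And>S. S \<in> W \<Longrightarrow> nrm M (\<lambda>x. p S x - p T x) < \<gamma>" by blast
  have "W \<subseteq> {T \<in> MPT M. approximable M T h \<epsilon> f}"
  proof
    fix S assume S: "S \<in> W"
    have SM: "S \<in> MPT M" by (rule openin_weak_subset[OF M W(1) S])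
    have "nrm M (\<lambda>x. h x - p S x) \<le> nrm M (\<lambda>x. h x - p T x) + nrm M (\<lambda>x. p T x - p S x)"
      by (rule nrm_triangle_diff[OF h weakly_continuousD(1)[OF wc TM] weakly_continuousD(1)[OF wc SM]])
    moreover have "nrm M (\<lambda>x. p T x - p S x) < \<gamma>" using W(3)[OF S] by (subst nrm_minus_commute)
    ultimately have "nrm M (\<lambda>x. h x - p S x) < \<epsilon>" by (simp add: \<gamma>_def)
    then show "S \<in> {T \<in> MPT M. approximable M T h \<epsilon> f}" using SM unfolding approximable_def p_def by blast
  qed
  then show "\<exists>W. openin (weak_topology M) W \<and> T \<in> W \<and> W \<subseteq> {T \<in> MPT M. approximable M T h \<epsilon> f}"
    using W(1,2) by blast
qed

text \<open>
  For a fixed polynomial the operator is Lipschitz, with the sum of the absolute values of the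
  coefficients as a constant.
\<close>

lemma approximable_open:
  assumes M: "prob_space M" and T: "T \<in> MPT M" and f: "f \<in> l2_fun M" and h: "h \<in> l2_fun M"
    and app: "approximable M T h \<epsilon> f"
  shows "\<exists>\<delta>>0. \<forall>g\<in>l2_fun M. nrm M (\<lambda>x. f x - g x) < \<delta> \<longrightarrow> approximable M T h \<epsilon> g"
proof -
  note s = ess_isoD[OF ess_iso_sym[OF ess_iso_rep_tinv[OF M T]]]
  note ol = orbit_fun_l2[OF s(1,3)]
  obtain n :: nat and c where n: "nrm M (\<lambda>x. h x - (\<Sum>i<n. c i * orbit_fun (tinv M T) f i x)) < \<epsilon>"
    using app unfolding approximable_def by blast
  define p where "p g x = (\<Sum>i<n. c i * orbit_fun (tinv M T) g i x)" for g x
  have pl: "p g \<in> l2_fun M" if "g \<in> l2_fun M" for g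
    unfolding p_def[abs_def] by (intro l2_fun_lincomb ol(1) that)
  define C where "C = (\<Sum>i<n. cmod (c i)) + 1"
  have C: "C > 0" unfolding C_def by (intro add_nonneg_pos sum_nonneg) auto
  have lip: "nrm M (\<lambda>x. p f x - p g x) \<le> C * nrm M (\<lambda>x. f x - g x)" if g: "g \<in> l2_fun M" for g
  proof -
    have d: "(\<lambda>x. f x - g x) \<in> l2_fun M" by (rule l2_fun_diff[OF f g])
    have "(\<lambda>x. p f x - p g x) = (\<lambda>x. \<Sum>i<n. c i * orbit_fun (tinv M T) (\<lambda>x. f x - g x) i x)"
      by (simp add: p_def orbit_fun_def sum_subtractf right_diff_distrib)
    then have "nrm M (\<lambda>x. p f x - p g x) \<le> (\<Sum>i<n. nrm M (\<lambda>x. c i * orbit_fun (tinv M T) (\<lambda>x. f x - g x) i x))"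
      by (simp only:) (intro nrm_sum l2_fun_scale ol(1) d)
    also have "\<dots> = (\<Sum>i<n. cmod (c i)) * nrm M (\<lambda>x. f x - g x)"
      unfolding nrm_scale ol(2)[OF d] by (simp add: sum_distrib_right)
    also have "\<dots> \<le> C * nrm M (\<lambda>x. f x - g x)" unfolding C_def by (intro mult_right_mono) auto
    finally show ?thesis .
  qed
  define \<gamma> where "\<gamma> = \<epsilon> - nrm M (\<lambda>x. h x - p f x)"
  have \<gamma>: "\<gamma> > 0" using n by (simp add: \<gamma>_def p_def)
  show ?thesis
  proof (intro exI[of _ "\<gamma> / C"] conjI ballI impI)
    show "\<gamma> / C > 0" using \<gamma> C by simp
    fix g assume g: "g \<in> l2_fun M" "nrm M (\<lambda>x. f x - g x) < \<gamma> / C"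
    have "nrm M (\<lambda>x. h x - p g x) \<le> nrm M (\<lambda>x. h x - p f x) + nrm M (\<lambda>x. p f x - p g x)"
      by (rule nrm_triangle_diff[OF h pl[OF f] pl[OF g(1)]])
    moreover have "C * nrm M (\<lambda>x. f x - g x) < \<gamma>" using g(2) C by (simp add: pos_less_divide_eq mult.commute)
    ultimately have "nrm M (\<lambda>x. h x - p g x) < \<epsilon>" using lip[OF g(1)] by (simp add: \<gamma>_def)
    then show "approximable M T h \<epsilon> g" unfolding approximable_def p_def by blast
  qed
qed

text \<open>
  A countable dense family of vectors: lists over a countable type encode the combinations of the
  vectors \<open>e k\<close> with coefficients whose real and imaginary parts are rational.
\<close>

definition rational_comb :: "(int \<Rightarrow> 'a \<Rightarrow> complex) \<Rightarrow> ((rat \<times> rat) \<times> int) list \<Rightarrow> 'a \<Rightarrow> complex" where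
  "rational_comb e xs x = (\<Sum>i<length xs. Complex (of_rat (fst (fst (xs ! i)))) (of_rat (snd (fst (xs ! i)))) * e (snd (xs ! i)) x)"

lemma complex_rational_dense:
  assumes "\<epsilon> > 0" shows "\<exists>r. cmod (z - Complex (of_rat (fst r)) (of_rat (snd r))) < \<epsilon>"
proof -
  have rat: "\<exists>r. \<bar>t - of_rat r\<bar> < \<epsilon>/2" for t :: real
  proof -
    obtain r where "t - \<epsilon>/2 < of_rat r" "of_rat r < t + \<epsilon>/2"
      using of_rat_dense[of "t - \<epsilon>/2" "t + \<epsilon>/2"] assms by auto
    then have "\<bar>t - of_rat r\<bar> < \<epsilon>/2" by linarith
    then show ?thesis by blast
  qed
  obtain p q where "\<bar>Re z - of_rat p\<bar> < \<epsilon>/2" "\<bar>Im z - of_rat q\<bar> < \<epsilon>/2" using rat[of "Re z"] rat[of "Im z"] by blast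
  then have "cmod (z - Complex (of_rat p) (of_rat q)) < \<epsilon>"
    using cmod_le[of "z - Complex (of_rat p) (of_rat q)"] by simp
  then show ?thesis by (intro exI[of _ "(p, q)"]) simp
qed

lemma rational_comb_l2:
  assumes "\<And>k. e k \<in> l2_fun M" shows "rational_comb e xs \<in> l2_fun M"
  unfolding rational_comb_def[abs_def] by (intro l2_fun_lincomb assms)

lemma rational_comb_dense:
  assumes e: "\<And>k. e k \<in> l2_fun M" "\<And>k. nrm M (e k) = 1" and tot: "cspan M (range e) = l2_fun M"
    and f: "f \<in> l2_fun M" and \<epsilon>: "\<epsilon> > 0"
  shows "\<exists>xs. nrm M (\<lambda>x. f x - rational_comb e xs x) < \<epsilon>"
proof -
  have "f \<in> cspan M (range e)" using f tot by simp
  moreover have e2: "\<epsilon>/2 > 0" using \<epsilon> by simp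
  ultimately obtain n :: nat and c d where d: "\<forall>i<n. d i \<in> range e" "nrm M (\<lambda>x. f x - (\<Sum>i<n. c i * d i x)) < \<epsilon>/2"
    unfolding cspan_def by blast
  have "\<forall>i. \<exists>k. i < n \<longrightarrow> d i = e k" using d(1) by blast
  then obtain k where k: "\<And>i. i < n \<Longrightarrow> d i = e (k i)" unfolding choice_iff by blast
  have \<gamma>: "\<epsilon> / (2 * (real n + 1)) > 0" using \<epsilon> by simp
  have "\<forall>i. \<exists>r. cmod (c i - Complex (of_rat (fst r)) (of_rat (snd r))) < \<epsilon> / (2 * (real n + 1))"
    using complex_rational_dense[OF \<gamma>] by blast
  then obtain r where r: "\<And>i. cmod (c i - Complex (of_rat (fst (r i))) (of_rat (snd (r i)))) < \<epsilon> / (2 * (real n + 1))"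
    by metis
  define xs where "xs = map (\<lambda>i. (r i, k i)) [0..<n]"
  have rc: "rational_comb e xs = (\<lambda>x. \<Sum>i<n. Complex (of_rat (fst (r i))) (of_rat (snd (r i))) * e (k i) x)"
    by (simp add: rational_comb_def[abs_def] xs_def)
  have l: "(\<lambda>x. \<Sum>i<n. c i * d i x) \<in> l2_fun M" using e k by (intro l2_fun_lincomb) auto
  have "(\<lambda>x. (\<Sum>i<n. c i * d i x) - rational_comb e xs x) =
      (\<lambda>x. \<Sum>i<n. (c i - Complex (of_rat (fst (r i))) (of_rat (snd (r i)))) * e (k i) x)"
    unfolding rc sum_subtractf[symmetric] by (intro ext sum.cong) (auto simp: k left_diff_distrib)
  then have "nrm M (\<lambda>x. (\<Sum>i<n. c i * d i x) - rational_comb e xs x) \<le>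
      (\<Sum>i<n. nrm M (\<lambda>x. (c i - Complex (of_rat (fst (r i))) (of_rat (snd (r i)))) * e (k i) x))"
    by (simp only:) (intro nrm_sum l2_fun_scale e(1))
  also have "\<dots> \<le> (\<Sum>i<n. \<epsilon> / (2 * (real n + 1)))"
    unfolding nrm_scale e(2) using r by (intro sum_mono) (simp add: less_imp_le)
  also have "\<dots> \<le> \<epsilon>/2" using \<epsilon> by (simp add: field_simps)
  finally have "nrm M (\<lambda>x. (\<Sum>i<n. c i * d i x) - rational_comb e xs x) \<le> \<epsilon>/2" .
  then have "nrm M (\<lambda>x. f x - rational_comb e xs x) < \<epsilon>"
    using nrm_triangle_diff[OF f l rational_comb_l2[of e M xs, OF e(1)]] d(2) by linarith
  then show ?thesis by blast
qed

text \<open>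
  \<open>O1 k m xs l\<close> demands that some vector near \<open>rational_comb e xs\<close> is mapped near \<open>e k\<close> by a
  polynomial in the operator. These are countably many open conditions on \<open>T\<close>. Their intersection contains the
  dense set \<open>D\<close>, so its density needs no completeness of the space of transformations. For \<open>T\<close> in the
  intersection, the vectors that reach the \<open>1/(m+1)\<close>-ball around \<open>e k\<close> form an open dense set, and
  Baire's theorem in \<open>L\<^sup>2\<close> finishes the proof.
\<close>

theorem generic_transformations:
  assumes M: "prob_space M"
    and e: "\<And>k. e k \<in> l2_fun M" "\<And>k. nrm M (e k) = 1" and tot: "cspan M (range (e :: int \<Rightarrow> _)) = l2_fun M"
    and D: "dense_in (weak_topology M) D"
      "\<And>T. T \<in> D \<Longrightarrow> generic_in (L2_topology M) {f \<in> L2 M. asymp_lin_predictive M T f}"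
  shows "\<exists>G. generic_in (weak_topology M) G \<and>
    (\<forall>T\<in>G. generic_in (L2_topology M) {f \<in> L2 M. asymp_lin_predictive M T f})"
proof -
  define O1 where "O1 k m xs l = {T \<in> MPT M. \<exists>f\<in>l2_fun M.
    nrm M (\<lambda>x. rational_comb e xs x - f x) < 1 / (real l + 1) \<and> approximable M T (e k) (1 / (real m + 1)) f}"
    for k and m :: nat and xs and l :: nat
  define G where "G = (\<Inter>(k, m, xs, l)\<in>UNIV. O1 k m xs l)"
  have opO: "openin (weak_topology M) (O1 k m xs l)" for k m xs l
  proof -
    have "O1 k m xs l = (\<Union>f\<in>{f\<in>l2_fun M. nrm M (\<lambda>x. rational_comb e xs x - f x) < 1 / (real l + 1)}.
        {T \<in> MPT M. approximable M T (e k) (1 / (real m + 1)) f})"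
      by (auto simp: O1_def)
    then show ?thesis using openin_approximable[OF M _ e(1)] by auto
  qed
  have DM: "D \<subseteq> MPT M" using D(1) by (simp add: dense_in_def topspace_weak[OF M])
  have DG: "D \<subseteq> G"
  proof
    fix T assume T: "T \<in> D"
    have TM: "T \<in> MPT M" using T DM by auto
    have "T \<in> O1 k m xs l" for k m xs l
    proof -
      have rl: "rational_comb e xs \<in> l2_fun M" by (rule rational_comb_l2[OF e(1)])
      obtain R where R: "dense_in (L2_topology M) R" "R \<subseteq> {f \<in> L2 M. asymp_lin_predictive M T f}"
        using D(2)[OF T] by (auto simp: generic_in_def)
      define R' where "R' = {f \<in> l2_fun M. l2_class M f \<in> R}"
      have R': "l2_class M ` R' = R"
      proof (intro equalityI subsetI)
        fix F assume F: "F \<in> R"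
        then have "F \<in> L2 M" using R(2) by auto
        then obtain f where f: "f \<in> l2_fun M" "F = l2_class M f" by (rule L2_cases)
        then show "F \<in> l2_class M ` R'" using F by (auto simp: R'_def)
      qed (auto simp: R'_def)
      have "l2_class M (rational_comb e xs) \<in> L2_topology M closure_of (l2_class M ` R')"
        using R(1) l2_class_in_L2[OF rl] unfolding R' by (simp add: dense_in_def)
      then have "\<forall>\<epsilon>>0. \<exists>f\<in>R'. nrm M (\<lambda>x. rational_comb e xs x - f x) < \<epsilon>"
        by (subst (asm) l2_class_in_closure_iff[OF rl]) (auto simp: R'_def)
      moreover have "1 / (real l + 1) > 0" by simp
      ultimately obtain f where f: "f \<in> R'" "nrm M (\<lambda>x. rational_comb e xs x - f x) < 1 / (real l + 1)" by blast
      then have fl: "f \<in> l2_fun M" "asymp_lin_predictive M T (l2_class M f)" using R(2) by (auto simp: R'_def)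
      have "approximable M T (e k) (1 / (real m + 1)) f"
        by (rule approximable_if_predictive[OF M TM fl(1) e(1) fl(2)]) simp
      then show ?thesis using TM fl(1) f(2) by (auto simp: O1_def)
    qed
    then show "T \<in> G" by (auto simp: G_def)
  qed
  have GM: "G \<subseteq> MPT M" by (auto simp: G_def O1_def)
  have "gdelta_in (weak_topology M) G" unfolding G_def
    by (rule gdelta_in_Inter) (auto intro: open_imp_gdelta_in opO)
  moreover have "dense_in (weak_topology M) G"
    using D(1) closure_of_mono[OF DG, of "weak_topology M"] GM closure_of_subset_topspace[of "weak_topology M" G]
    unfolding dense_in_def topspace_weak[OF M] by auto
  ultimately have gen: "generic_in (weak_topology M) G"
    using GM unfolding generic_in_def topspace_weak[OF M] by blast
  have "generic_in (L2_topology M) {f \<in> L2 M. asymp_lin_predictive M T f}" if T: "T \<in> G" for T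
  proof -
    have TM: "T \<in> MPT M" using T GM by auto
    let ?P = "\<lambda>(k, m::nat). approximable M T (e k) (1 / (real m + 1))"
    show ?thesis
    proof (rule generic_L2I(1)[OF M, of "UNIV :: (int \<times> nat) set" ?P])
      show "\<exists>\<delta>>0. \<forall>g\<in>l2_fun M. nrm M (\<lambda>x. f x - g x) < \<delta> \<longrightarrow> ?P i g"
        if "f \<in> l2_fun M" "?P i f" for i f
        using approximable_open[OF M TM that(1) e(1)] that(2) by (cases i) simp
      show "\<exists>g\<in>l2_fun M. ?P i g \<and> nrm M (\<lambda>x. f x - g x) < \<epsilon>"
        if f: "f \<in> l2_fun M" and \<epsilon>: "\<epsilon> > 0" for i f and \<epsilon> :: real
      proof -
        obtain k m where i: "i = (k, m)" by (cases i)
        have e2: "\<epsilon>/2 > 0" using \<epsilon> by simp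
        obtain xs where xs: "nrm M (\<lambda>x. f x - rational_comb e xs x) < \<epsilon>/2"
          using rational_comb_dense[OF e tot f e2] by blast
        obtain l :: nat where l: "1 / (real l + 1) < \<epsilon>/2" using nat_approx_posE[OF e2] by (auto simp: add.commute)
        have "T \<in> O1 k m xs l" using T by (auto simp: G_def)
        then obtain g where g: "g \<in> l2_fun M" "nrm M (\<lambda>x. rational_comb e xs x - g x) < 1 / (real l + 1)"
          "approximable M T (e k) (1 / (real m + 1)) g" by (auto simp: O1_def)
        have "nrm M (\<lambda>x. f x - g x) < \<epsilon>"
          using nrm_triangle_diff[OF f rational_comb_l2[of e M xs, OF e(1)] g(1)] xs g(2) l by linarith
        then show ?thesis using g i by auto
      qed
      show "l2_class M f \<in> {f \<in> L2 M. asymp_lin_predictive M T f}"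
        if f: "f \<in> l2_fun M" and P: "\<And>i. i \<in> UNIV \<Longrightarrow> ?P i f" for f
      proof -
        have "asymp_lin_predictive M T (l2_class M f)"
        proof (rule predictive_if_approximable[OF M TM f _ tot])
          show "range e \<subseteq> l2_fun M" using e(1) by auto
          fix h and m :: nat assume "h \<in> range e"
          then obtain k where "h = e k" by (rule rangeE)
          then show "approximable M T h (1 / (real m + 1)) f" using P[of "(k, m)"] by simp
        qed
        then show ?thesis using l2_class_in_L2[OF f] by simp
      qed
    qed auto
  qed
  then show ?thesis using gen by blast
qed

theorem mainTheorem1:
  fixes M :: "'a measure"
  assumes "standard_nonatomic_prob_space M"
  shows
    "(\<exists>D. dense_in (weak_topology M) D \<and>
        (\<forall>T\<in>D. prevalent_in_L2 M {f \<in> L2 M. asymp_lin_predictive M T f} \<and>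
                generic_in (L2_topology M) {f \<in> L2 M. asymp_lin_predictive M T f})) \<and>
     (\<exists>G. generic_in (weak_topology M) G \<and>
        (\<forall>T\<in>G. generic_in (L2_topology M) {f \<in> L2 M. asymp_lin_predictive M T f})) \<and>
     (\<exists>D. dense_in (weak_topology M) D \<and>
        (\<forall>T\<in>D. \<forall>f\<in>L2 M. weakly_lin_asymp_predictive M T f)) \<and>
     (\<forall>T\<in>MPT M. discrete_spectrum M T \<longrightarrow>
        (\<forall>f\<in>L2 M. weakly_lin_asymp_predictive M T f))"
proof -
  have M: "prob_space M" using assms by (simp add: standard_nonatomic_prob_space_def)
  obtain u v N where c: "coordinate M u v N" using standard_has_coordinate[OF assms] by blast
  note um = coordinate_measurable[OF c]
  let ?D = "irrational_rotations M"
  note D = irrational_rotations_dense[OF M c]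
  have DT: "T \<in> MPT M \<and> prevalent_in_L2 M {f \<in> L2 M. asymp_lin_predictive M T f} \<and>
      generic_in (L2_topology M) {f \<in> L2 M. asymp_lin_predictive M T f} \<and> discrete_spectrum M T"
    if "T \<in> ?D" for T
  proof -
    obtain u v N a where r: "T = mpt_class M (v \<circ> rot a \<circ> u)" "coordinate M u v N" "a \<notin> \<rat>"
      using \<open>T \<in> ?D\<close> by (auto simp: irrational_rotations_def)
    have T: "T \<in> MPT M" using mpt_class(1)[OF M rotation_ess_iso(1)[OF r(2) M]] r(1) by simp
    interpret diagonal_system M "tinv M T" "fourier u" "\<lambda>k. cis (2 * pi * of_int k * (- a))"
      unfolding r(1) by (rule rotation_diagonal[OF r(2) M r(3)])
    show ?thesis using T prevalent_predictive[OF T refl] generic_predictive[OF T refl] discrete_spectrum[OF T refl]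
      by blast
  qed
  have weak: "weakly_lin_asymp_predictive M T f" if "T \<in> MPT M" "discrete_spectrum M T" "f \<in> L2 M" for T f
    by (rule discrete_spectrum_weakly_predictive[OF M that])
  show ?thesis
  proof (intro conjI)
    show "\<exists>D. dense_in (weak_topology M) D \<and>
        (\<forall>T\<in>D. prevalent_in_L2 M {f \<in> L2 M. asymp_lin_predictive M T f} \<and>
                generic_in (L2_topology M) {f \<in> L2 M. asymp_lin_predictive M T f})"
      using D DT by blast
    show "\<exists>G. generic_in (weak_topology M) G \<and>
        (\<forall>T\<in>G. generic_in (L2_topology M) {f \<in> L2 M. asymp_lin_predictive M T f})"
      by (rule generic_transformations[OF M fourier_l2[OF M um] fourier_total[OF c M] D]) (use DT in blast)
    show "\<exists>D. dense_in (weak_topology M) D \<and> (\<forall>T\<in>D. \<forall>f\<in>L2 M. weakly_lin_asymp_predictive M T f)"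
      using D DT weak by blast
    show "\<forall>T\<in>MPT M. discrete_spectrum M T \<longrightarrow> (\<forall>f\<in>L2 M. weakly_lin_asymp_predictive M T f)"
      using weak by blast
  qed
qed

end
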